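(* Let $F$ be a finite field of characteristic $2$. Let $n>m\ge 1$, $k\ge 2$, $l\in\{1,2\}$, $H_1\cong D_8$, $H_2\cong Q_8$, and let $$G_l\cong \bigl(M_2(m+1,1)\mathbin{\mathsf Y}H_l\mathbin{\mathsf Y}D_8^{\mathsf Y(k-2)}\bigr)\times\mathbb{Z}_{2^n},$$ with derived subgroup $\langle c\rangle$ of order $2$. Then: (i) If $m=1$, then $|\Omega_1(G_1)|=2^{2k+1}+2^{k+1}=|\Omega_c(G_2)|$ and $|\Omega_c(G_1)|=2^{2k+1}-2^{k+1}=|\Omega_1(G_2)|$. If $m\ge 2$, then $|\Omega_1(G_l)|=2^{2k+1}=|\Omega_c(G_l)|$ for $l=1,2$. (ii) $|V_*(FG_l)|=2|F|^{\frac{|G_l|+|\Omega_1(G_l)|}{2}-1}$ if $n>m=1$, and $|V_*(FG_l)|=4|F|^{\frac{|G_l|+|\Omega_1(G_l)|}{2}-1}$ if $n>m\ge 2$.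
   Context: $V(FG)=\{\sum_{g}\alpha_g g\in FG:\sum_g\alpha_g=1\}$; $(\sum_g\alpha_g g)^*=\sum_g\alpha_g g^{-1}$; $V_*(FG)=\{x\in V(FG):x^*=x^{-1}\}$. $\Omega_1(G)=\{g\in G:g^2=1\}$ and $\Omega_c(G)=\{g\in G: g^2=c\}$. $D_8$, $Q_8$ are the dihedral and quaternion groups of order $8$. $M_2(u,v)=\langle a,b\mid a^{2^u}=b^{2^v}=1,\ a^b=a^{1+2^{u-1}}\rangle$ for $u\ge2,v\ge1$ (so $M_2(2,1)\cong D_8$). $H\mathbin{\mathsf Y}K$ denotes the central product; here all central factors have derived subgroup of order $2$, and the central product is formed by identifying these derived subgroups with one common subgroup $\langle c\rangle$, so that factors intersect exactly in $\langle c\rangle$. $D_8^{\mathsf Y j}$ is the central product of $j$ copies of $D_8$ (omitted if $j=0$). *)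

theory Defs
  imports "HOL-Algebra.Algebra" "HOL-Library.Cardinality" "HOL-Computational_Algebra.Primes"
begin

section \<open>Groups given by a presentation\<close>

text \<open>A word is a list of letters; the letter \<open>(x, False)\<close> stands for the generator \<open>x\<close> and
  \<open>(x, True)\<close> for its inverse. A relation \<open>u = v\<close> is recorded as the pair \<open>(u, v)\<close>.\<close>

type_synonym 'x word = "('x \<times> bool) list"

inductive pres_eq :: "('x word \<times> 'x word) set \<Rightarrow> 'x word \<Rightarrow> 'x word \<Rightarrow> bool"
  for R :: "('x word \<times> 'x word) set" where
  rel: "(u, v) \<in> R \<Longrightarrow> pres_eq R u v"
| cancel: "pres_eq R [(x, e), (x, \<not> e)] []"
| cong: "pres_eq R u v \<Longrightarrow> pres_eq R (p @ u @ q) (p @ v @ q)"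
| refl: "pres_eq R u u"
| sym: "pres_eq R u v \<Longrightarrow> pres_eq R v u"
| trans: "pres_eq R u v \<Longrightarrow> pres_eq R v w \<Longrightarrow> pres_eq R u w"

definition pres_class :: "('x word \<times> 'x word) set \<Rightarrow> 'x word \<Rightarrow> 'x word set" where
  "pres_class R w = {v. pres_eq R w v}"

text \<open>The generators are all elements of the type \<open>'x\<close>.\<close>

definition presented_group :: "('x word \<times> 'x word) set \<Rightarrow> 'x word set monoid" where
  "presented_group R =
     \<lparr>carrier = range (pres_class R),
      monoid.mult = (\<lambda>A B. \<Union>u\<in>A. \<Union>v\<in>B. pres_class R (u @ v)),
      one = pres_class R []\<rparr>"

datatype gen2 = GenA | GenB

definition apow :: "nat \<Rightarrow> gen2 word" where
  "apow n = replicate n (GenA, False)"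

definition bpow :: "nat \<Rightarrow> gen2 word" where
  "bpow n = replicate n (GenB, False)"

text \<open>The word for \<open>a\<^sup>b = b\<^sup>-\<^sup>1 a b\<close>.\<close>

definition a_conj_b :: "gen2 word" where
  "a_conj_b = [(GenB, True), (GenA, False), (GenB, False)]"

definition M2 :: "nat \<Rightarrow> nat \<Rightarrow> gen2 word set monoid" where
  "M2 u v = presented_group
     {(apow (2 ^ u), []), (bpow (2 ^ v), []), (a_conj_b, apow (1 + 2 ^ (u - 1)))}"

definition D8 :: "gen2 word set monoid" where
  "D8 = presented_group {(apow 4, []), (bpow 2, []), (a_conj_b, [(GenA, True)])}"

definition Q8 :: "gen2 word set monoid" where
  "Q8 = presented_group {(apow 4, []), (bpow 2, apow 2), (a_conj_b, [(GenA, True)])}"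


section \<open>Central products\<close>

text \<open>Central product of a list of groups whose derived subgroups all have order 2: the quotient
  of the direct product by the (central) subgroup generated by the elements that have the
  nontrivial element \<open>x\<close> of the \<open>i\<close>-th derived subgroup at position \<open>i\<close>, the inverse of the
  nontrivial element \<open>y\<close> of the \<open>j\<close>-th derived subgroup at position \<open>j\<close>, and the identity
  elsewhere. Thus all the derived subgroups become identified with one common subgroup.\<close>

definition identifying_elems :: "('a, 'm) monoid_scheme list \<Rightarrow> (nat \<Rightarrow> 'a) set" where
  "identifying_elems Gs =
     {(\<lambda>t\<in>{..<length Gs}.
         if t = i then x else if t = j then inv\<^bsub>Gs ! j\<^esub> y else \<one>\<^bsub>Gs ! t\<^esub>) | i j x y.
      i < length Gs \<and> j < length Gs \<and> i \<noteq> j \<and>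
      x \<in> derived (Gs ! i) (carrier (Gs ! i)) \<and> x \<noteq> \<one>\<^bsub>Gs ! i\<^esub> \<and>
      y \<in> derived (Gs ! j) (carrier (Gs ! j)) \<and> y \<noteq> \<one>\<^bsub>Gs ! j\<^esub>}"

definition central_product :: "('a, 'm) monoid_scheme list \<Rightarrow> (nat \<Rightarrow> 'a) set monoid" where
  "central_product Gs =
     (let P = product_group {..<length Gs} ((!) Gs)
      in P Mod generate P (identifying_elems Gs))"


section \<open>Square roots of a group element\<close>

definition \<Omega>\<^sub>c :: "('a, 'm) monoid_scheme \<Rightarrow> 'a \<Rightarrow> 'a set" where
  "\<Omega>\<^sub>c G c = {g \<in> carrier G. g [^]\<^bsub>G\<^esub> (2::nat) = c}"

abbreviation \<Omega>\<^sub>1 :: "('a, 'm) monoid_scheme \<Rightarrow> 'a set" where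
  "\<Omega>\<^sub>1 G \<equiv> \<Omega>\<^sub>c G \<one>\<^bsub>G\<^esub>"


section \<open>Group algebras and unitary units\<close>

text \<open>The coefficient ring is a type; elements of the group algebra are finitely supported
  coefficient functions vanishing outside the group.\<close>

definition group_algebra :: "('g, 'm) monoid_scheme \<Rightarrow> ('g \<Rightarrow> 'f::comm_ring_1) ring" where
  "group_algebra G =
     \<lparr>carrier = {x. finite {g. x g \<noteq> 0} \<and> (\<forall>g. g \<notin> carrier G \<longrightarrow> x g = 0)},
      monoid.mult = (\<lambda>x y g. if g \<in> carrier G
         then \<Sum>h | h \<in> carrier G \<and> x h \<noteq> 0. x h * y (inv\<^bsub>G\<^esub> h \<otimes>\<^bsub>G\<^esub> g) else 0),
      monoid.one = (\<lambda>g. if g = \<one>\<^bsub>G\<^esub> then 1 else 0),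
      ring.zero = (\<lambda>g. 0),
      ring.add = (\<lambda>x y g. x g + y g)\<rparr>"

definition aug :: "('g, 'm) monoid_scheme \<Rightarrow> ('g \<Rightarrow> 'f::comm_ring_1) \<Rightarrow> 'f" where
  "aug G x = (\<Sum>g | g \<in> carrier G \<and> x g \<noteq> 0. x g)"

definition fg_star :: "('g, 'm) monoid_scheme \<Rightarrow> ('g \<Rightarrow> 'f::comm_ring_1) \<Rightarrow> 'g \<Rightarrow> 'f" where
  "fg_star G x = (\<lambda>g. if g \<in> carrier G then x (inv\<^bsub>G\<^esub> g) else 0)"

definition normalized_V :: "('g, 'm) monoid_scheme \<Rightarrow> ('g \<Rightarrow> 'f::comm_ring_1) set" where
  "normalized_V G = {x \<in> carrier (group_algebra G). aug G x = 1}"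

text \<open>Membership in \<open>Units\<close> expresses that \<open>x\<^sup>-\<^sup>1\<close> exists; it is automatic for \<open>x \<in> normalized_V G\<close>
  when \<open>G\<close> is a finite \<open>p\<close>-group over a field of characteristic \<open>p\<close>.\<close>

definition unitary_V :: "('g, 'm) monoid_scheme \<Rightarrow> ('g \<Rightarrow> 'f::comm_ring_1) set" where
  "unitary_V G = {x \<in> normalized_V G. x \<in> Units (group_algebra G) \<and>
     fg_star G x = inv\<^bsub>group_algebra G\<^esub> x}"

end

theory Submission
  imports Defs "HOL-Library.Function_Algebras"
begin

text \<open>Let \<open>c\<close> be a central involution of \<open>G\<close> with \<open>H = G / \<langle>c\<rangle>\<close> abelian. The elements \<open>x\<close> of \<open>FG\<close> whose
  image in \<open>FH\<close> is unitary form a group \<open>T\<close>, and \<open>\<delta>(x) = x x\<^sup>* + 1\<close> is a homomorphism from \<open>T\<close> to an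
  additive group \<open>D\<close> of symmetric elements of \<open>(1 + c) FG\<close>; its kernel is \<open>V\<^sub>*(FG)\<close>, so \<open>|V\<^sub>*(FG)|\<close> is obtained
  from \<open>|V\<^sub>*(FH)|\<close> once the image of \<open>\<delta>\<close> is known. The identity
  \<open>\<delta>(1 + b (u + w)) = b (u + u\<inverse> + w + w\<inverse>) + b\<^sup>2 (u w\<inverse> + w u\<inverse>)\<close> shows that \<open>\<delta>\<close> is onto if every \<open>g\<close> with
  \<open>g\<^sup>2 = c\<close> either fails to commute with some involution or commutes with a square \<open>u\<^sup>2\<close> such that
  \<open>u\<^sup>4 = c\<close>. If \<open>G\<close> is abelian and maps to the cyclic group of order 4 with \<open>c \<mapsto> 2\<close>, the image has
  index 2, cut out by an Artin-Schreier condition. Starting from elementary abelian groups, where \<open>V\<^sub>* = V\<close>,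
  each cyclic factor of order at least 4 of \<open>H\<close> thus contributes a factor 2, and the last step from \<open>H\<close> to
  \<open>G\<close> contributes nothing.

  The square roots of \<open>1\<close> and \<open>c\<close> are counted in a model of \<open>G\<close> as a cocycle extension of a cyclic group by an
  elementary abelian group: for \<open>m \<ge> 2\<close> a central square root of \<open>c\<close> exchanges the two sets, for \<open>m = 1\<close> the
  difference of their sizes is a Gauss sum that factors over the factors of the central product.\<close>

section \<open>Group algebras of finite groups in characteristic two\<close>

text \<open>Everything rests on two properties of the kernel \<open>K\<close> = (1 + c)FG of the map
  FG -> FH: its square is zero because (1 + c)^2 = 0, and it is central because all commutators lie
  in {1, c}. They make \<delta> turn products into sums and make 1 + \<delta>(x) its own inverse, so
  that |V_*(FG)| |im \<delta>| = |V_*(FH)| |F|^|H|. The dimension of \<open>D\<close> is the number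
  of orbits outside \<Omega>_1(G) under inversion and multiplication by c. An orbit has two elements
  if g^2 = c and four otherwise. Together with |\<Omega>_1(G)| + |\<Omega>_c(G)| = 2 |\<Omega>_1(H)|
  this shows that passing from H to G multiplies the factor t of \<open>theta\<close> by exactly the
  index of im \<delta> in \<open>D\<close>. Four-element orbits always lie in the image, so the
  square roots of c are the only obstacle. The constants 2 and 4 come from the index 2 of {b^2 + b}
  in F. Here H is Z_(2^m) x Z_(2^n) x E with E elementary abelian and n >= 2: within a cyclic factor
  only the step from Z_2 to Z_4 doubles t, and it occurs once if m = 1 and twice if m >= 2.\<close>

definition FG :: "('g, 'm) monoid_scheme \<Rightarrow> ('g \<Rightarrow> 'f::comm_ring_1) set" where
  "FG G = {x. \<forall>g. g \<notin> carrier G \<longrightarrow> x g = 0}"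

text \<open>\<open>FG\<close> and \<open>conv\<close> replace the carrier and the product of
  \<open>group_algebra\<close> for finite groups: without support conditions the sums range over the
  whole carrier and can be reindexed freely. \<open>group_algebra_simps\<close> gives the
  link.\<close>

definition conv :: "('g, 'm) monoid_scheme \<Rightarrow> ('g \<Rightarrow> 'f::comm_ring_1) \<Rightarrow> ('g \<Rightarrow> 'f) \<Rightarrow> 'g \<Rightarrow> 'f" where
  "conv G x y = (\<lambda>g. if g \<in> carrier G
     then \<Sum>h\<in>carrier G. x h * y (inv\<^bsub>G\<^esub> h \<otimes>\<^bsub>G\<^esub> g) else 0)"

text \<open>The monomial a g of the group algebra.\<close>

definition sing :: "'g \<Rightarrow> 'f \<Rightarrow> 'g \<Rightarrow> 'f::comm_ring_1" where
  "sing g a = (\<lambda>h. if h = g then a else 0)"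

text \<open>In characteristic 2 the condition \<open>x x\<^sup>* = 1\<close> forces the augmentation of \<open>x\<close> to be 1.\<close>

definition unitaries :: "('g, 'm) monoid_scheme \<Rightarrow> ('g \<Rightarrow> 'f::comm_ring_1) set" where
  "unitaries G = {x \<in> FG G. conv G x (fg_star G x) = sing \<one>\<^bsub>G\<^esub> 1}"

text \<open>The linear extension of \<open>\<phi>\<close> to the group algebras; for a homomorphism
  it respects product and involution by \<open>push_conv\<close> and
  \<open>push_star\<close>.\<close>

definition push :: "('g \<Rightarrow> 'h) \<Rightarrow> ('g, 'm) monoid_scheme \<Rightarrow> ('g \<Rightarrow> 'f::comm_ring_1) \<Rightarrow> 'h \<Rightarrow> 'f" where
  "push \<phi> G x = (\<lambda>k. \<Sum>g | g \<in> carrier G \<and> \<phi> g = k. x g)"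

text \<open>The orbits of the fixed-point-free involution \<open>i\<close> have two elements with
  equal values, which cancel. The induction removes one orbit at a time.\<close>

lemma sum_involution_eq_0:
  fixes f :: "'a \<Rightarrow> 'b::comm_monoid_add"
  assumes "finite S" and two: "\<And>x::'b. x + x = 0"
    and "\<And>s. s \<in> S \<Longrightarrow> i s \<in> S" and "\<And>s. s \<in> S \<Longrightarrow> i (i s) = s"
    and "\<And>s. s \<in> S \<Longrightarrow> i s \<noteq> s" and "\<And>s. s \<in> S \<Longrightarrow> f (i s) = f s"
  shows "sum f S = 0"
  using assms(1,3-)
proof (induction S rule: finite_psubset_induct)
  case (psubset S)
  show ?case
  proof (cases "S = {}")
    case False
    then obtain s where s: "s \<in> S" by auto
    let ?S = "S - {s, i s}"
    have "sum f S = sum f ?S + sum f {s, i s}"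
      using s psubset by (intro sum.subset_diff) auto
    moreover have "sum f {s, i s} = 0"
      using psubset.prems(3)[OF s] psubset.prems(4)[OF s] two by auto
    moreover have "sum f ?S = 0"
    proof (rule psubset.IH)
      show "?S \<subset> S" using s by auto
      fix t assume t: "t \<in> ?S"
      show "i t \<in> ?S" using t s psubset.prems(1,2)
        by (metis DiffD1 DiffD2 DiffI insertCI insertE singletonD)
    qed (use psubset.prems in auto)
    ultimately show ?thesis by simp
  qed auto
qed

section \<open>The group algebra with its involution\<close>

locale grp_alg = group G for G :: "('a, 'm) monoid_scheme" (structure) +
  fixes F :: "'f::finite_field itself"
  assumes fin: "finite (carrier G)" and char2: "CHAR('f) = 2"
begin

abbreviation "star \<equiv> fg_star G :: ('a \<Rightarrow> 'f) \<Rightarrow> 'a \<Rightarrow> 'f"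
abbreviation "A \<equiv> FG G :: ('a \<Rightarrow> 'f) set"
abbreviation cv :: "('a \<Rightarrow> 'f) \<Rightarrow> ('a \<Rightarrow> 'f) \<Rightarrow> 'a \<Rightarrow> 'f" (infixl "\<star>" 70) where "x \<star> y \<equiv> conv G x y"
abbreviation uno :: "'a \<Rightarrow> 'f" where "uno \<equiv> sing \<one> 1"

lemma r_inv_left [simp]: "g \<in> carrier G \<Longrightarrow> h \<in> carrier G \<Longrightarrow> g \<otimes> (inv g \<otimes> h) = h"
  and l_inv_left [simp]: "g \<in> carrier G \<Longrightarrow> h \<in> carrier G \<Longrightarrow> inv g \<otimes> (g \<otimes> h) = h"
  by (simp_all add: m_assoc[symmetric])

lemma two_eq_0 [simp]: "(2::'f) = 0"
  using char2 of_nat_CHAR[where 'a='f] by (metis of_nat_numeral)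

lemma two [simp]: "(x::'f) + x = 0"
  by (metis mult_2 mult_zero_left two_eq_0)

lemma twof [simp]: "(x::'b \<Rightarrow> 'f) + x = 0"
  by (auto simp: fun_eq_iff)

lemma twof_left [simp]: "(x::'b \<Rightarrow> 'f) + (x + y) = y"
  by (simp add: add.assoc[symmetric])

lemma two_left [simp]: "(x::'f) + (x + y) = y"
  by (simp add: add.assoc[symmetric])

lemma add_eq_0_char2: "(x::'b \<Rightarrow> 'f) + y = 0 \<longleftrightarrow> x = y"
  by (metis twof twof_left add.right_neutral)

lemma add_eq_0_char2': "(x::'f) + y = 0 \<longleftrightarrow> x = y"
  by (metis two two_left add.right_neutral)

lemma FG_add [simp]: "x \<in> A \<Longrightarrow> y \<in> A \<Longrightarrow> x + y \<in> A"
  and FG_0 [simp]: "0 \<in> A"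
  and conv_FG [simp]: "x \<star> y \<in> A"
  and star_FG [simp]: "star x \<in> A"
  and sing_FG [simp]: "g \<in> carrier G \<Longrightarrow> sing g a \<in> A"
  by (auto simp: FG_def conv_def fg_star_def sing_def)

lemma uno_FG [simp]: "uno \<in> A"
  by simp

lemma finite_FG [simp]: "finite A"
proof -
  have "inj_on (\<lambda>x. restrict x (carrier G)) A"
    by (auto simp: inj_on_def FG_def restrict_def fun_eq_iff) metis
  moreover have "(\<lambda>x. restrict x (carrier G)) ` A \<subseteq> (\<Pi>\<^sub>E g\<in>carrier G. UNIV)"
    by auto
  ultimately show ?thesis
    by (meson fin finite_PiE finite_UNIV finite_subset inj_on_finite finite_class.finite_UNIV)
qed

lemma card_FG: "card A = CARD('f) ^ order G"
proof -
  have "bij_betw (\<lambda>x. restrict x (carrier G)) A (\<Pi>\<^sub>E g\<in>carrier G. UNIV)"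
  proof (rule bij_betwI[where g = "\<lambda>y g. if g \<in> carrier G then y g else 0"])
  qed (auto simp: FG_def fun_eq_iff PiE_def extensional_def)
  then show ?thesis
    using fin by (simp add: bij_betw_same_card card_PiE order_def)
qed

lemma conv_add_left: "(x + y) \<star> z = x \<star> z + y \<star> z"
  and conv_add_right: "x \<star> (y + z) = x \<star> y + x \<star> z"
  by (auto simp: conv_def fun_eq_iff algebra_simps sum.distrib)

lemma star_add: "star (x + y) = star x + star y"
  by (auto simp: fg_star_def)

lemma conv_assoc: "x \<star> y \<star> z = x \<star> (y \<star> z)"
proof
  fix g
  show "(x \<star> y \<star> z) g = (x \<star> (y \<star> z)) g"
  proof (cases "g \<in> carrier G")
    case g: True
    have "(x \<star> y \<star> z) g = (\<Sum>k\<in>carrier G. \<Sum>h\<in>carrier G. x h * (y (inv h \<otimes> k) * z (inv k \<otimes> g)))"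
      using g by (simp add: conv_def sum_distrib_right mult.assoc)
    also have "\<dots> = (\<Sum>h\<in>carrier G. \<Sum>k\<in>carrier G. x h * (y (inv h \<otimes> k) * z (inv k \<otimes> g)))"
      by (rule sum.swap)
    also have "\<dots> = (\<Sum>h\<in>carrier G. \<Sum>k\<in>carrier G. x h * (y k * z (inv k \<otimes> (inv h \<otimes> g))))"
    proof (rule sum.cong[OF HOL.refl])
      fix h assume h: "h \<in> carrier G"
      have [simp]: "inv (inv h \<otimes> k) \<otimes> inv h \<otimes> g = inv k \<otimes> g" if "k \<in> carrier G" for k
        using that g h by (metis inv_closed inv_mult_group inv_inv l_one m_assoc m_closed r_inv)
      show "(\<Sum>k\<in>carrier G. x h * (y (inv h \<otimes> k) * z (inv k \<otimes> g))) =
            (\<Sum>k\<in>carrier G. x h * (y k * z (inv k \<otimes> (inv h \<otimes> g))))"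
        by (rule sum.reindex_bij_witness[where i = "\<lambda>k. h \<otimes> k" and j = "\<lambda>k. inv h \<otimes> k"])
          (use h g in \<open>auto simp: m_assoc[symmetric]\<close>)
    qed
    also have "\<dots> = (x \<star> (y \<star> z)) g"
      using g by (simp add: conv_def sum_distrib_left)
    finally show ?thesis .
  qed (simp add: conv_def)
qed

lemma conv_sing_left:
  assumes "g \<in> carrier G" "k \<in> carrier G" shows "(sing g a \<star> x) k = a * x (inv g \<otimes> k)"
proof -
  have "(sing g a \<star> x) k = (\<Sum>h\<in>carrier G. if h = g then a * x (inv h \<otimes> k) else 0)"
    using assms unfolding conv_def sing_def by (auto intro!: sum.cong)
  also have "\<dots> = a * x (inv g \<otimes> k)" using assms fin by simp
  finally show ?thesis .
qed

lemma star_sing [simp]: "g \<in> carrier G \<Longrightarrow> star (sing g a) = sing (inv g) a"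
  by (auto simp: fg_star_def sing_def fun_eq_iff)

lemma conv_sing [simp]:
  assumes "g \<in> carrier G" "h \<in> carrier G"
  shows "sing g a \<star> sing h b = sing (g \<otimes> h) (a * b)"
proof
  fix k show "(sing g a \<star> sing h b) k = sing (g \<otimes> h) (a * b) k"
  proof (cases "k \<in> carrier G")
    case True
    then have "inv g \<otimes> k = h \<longleftrightarrow> k = g \<otimes> h"
      using assms by (metis True inv_closed l_inv l_one m_assoc m_closed r_inv)
    then show ?thesis using True assms by (simp add: conv_sing_left) (simp add: sing_def)
  qed (use assms in \<open>auto simp: conv_def sing_def\<close>)
qed

lemma uno_conv [simp]: "x \<in> A \<Longrightarrow> uno \<star> x = x"
proof
  fix k assume "x \<in> A"
  then show "(uno \<star> x) k = x k"
  proof (cases "k \<in> carrier G")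
    case True
    then show ?thesis by (simp add: conv_sing_left)
  qed (auto simp: conv_def FG_def)
qed

lemma star_star [simp]: "x \<in> A \<Longrightarrow> star (star x) = x"
  by (auto simp: fg_star_def FG_def)

lemma star_uno [simp]: "star uno = uno"
  by simp

lemma star_conv: "star (x \<star> y) = star y \<star> star x"
proof
  fix g
  show "star (x \<star> y) g = (star y \<star> star x) g"
  proof (cases "g \<in> carrier G")
    case g: True
    have "star (x \<star> y) g = (\<Sum>h\<in>carrier G. x h * y (inv h \<otimes> inv g))"
      using g by (simp add: fg_star_def conv_def)
    also have "\<dots> = (\<Sum>h\<in>carrier G. y (inv h) * x (inv (inv h \<otimes> g)))"
      by (rule sum.reindex_bij_witness[where i = "\<lambda>h. inv (inv h \<otimes> g)" and j = "\<lambda>h. g \<otimes> h"])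
        (use g in \<open>auto simp: inv_mult_group m_assoc[symmetric]\<close>)
    also have "\<dots> = (star y \<star> star x) g"
      using g by (simp add: fg_star_def conv_def)
    finally show ?thesis .
  qed (simp add: fg_star_def conv_def)
qed

lemma conv_uno [simp]: assumes "x \<in> A" shows "x \<star> uno = x"
  using star_conv[of uno "star x"] assms by simp

lemma conv_0 [simp]: "0 \<star> x = 0" "x \<star> 0 = 0"
  by (auto simp: conv_def)

lemma sq_add: "((a::'f) + b) ^ 2 = a ^ 2 + b ^ 2"
  by (simp add: power2_eq_square algebra_simps)

lemma sq_sum: "(sum (f::'b \<Rightarrow> 'f) S) ^ 2 = (\<Sum>s\<in>S. f s ^ 2)"
  by (induction S rule: infinite_finite_induct) (auto simp: sq_add)

lemma inj_sq: "inj (\<lambda>a::'f. a ^ 2)"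
proof
  fix a b :: 'f assume "a\<^sup>2 = b\<^sup>2"
  then have "(a + b)\<^sup>2 = 0" by (simp add: sq_add)
  then show "a = b" by (simp add: add_eq_0_char2')
qed

text \<open>The Frobenius map of a finite field is injective, hence onto. Roots are needed because
  the decisive coefficients in \<open>dlt_two_eq\<close> occur squared.\<close>

lemma ex_sqrt: "\<exists>b::'f. a = b ^ 2"
  using finite_UNIV_inj_surj[OF finite_class.finite_UNIV inj_sq] by (metis surjD)

lemma conv_star_apply:
  assumes "g \<in> carrier G"
  shows "(x \<star> star x) g = (\<Sum>h\<in>carrier G. x h * x (inv g \<otimes> h))"
  using assms by (auto simp: conv_def fg_star_def inv_mult_group intro!: sum.cong)

lemma conv_star_sym: "star (x \<star> star x) = x \<star> star x" if "x \<in> A"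
  using that by (simp add: star_conv)

text \<open>The coefficient at 1 is the sum of the squares of all coefficients, and squaring is
  additive.\<close>

lemma conv_star_one: "(x \<star> star x) \<one> = (sum x (carrier G))\<^sup>2"
  unfolding sq_sum by (simp add: conv_star_apply power2_eq_square)

text \<open>Left translation by \<open>inv g\<close> pairs the terms of the sum: it has no fixed
  point since \<open>g\<close> differs from 1, and the summand is symmetric in its two
  factors.\<close>

lemma conv_star_involution:
  assumes "g \<in> carrier G" "g \<noteq> \<one>" "g \<otimes> g = \<one>"
  shows "(x \<star> star x) g = 0"
proof -
  have ig: "inv g = g" using assms by (simp add: inv_equality)
  have "(\<Sum>h\<in>carrier G. x h * x (inv g \<otimes> h)) = 0"
  proof (rule sum_involution_eq_0[where i = "\<lambda>h. inv g \<otimes> h"])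
    fix h assume h: "h \<in> carrier G"
    show "inv g \<otimes> h \<noteq> h" using assms h ig by (metis l_one one_closed right_cancel)
    show "inv g \<otimes> (inv g \<otimes> h) = h" using assms h ig by (simp add: m_assoc[symmetric])
    then show "x (inv g \<otimes> h) * x (inv g \<otimes> (inv g \<otimes> h)) = x h * x (inv g \<otimes> h)" by simp
  qed (use assms fin in auto)
  then show ?thesis using assms by (simp add: conv_star_apply)
qed

lemma unitaries_sum: "x \<in> unitaries G \<Longrightarrow> sum (x::'a \<Rightarrow> 'f) (carrier G) = 1"
proof -
  assume "x \<in> unitaries G"
  then have "(sum x (carrier G))\<^sup>2 = 1\<^sup>2"
    using conv_star_one[of x] by (simp add: unitaries_def sing_def)
  then show ?thesis using inj_sq by (metis injD)
qed

text \<open>Left multiplication by \<open>x\<close> undoes left multiplication by \<open>y\<close>,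
  so the latter is injective on a finite set and therefore onto. Thus \<open>y\<close> has a right
  inverse, which must be \<open>x\<close>.\<close>

lemma right_inv_left_inv:
  assumes "x \<in> A" "y \<in> A" "x \<star> y = uno" shows "y \<star> x = uno"
proof -
  have "inj_on (\<lambda>z. y \<star> z) A"
    by (rule inj_on_inverseI[where g = "\<lambda>z. x \<star> z"]) (simp add: conv_assoc[symmetric] assms)
  then have "(\<lambda>z. y \<star> z) ` A = A"
    by (intro endo_inj_surj) auto
  then obtain z where z: "z \<in> A" "y \<star> z = uno"
    using uno_FG by (metis imageE)
  then have "x = z"
    using assms conv_assoc[of x y z] by simp
  then show ?thesis using z by simp
qed

lemma group_algebra_simps:
  "x \<in> carrier (group_algebra G) \<longleftrightarrow> x \<in> A"
  "x \<otimes>\<^bsub>group_algebra G\<^esub> y = x \<star> y"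
  "\<one>\<^bsub>group_algebra G\<^esub> = uno"
proof -
  have "finite {g. x g \<noteq> 0}" if "x \<in> A" for x
    by (rule finite_subset[OF _ fin]) (use that in \<open>auto simp: FG_def\<close>)
  then show "x \<in> carrier (group_algebra G) \<longleftrightarrow> x \<in> A"
    by (auto simp: group_algebra_def FG_def)
  show "x \<otimes>\<^bsub>group_algebra G\<^esub> y = x \<star> y"
    by (auto simp: group_algebra_def conv_def fun_eq_iff fin intro!: sum.mono_neutral_left)
qed (auto simp: group_algebra_def sing_def)

lemma monoid_group_algebra: "Group.monoid (group_algebra G :: ('a \<Rightarrow> 'f) ring)"
  by (rule Group.monoid.intro) (auto simp: group_algebra_simps conv_assoc)

text \<open>The single equation in \<open>unitaries\<close> suffices: the algebra is finite, so a
  one-sided inverse is two-sided, and \<open>unitaries_sum\<close> supplies augmentation 1.\<close>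

lemma unitary_V_eq: "unitary_V G = (unitaries G :: ('a \<Rightarrow> 'f) set)"
proof -
  interpret R: Group.monoid "group_algebra G :: ('a \<Rightarrow> 'f) ring" by (rule monoid_group_algebra)
  have aug: "aug G x = sum x (carrier G)" for x :: "'a \<Rightarrow> 'f"
    unfolding aug_def by (rule sum.mono_neutral_left) (use fin in auto)
  show ?thesis
  proof (rule equalityI; rule subsetI)
    fix x :: "'a \<Rightarrow> 'f" assume "x \<in> unitary_V G"
    then show "x \<in> unitaries G"
      using R.Units_r_inv[of x]
      by (simp add: unitary_V_def normalized_V_def unitaries_def group_algebra_simps)
  next
    fix x :: "'a \<Rightarrow> 'f" assume x: "x \<in> unitaries G"
    then have xA: "x \<in> A" and 1: "x \<star> star x = uno" by (auto simp: unitaries_def)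
    have 2: "star x \<star> x = uno" using right_inv_left_inv xA 1 star_FG by blast
    have u: "x \<in> Units (group_algebra G)"
      unfolding Units_def using xA 1 2 star_FG by (auto simp: group_algebra_simps)
    moreover have "star x = inv\<^bsub>group_algebra G\<^esub> x"
      by (rule R.inv_char[symmetric]) (use xA 1 2 in \<open>auto simp: group_algebra_simps\<close>)
    ultimately show "x \<in> unitary_V G"
      using xA x by (simp add: unitary_V_def normalized_V_def group_algebra_simps aug unitaries_sum)
  qed
qed

lemma finite_unitaries [simp]: "finite (unitaries G :: ('a \<Rightarrow> 'f) set)"
  by (rule finite_subset[OF _ finite_FG]) (auto simp: unitaries_def)

end

section \<open>Functoriality of the group algebra\<close>

locale push_alg = grp_alg G F + H: grp_alg H F
  for G :: "('a, 'm) monoid_scheme" (structure) and H :: "('b, 'n) monoid_scheme" (structure)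
    and F :: "'f::finite_field itself" +
  fixes \<phi> :: "'a \<Rightarrow> 'b"
  assumes hom: "\<phi> \<in> hom G H"
begin

abbreviation pu :: "('a \<Rightarrow> 'f) \<Rightarrow> 'b \<Rightarrow> 'f" where "pu \<equiv> push \<phi> G"

sublocale group_hom G H \<phi>
  by unfold_locales (rule hom)

lemma push_FG [simp]: "pu x \<in> H.A"
  by (auto simp: FG_def push_def intro!: sum.neutral)

lemma push_add: "pu (x + y) = pu x + pu y"
  by (auto simp: push_def sum.distrib)

lemma push_conv: "pu (x \<star> y) = H.cv (pu x) (pu y)"
proof
  fix k
  show "pu (x \<star> y) k = H.cv (pu x) (pu y) k"
  proof (cases "k \<in> carrier H")
    case k: True
    have "pu (x \<star> y) k = (\<Sum>g | g \<in> carrier G \<and> \<phi> g = k. \<Sum>h\<in>carrier G. x h * y (inv h \<otimes> g))"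
      by (auto simp: push_def conv_def intro!: sum.cong)
    also have "\<dots> = (\<Sum>h\<in>carrier G. \<Sum>g | g \<in> carrier G \<and> \<phi> g = k. x h * y (inv h \<otimes> g))"
      by (rule sum.swap)
    also have "\<dots> = (\<Sum>h\<in>carrier G. x h * pu y (inv\<^bsub>H\<^esub> \<phi> h \<otimes>\<^bsub>H\<^esub> k))"
    proof (rule sum.cong[OF HOL.refl])
      fix h assume h: "h \<in> carrier G"
      have "(\<Sum>g | g \<in> carrier G \<and> \<phi> g = k. x h * y (inv h \<otimes> g)) =
            (\<Sum>g | g \<in> carrier G \<and> \<phi> g = inv\<^bsub>H\<^esub> \<phi> h \<otimes>\<^bsub>H\<^esub> k. x h * y g)"
        by (rule sum.reindex_bij_witness[where i = "\<lambda>g. h \<otimes> g" and j = "\<lambda>g. inv h \<otimes> g"])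
          (use h k in \<open>auto simp: m_assoc[symmetric] H.m_assoc[symmetric]\<close>)
      then show "(\<Sum>g | g \<in> carrier G \<and> \<phi> g = k. x h * y (inv h \<otimes> g)) = x h * pu y (inv\<^bsub>H\<^esub> \<phi> h \<otimes>\<^bsub>H\<^esub> k)"
        by (simp add: push_def sum_distrib_left)
    qed
    also have "\<dots> = (\<Sum>l\<in>carrier H. \<Sum>h | h \<in> carrier G \<and> \<phi> h = l. x h * pu y (inv\<^bsub>H\<^esub> \<phi> h \<otimes>\<^bsub>H\<^esub> k))"
      by (rule sum.group[symmetric]) (use fin H.fin in auto)
    also have "\<dots> = H.cv (pu x) (pu y) k"
      using k by (auto simp: conv_def push_def[of _ _ x] sum_distrib_right intro!: sum.cong)
    finally show ?thesis .
  next
    case False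
    then show ?thesis by (auto simp: push_def conv_def intro!: sum.neutral)
  qed
qed

lemma push_star: "pu (star x) = H.star (pu x)"
proof
  fix k
  show "pu (star x) k = H.star (pu x) k"
  proof (cases "k \<in> carrier H")
    case k: True
    have "pu (star x) k = (\<Sum>g | g \<in> carrier G \<and> \<phi> g = k. x (inv g))"
      by (auto simp: push_def fg_star_def intro!: sum.cong)
    also have "\<dots> = (\<Sum>g | g \<in> carrier G \<and> \<phi> g = inv\<^bsub>H\<^esub> k. x g)"
      by (rule sum.reindex_bij_witness[where i = "\<lambda>g. inv g" and j = "\<lambda>g. inv g"])
        (use k in auto)
    finally show ?thesis using k by (simp add: fg_star_def push_def)
  next
    case False
    then show ?thesis by (auto simp: push_def fg_star_def intro!: sum.neutral)
  qed
qed

lemma push_sing [simp]: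
  assumes "g \<in> carrier G" shows "pu (sing g a) = sing (\<phi> g) a"
proof
  fix k
  have "pu (sing g a) k = (\<Sum>h | h \<in> carrier G \<and> \<phi> h = k. if h = g then a else 0)"
    by (simp add: push_def sing_def)
  also have "\<dots> = sing (\<phi> g) a k"
    using assms fin by (subst sum.delta) (auto simp: sing_def)
  finally show "pu (sing g a) k = sing (\<phi> g) a k" .
qed

lemma push_unitaries: "x \<in> unitaries G \<Longrightarrow> pu x \<in> unitaries H"
  by (auto simp: unitaries_def push_conv[symmetric] push_star[symmetric])

end

lemma card_fibres:
  assumes "finite S" "\<And>y. y \<in> f ` S \<Longrightarrow> card {x \<in> S. f x = y} = n"
  shows "card S = card (f ` S) * n"
proof -
  have "card S = (\<Sum>y\<in>f ` S. card {x \<in> S. f x = y})"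
    using assms(1) sum.group[of S "f ` S" f "\<lambda>_. 1::nat"] by simp
  then show ?thesis using assms(2) by simp
qed

text \<open>The order of \<open>V\<^sub>*(FG)\<close> is \<open>t\<close> times \<open>|F|\<close> to the power \<open>(|G| + |\<Omega>\<^sub>1(G)|) / 2 - 1\<close>; both sides are
  squared so that no exponent has to be halved.\<close>

definition theta :: "('a, 'm) monoid_scheme \<Rightarrow> 'f::finite_field itself \<Rightarrow> nat \<Rightarrow> bool" where
  "theta G F t \<longleftrightarrow> card (unitaries G :: ('a \<Rightarrow> 'f) set) ^ 2 * CARD('f) ^ 2 =
     t ^ 2 * CARD('f) ^ (order G + card (\<Omega>\<^sub>1 G))"

section \<open>Central extensions of abelian groups by a group of order two\<close>

locale central_ext = grp_alg G F + H: comm_group H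
  for G :: "('a, 'm) monoid_scheme" (structure) and H :: "('b, 'n) monoid_scheme" (structure)
    and F :: "'f::finite_field itself" +
  fixes \<phi> :: "'a \<Rightarrow> 'b" and c :: 'a
  assumes hom: "\<phi> \<in> hom G H" and surj: "\<phi> ` carrier G = carrier H"
    and c [simp]: "c \<in> carrier G" and c_neq [simp]: "c \<noteq> \<one>\<^bsub>G\<^esub>"
    and ker: "\<And>g. g \<in> carrier G \<Longrightarrow> \<phi> g = \<one>\<^bsub>H\<^esub> \<longleftrightarrow> g = \<one>\<^bsub>G\<^esub> \<or> g = c"
begin

sublocale P: push_alg G H F \<phi>
proof (intro_locales; unfold_locales?)
  show "finite (carrier H)" using surj fin by (metis finite_imageI)
qed (use char2 hom in auto)

end

context central_ext begin

abbreviation "pu \<equiv> P.pu"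

lemma phi_mult [simp]: "g \<in> carrier G \<Longrightarrow> h \<in> carrier G \<Longrightarrow> \<phi> (g \<otimes> h) = \<phi> g \<otimes>\<^bsub>H\<^esub> \<phi> h"
  and phi_inv [simp]: "g \<in> carrier G \<Longrightarrow> \<phi> (inv g) = inv\<^bsub>H\<^esub> \<phi> g"
  and phi_one [simp]: "\<phi> \<one> = \<one>\<^bsub>H\<^esub>"
  and phi_closed [simp]: "g \<in> carrier G \<Longrightarrow> \<phi> g \<in> carrier H"
  by auto

lemma phi_c [simp]: "\<phi> c = \<one>\<^bsub>H\<^esub>"
  using ker c by blast

lemma phi_eq: 
  assumes "g \<in> carrier G" "h \<in> carrier G"
  shows "\<phi> g = \<phi> h \<longleftrightarrow> g = h \<or> g = c \<otimes> h"
proof -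
  have "\<phi> g = \<phi> h \<longleftrightarrow> \<phi> (g \<otimes> inv h) = \<one>\<^bsub>H\<^esub>"
    using assms by (metis H.inv_closed H.r_inv H.inv_solve_right' H.l_one H.one_closed phi_closed phi_inv phi_mult inv_closed)
  also have "\<dots> \<longleftrightarrow> g \<otimes> inv h = \<one> \<or> g \<otimes> inv h = c"
    using assms by (intro ker) auto
  also have "\<dots> \<longleftrightarrow> g = h \<or> g = c \<otimes> h"
    using assms by (metis c inv_closed inv_solve_right' l_one one_closed)
  finally show ?thesis .
qed

lemma c_sq [simp]: "c \<otimes> c = \<one>"
  using ker[of "c \<otimes> c"] c_neq by (auto simp: l_cancel_one)

lemma inv_c [simp]: "inv c = c"
  by (simp add: inv_equality)

lemma c_left [simp]: "g \<in> carrier G \<Longrightarrow> c \<otimes> (c \<otimes> g) = g"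
  by (simp add: m_assoc[symmetric])

lemma cg_neq [simp]: "g \<in> carrier G \<Longrightarrow> c \<otimes> g \<noteq> g" "g \<in> carrier G \<Longrightarrow> g \<noteq> c \<otimes> g"
  using r_cancel_one[of g c] by auto

text \<open>\<open>g \<otimes> c\<close> has the same image as \<open>g\<close>, so it is
  \<open>g\<close> or \<open>c \<otimes> g\<close>, and the former is impossible.\<close>

lemma c_comm: "g \<in> carrier G \<Longrightarrow> g \<otimes> c = c \<otimes> g"
  using phi_eq[of "g \<otimes> c" g] by (auto simp: r_cancel_one l_cancel_one)

text \<open>The quotient is abelian, so commutators lie in the kernel {1, c}.\<close>

lemma comm_cases: "g \<in> carrier G \<Longrightarrow> h \<in> carrier G \<Longrightarrow> g \<otimes> h = h \<otimes> g \<or> g \<otimes> h = c \<otimes> (h \<otimes> g)"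
  using phi_eq[of "g \<otimes> h" "h \<otimes> g"] by (auto simp: H.m_comm)

lemma inv_cg: "g \<in> carrier G \<Longrightarrow> inv (c \<otimes> g) = c \<otimes> inv g"
  by (simp add: inv_mult_group c_comm)

lemma fib: "g \<in> carrier G \<Longrightarrow> {h. h \<in> carrier G \<and> \<phi> h = \<phi> g} = {g, c \<otimes> g}"
  using phi_eq by auto

lemma push_at: "g \<in> carrier G \<Longrightarrow> pu x (\<phi> g) = x g + x (c \<otimes> g)"
  by (simp add: push_def fib)

text \<open>The ideal (1 + c)FG, which by \<open>K_iff\<close> is the kernel of
  \<open>pu\<close>.\<close>

definition K :: "('a \<Rightarrow> 'f) set" where
  "K = {d \<in> A. \<forall>g\<in>carrier G. d (c \<otimes> g) = d g}"

lemma K_iff: "x \<in> A \<Longrightarrow> x \<in> K \<longleftrightarrow> pu x = 0"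
proof
  assume "x \<in> A" "x \<in> K"
  show "pu x = 0"
  proof
    fix k show "pu x k = 0 k"
    proof (cases "k \<in> carrier H")
      case True
      then obtain g where "g \<in> carrier G" "k = \<phi> g" using surj by blast
      then show ?thesis using \<open>x \<in> K\<close> by (simp add: K_def push_at)
    qed (use P.push_FG[of x] in \<open>simp add: FG_def\<close>)
  qed
next
  assume "x \<in> A" "pu x = 0"
  then show "x \<in> K"
    unfolding K_def by (auto simp: push_at[symmetric]) 
      (metis add_eq_0_char2' push_at zero_fun_apply)
qed

lemma K_A: "d \<in> K \<Longrightarrow> d \<in> A"
  by (simp add: K_def)

lemma K_add: "d \<in> K \<Longrightarrow> e \<in> K \<Longrightarrow> d + e \<in> K"
  by (auto simp: K_def)

lemma K_0: "0 \<in> K"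
  by (auto simp: K_def)

lemma K_conv: "d \<in> K \<Longrightarrow> x \<star> d \<in> K" "d \<in> K \<Longrightarrow> d \<star> x \<in> K"
  using K_iff[of "x \<star> d"] K_iff[of "d \<star> x"] K_iff[of d] K_A[of d] by (simp_all add: P.push_conv)

text \<open>This is (1 + c)^2 = 0: in the convolution the terms for h and c h coincide.\<close>

lemma K_conv_0: assumes "d \<in> K" "e \<in> K" shows "d \<star> e = 0"
proof
  fix g
  have "(\<Sum>h\<in>carrier G. d h * e (inv h \<otimes> g)) = 0" if g: "g \<in> carrier G"
  proof (rule sum_involution_eq_0[where i = "\<lambda>h. c \<otimes> h"])
    fix h assume h: "h \<in> carrier G"
    show "d (c \<otimes> h) * e (inv (c \<otimes> h) \<otimes> g) = d h * e (inv h \<otimes> g)"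
      using assms h g by (simp add: K_def inv_cg m_assoc)
  qed (use fin in auto)
  then show "(d \<star> e) g = 0 g" by (auto simp: conv_def)
qed

text \<open>\<open>g \<otimes> inv h\<close> and \<open>inv h \<otimes> g\<close> differ at most by
  the factor \<open>c\<close>, and \<open>d\<close> is constant on the cosets of {1, c}.\<close>

lemma K_central: assumes "d \<in> K" shows "x \<star> d = d \<star> x"
proof
  fix g
  show "(x \<star> d) g = (d \<star> x) g"
  proof (cases "g \<in> carrier G")
    case g: True
    have "(\<Sum>h\<in>carrier G. x h * d (inv h \<otimes> g)) = (\<Sum>h\<in>carrier G. d h * x (inv h \<otimes> g))"
    proof (rule sum.reindex_bij_witness[where i = "\<lambda>h. inv h \<otimes> g" and j = "\<lambda>h. g \<otimes> inv h"])
      fix h assume h: "h \<in> carrier G"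
      have "d (g \<otimes> inv h) = d (inv h \<otimes> g)"
        using comm_cases[of g "inv h"] assms g h by (auto simp: K_def)
      then show "d (g \<otimes> inv h) * x (inv (g \<otimes> inv h) \<otimes> g) = x h * d (inv h \<otimes> g)"
        using g h by (simp add: inv_mult_group m_assoc)
    qed (use g in \<open>auto simp: inv_mult_group m_assoc\<close>)
    then show ?thesis using g by (simp add: conv_def)
  qed (simp add: conv_def)
qed

definition dlt :: "('a \<Rightarrow> 'f) \<Rightarrow> 'a \<Rightarrow> 'f" where "dlt x = x \<star> star x + uno"

definition T :: "('a \<Rightarrow> 'f) set" where "T = {x \<in> A. dlt x \<in> K}"

lemma T_A: "x \<in> T \<Longrightarrow> x \<in> A"
  by (simp add: T_def)

lemma finite_T [simp]: "finite T"
  by (rule finite_subset[OF _ finite_FG]) (auto simp: T_def)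

lemma dlt_FG [simp]: "dlt x \<in> A"
  by (simp add: dlt_def)

lemma conv_star_dlt: "x \<star> star x = uno + dlt x"
  by (simp add: dlt_def add.left_commute[of uno])

text \<open>Moving the central \<open>d\<close> to the front leaves d (1 + \<open>dlt x\<close>),
  and d times \<open>dlt x\<close> vanishes as a product of two elements of
  \<open>K\<close>.\<close>

lemma T_conv_K:
  assumes "x \<in> T" "d \<in> K" shows "x \<star> d \<star> star x = d"
proof -
  have "x \<star> d \<star> star x = d \<star> (x \<star> star x)"
    using assms by (simp add: K_central conv_assoc)
  also have "\<dots> = d"
    using assms K_conv_0[of d "dlt x"] by (simp add: conv_star_dlt conv_add_right K_A T_def)
  finally show ?thesis .
qed

text \<open>The inner product \<open>y \<star> star y\<close> is 1 + \<open>dlt y\<close>, and its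
  second summand survives the multiplication by \<open>x\<close> and \<open>star x\<close> unchanged
  by \<open>T_conv_K\<close>.\<close>

lemma dlt_conv:
  assumes "x \<in> T" "y \<in> T" shows "dlt (x \<star> y) = dlt x + dlt y"
proof -
  have "x \<star> y \<star> star (x \<star> y) = x \<star> (y \<star> star y) \<star> star x"
    by (simp add: star_conv conv_assoc)
  also have "\<dots> = x \<star> star x + x \<star> dlt y \<star> star x"
    using assms by (simp add: conv_star_dlt conv_add_right conv_add_left T_A)
  also have "\<dots> = x \<star> star x + dlt y"
    using assms T_conv_K by (simp add: T_def)
  finally show ?thesis by (simp add: dlt_def add.assoc add.left_commute)
qed

lemma T_conv: "x \<in> T \<Longrightarrow> y \<in> T \<Longrightarrow> x \<star> y \<in> T"
  using dlt_conv[of x y] K_add by (simp add: T_def)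

lemma unitaries_dlt: "unitaries G = {x \<in> T. dlt x = 0}"
  using K_0 by (auto simp: unitaries_def T_def dlt_def add_eq_0_char2)

text \<open>The inverse is \<open>star x\<close> times 1 + \<open>dlt x\<close>: the square of 1 +
  \<open>dlt x\<close> is 1, since \<open>dlt x\<close> has square zero.\<close>

lemma T_unit:
  assumes "x \<in> T" shows "\<exists>y\<in>A. x \<star> y = uno \<and> y \<star> x = uno"
proof -
  have "x \<star> (star x \<star> (uno + dlt x)) = (uno + dlt x) \<star> (uno + dlt x)"
    by (simp add: conv_assoc[symmetric] conv_star_dlt)
  also have "\<dots> = uno"
    using assms K_conv_0[of "dlt x" "dlt x"]
    by (simp add: conv_add_left conv_add_right T_def add.assoc)
  finally show ?thesis
    using right_inv_left_inv conv_FG assms T_A by metis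
qed

text \<open>The fibre is the coset y V_*(FG). For translating back, the inverse of \<open>y\<close>
  must lie in \<open>T\<close> and have the same value under \<open>dlt\<close>.\<close>

lemma dlt_fibre:
  assumes "y \<in> T" shows "card {x \<in> T. dlt x = dlt y} = card (unitaries G :: ('a \<Rightarrow> 'f) set)"
proof -
  obtain y' where y': "y' \<in> A" "y \<star> y' = uno" "y' \<star> y = uno"
    using T_unit assms by blast
  have y'T: "y' \<in> T"
  proof -
    have "star y \<star> star y' = uno" 
      using y' star_conv[of y' y] by simp
    \<comment> \<open>Replacing \<open>y \<star> star y\<close> by 1 + \<open>dlt y\<close> in this
      identity expresses \<open>dlt y'\<close> through \<open>dlt y\<close> and so puts it into the
      ideal \<open>K\<close>.\<close>
    then have "uno = y' \<star> (y \<star> star y) \<star> star y'"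
      using y' by (metis conv_assoc conv_uno star_FG uno_conv)
    also have "\<dots> = y' \<star> star y' + y' \<star> dlt y \<star> star y'"
      using y' by (simp add: conv_star_dlt conv_add_left conv_add_right)
    finally have "dlt y' = y' \<star> dlt y \<star> star y'"
      by (metis add.commute dlt_def twof_left)
    then show ?thesis
      using K_conv assms y' by (auto simp: T_def)
  qed
  have y0: "dlt y' = dlt y"
    using dlt_conv[OF assms y'T] y' by (metis dlt_def add_eq_0_char2 conv_uno star_uno uno_FG)
  have "bij_betw (\<lambda>u. y \<star> u) (unitaries G) {x \<in> T. dlt x = dlt y}"
  proof (rule bij_betwI[where g = "\<lambda>x. y' \<star> x"])
    show "(\<lambda>u. y \<star> u) \<in> unitaries G \<rightarrow> {x \<in> T. dlt x = dlt y}"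
      using assms by (auto simp: unitaries_dlt T_conv dlt_conv)
    show "(\<lambda>x. y' \<star> x) \<in> {x \<in> T. dlt x = dlt y} \<rightarrow> unitaries G"
      using y'T y0 by (auto simp: unitaries_dlt T_conv dlt_conv)
  qed (use y' in \<open>auto simp: conv_assoc[symmetric] unitaries_def T_A\<close>)
  then show ?thesis by (simp add: bij_betw_same_card)
qed

lemma card_T: "card T = card (dlt ` T) * card (unitaries G :: ('a \<Rightarrow> 'f) set)"
  by (rule card_fibres) (use dlt_fibre in auto)

lemma T_iff: "x \<in> A \<Longrightarrow> x \<in> T \<longleftrightarrow> pu x \<in> unitaries H"
  using K_iff[of "dlt x"]
  by (simp add: T_def unitaries_def P.push_conv[symmetric] P.push_star[symmetric] dlt_def P.push_add P.H.add_eq_0_char2)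

lemma card_carrier: "order G = order H * 2"
proof -
  have "card (carrier G) = card (\<phi> ` carrier G) * 2"
    by (rule card_fibres) (use fin in \<open>auto simp: fib\<close>)
  then show ?thesis by (simp add: surj order_def)
qed

lemma push_surj: "y \<in> P.H.A \<Longrightarrow> \<exists>x\<in>A. pu x = y"
proof -
  assume y: "y \<in> P.H.A"
  define s where "s = inv_into (carrier G) \<phi>"
  have s: "s k \<in> carrier G" "\<phi> (s k) = k" if "k \<in> carrier H" for k
    using that surj by (auto simp: s_def inv_into_into f_inv_into_f)
  define x where "x = (\<lambda>g. if g \<in> s ` carrier H then y (\<phi> g) else 0)"
  have "pu x k = y k" for k
  proof (cases "k \<in> carrier H")
    case True
    then have g: "s k \<in> carrier G" "\<phi> (s k) = k" by (auto simp: s)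
    \<comment> \<open>A section meets the fibre {s k, c (s k)} only once, so a single term
      contributes to the sum in \<open>push_at\<close>.\<close>
    have "c \<otimes> s k \<notin> s ` carrier H"
      using g s True by (metis cg_neq(1) c c_left m_closed imageE phi_mult phi_c H.l_one)
    then show ?thesis using push_at[of "s k" x] g True by (simp add: x_def)
  next
    case False
    then show ?thesis using y P.push_FG[of x] by (simp add: FG_def)
  qed
  moreover have "x \<in> A" using s by (auto simp: x_def FG_def)
  ultimately show ?thesis by blast
qed

lemma card_push_fibre: "y \<in> P.H.A \<Longrightarrow> card {x \<in> A. pu x = y} = card K"
proof -
  assume "y \<in> P.H.A"
  then obtain x0 where x0: "x0 \<in> A" "pu x0 = y" using push_surj by blast
  have "bij_betw (\<lambda>d. x0 + d) K {x \<in> A. pu x = y}"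
    by (rule bij_betwI[where g = "\<lambda>x. x0 + x"])
      (use x0 in \<open>auto simp: K_A P.push_add K_iff[OF K_A, THEN iffD1] K_iff[THEN iffD2]\<close>)
  then show ?thesis by (rule bij_betw_same_card[symmetric])
qed

lemma card_K: "card K = CARD('f) ^ order H"
proof -
  have im: "pu ` A = P.H.A" using push_surj by auto
  have "card A = card (pu ` A) * card K"
    by (rule card_fibres) (auto simp: card_push_fibre)
  then have "CARD('f) ^ (order H * 2) = CARD('f) ^ order H * card K"
    unfolding im by (simp add: card_FG P.H.card_FG card_carrier)
  then show ?thesis by (simp add: mult_2_right power_add)
qed

text \<open>\<open>T\<close> is the full preimage of the unitary elements of FH, and the fibres of
  \<open>pu\<close> are cosets of \<open>K\<close>.\<close>

lemma card_T_unitaries: "card T = card (unitaries H :: ('b \<Rightarrow> 'f) set) * CARD('f) ^ order H"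
proof -
  have im: "pu ` T = unitaries H"
  proof
    show "pu ` T \<subseteq> unitaries H" using T_iff T_A by auto
    show "unitaries H \<subseteq> pu ` T"
    proof
      fix y :: "'b \<Rightarrow> 'f" assume y: "y \<in> unitaries H"
      then have "y \<in> P.H.A" by (simp add: unitaries_def)
      then obtain x where "x \<in> A" "pu x = y" using push_surj by blast
      then show "y \<in> pu ` T" using y T_iff by blast
    qed
  qed
  have "card T = card (pu ` T) * card K"
  proof (rule card_fibres)
    fix y assume "y \<in> pu ` T"
    then have y: "y \<in> unitaries H" by (simp add: im)
    then have "{x \<in> T. pu x = y} = {x \<in> A. pu x = y}" using T_iff T_A by auto
    then show "card {x \<in> T. pu x = y} = card K" using card_push_fibre y by (simp add: unitaries_def)
  qed simp
  then show ?thesis by (simp add: im card_K)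
qed

lemma step_card:
  "card (dlt ` T) * card (unitaries G :: ('a \<Rightarrow> 'f) set) = card (unitaries H :: ('b \<Rightarrow> 'f) set) * CARD('f) ^ order H"
  using card_T card_T_unitaries by simp

end

lemma (in group) Omega_eq: "\<Omega>\<^sub>c G c = {g \<in> carrier G. g \<otimes> g = c}"
  by (auto simp: \<Omega>\<^sub>c_def numeral_2_eq_2)

section \<open>Orbits under inversion and multiplication by c\<close>

context central_ext begin

definition cl :: "'a \<Rightarrow> 'a set" where
  "cl g = {g, inv g, c \<otimes> g, c \<otimes> inv g}"

definition clf :: "'a \<Rightarrow> 'f \<Rightarrow> 'a \<Rightarrow> 'f" where
  "clf g a = (\<lambda>x. if x \<in> cl g then a else 0)"

text \<open>The space in which \<open>dlt\<close> takes its values by \<open>dlt_in_D\<close>; the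
  vanishing condition reflects \<open>conv_star_involution\<close>.\<close>

definition D :: "('a \<Rightarrow> 'f) set" where
  "D = {d \<in> K. (\<forall>g\<in>carrier G. d (inv g) = d g) \<and> (\<forall>g\<in>carrier G. g \<otimes> g = \<one> \<longrightarrow> d g = 0)}"

lemma cg_sq: "g \<in> carrier G \<Longrightarrow> (c \<otimes> g) \<otimes> (c \<otimes> g) = g \<otimes> g"
  using c_comm[of g] by (metis c c_left m_assoc m_closed)

lemma inv_sq_eq: "g \<in> carrier G \<Longrightarrow> inv g \<otimes> inv g = inv (g \<otimes> g)"
  by (simp add: inv_mult_group)

lemma inv_eq_c: "g \<in> carrier G \<Longrightarrow> inv g = c \<longleftrightarrow> g = c"
  by (metis inv_c inv_inv)

lemma inv_eq_cg_iff: "g \<in> carrier G \<Longrightarrow> inv g = c \<otimes> g \<longleftrightarrow> g \<otimes> g = c"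
  by (metis c c_comm c_sq inv_closed inv_solve_left' m_assoc m_closed r_inv r_one l_one inv_cg inv_equality)

lemma inv_eq_iff: "g \<in> carrier G \<Longrightarrow> inv g = g \<longleftrightarrow> g \<otimes> g = \<one>"
  by (metis inv_equality r_inv)

lemma cl_carrier: "g \<in> carrier G \<Longrightarrow> cl g \<subseteq> carrier G"
  by (auto simp: cl_def)

lemma cl_self: "g \<in> cl g"
  by (simp add: cl_def)

lemma cl_eq: "g \<in> carrier G \<Longrightarrow> h \<in> cl g \<Longrightarrow> cl h = cl g"
  by (auto simp: cl_def inv_cg)

text \<open>Passing to c g keeps the square and passing to the inverse inverts it, while 1 and
  \<open>c\<close> are their own inverses.\<close>

lemma cl_sq:
  assumes "g \<in> carrier G" "h \<in> cl g"
  shows "h \<otimes> h = \<one> \<longleftrightarrow> g \<otimes> g = \<one>" "h \<otimes> h = c \<longleftrightarrow> g \<otimes> g = c"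
proof -
  have "h \<otimes> h = g \<otimes> g \<or> h \<otimes> h = inv (g \<otimes> g)"
    using assms by (auto simp: cl_def cg_sq inv_sq_eq simp del: c_sq)
  moreover have "inv (g \<otimes> g) = \<one> \<longleftrightarrow> g \<otimes> g = \<one>" "inv (g \<otimes> g) = c \<longleftrightarrow> g \<otimes> g = c"
    using assms by (auto simp: inv_eq_c simp del: inv_mult_group)
  ultimately show "h \<otimes> h = \<one> \<longleftrightarrow> g \<otimes> g = \<one>" "h \<otimes> h = c \<longleftrightarrow> g \<otimes> g = c" by auto
qed

text \<open>Here the inverse of \<open>g\<close> is c g, so the four expressions in
  \<open>cl\<close> collapse to two.\<close>

lemma card_cl_c: assumes "g \<in> carrier G" "g \<otimes> g = c" shows "card (cl g) = 2" "cl g = {g, inv g}"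
proof -
  have "inv g = c \<otimes> g" using assms by (simp add: inv_eq_cg_iff)
  then show "cl g = {g, inv g}" using assms by (auto simp: cl_def)
  moreover have "inv g \<noteq> g" using assms by (simp add: inv_eq_iff)
  ultimately show "card (cl g) = 2" by auto
qed

lemma cl_distinct:
  assumes "g \<in> carrier G" "g \<otimes> g \<noteq> c" "g \<otimes> g \<noteq> \<one>"
  shows "g \<noteq> inv g" "g \<noteq> c \<otimes> g" "g \<noteq> c \<otimes> inv g" "inv g \<noteq> c \<otimes> g" "inv g \<noteq> c \<otimes> inv g" "c \<otimes> g \<noteq> c \<otimes> inv g"
proof -
  show 1: "g \<noteq> inv g" using assms inv_eq_iff by metis
  show 4: "inv g \<noteq> c \<otimes> g" using assms inv_eq_cg_iff by metis
  show "g \<noteq> c \<otimes> inv g" using 4 assms by (metis c_left inv_closed)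
  show "c \<otimes> g \<noteq> c \<otimes> inv g" using 1 assms by (metis c_left inv_closed)
qed (use assms in auto)

lemma card_cl_4: assumes "g \<in> carrier G" "g \<otimes> g \<noteq> c" "g \<otimes> g \<noteq> \<one>" shows "card (cl g) = 4"
  using cl_distinct[OF assms] by (simp add: cl_def)

lemma D_cl: "d \<in> D \<Longrightarrow> g \<in> carrier G \<Longrightarrow> h \<in> cl g \<Longrightarrow> d h = d g"
  by (auto simp: D_def K_def cl_def)

lemma clf_D: assumes "g \<in> carrier G" "g \<otimes> g \<noteq> \<one>" shows "clf g a \<in> D"
proof -
  have *: "h \<in> cl g \<longleftrightarrow> h' \<in> cl g" if "h \<in> carrier G" "h' \<in> cl h" for h h'
    using cl_eq[OF that] cl_eq[OF assms(1)] cl_self that by metis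
  have "clf g a h' = clf g a h" if "h \<in> carrier G" "h' \<in> cl h" for h h'
    using *[OF that] by (simp add: clf_def)
  moreover have "clf g a h = 0" if "h \<in> carrier G" "h \<otimes> h = \<one>" for h
    using cl_sq[OF assms(1)] that assms by (auto simp: clf_def)
  moreover have "clf g a \<in> A" using cl_carrier[OF assms(1)] by (auto simp: FG_def clf_def)
  moreover have "c \<otimes> h \<in> cl h" "inv h \<in> cl h" for h by (simp_all add: cl_def)
  ultimately show ?thesis unfolding D_def K_def by blast
qed

lemma D_add: "d \<in> D \<Longrightarrow> e \<in> D \<Longrightarrow> d + e \<in> D"
  by (auto simp: D_def K_add)

lemma D_A: "d \<in> D \<Longrightarrow> d \<in> A"
  by (simp add: D_def K_def)

lemma finite_D [simp]: "finite D"
  by (rule finite_subset[OF _ finite_FG]) (auto simp: D_A)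

text \<open>Adding the class function through a point of the support removes the whole class from
  the support, which drives an induction on its size. Adding it once more restores \<open>d\<close>
  in characteristic 2.\<close>

lemma D_induct:
  assumes "d \<in> D" "0 \<in> S" "\<And>x y. x \<in> S \<Longrightarrow> y \<in> S \<Longrightarrow> x + y \<in> S"
    and cls: "\<And>g a. g \<in> carrier G \<Longrightarrow> g \<otimes> g \<noteq> \<one> \<Longrightarrow> clf g a \<in> S"
  shows "d \<in> S"
  using assms(1)
proof (induction "card {g. d g \<noteq> 0}" arbitrary: d rule: less_induct)
  case less
  show ?case
  proof (cases "d = 0")
    case False
    then obtain g where g: "d g \<noteq> 0" by (auto simp: fun_eq_iff)
    have gG: "g \<in> carrier G" and g1: "g \<otimes> g \<noteq> \<one>"
      using g less.prems by (auto simp: D_def K_def FG_def)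
    let ?e = "clf g (d g)"
    have "(?e + d) h = (if h \<in> cl g then 0 else d h)" for h
      using D_cl[OF less.prems gG, of h] by (simp add: clf_def)
    then have "{h. (?e + d) h \<noteq> 0} \<subseteq> {h. d h \<noteq> 0} - {g}"
      using cl_self[of g] by auto
    then have "{h. (?e + d) h \<noteq> 0} \<subset> {h. d h \<noteq> 0}" using g by blast
    moreover have "finite {h. d h \<noteq> 0}"
      by (rule finite_subset[OF _ fin]) (use less.prems in \<open>auto simp: D_def K_def FG_def\<close>)
    ultimately have "card {h. (?e + d) h \<noteq> 0} < card {h. d h \<noteq> 0}" by (rule psubset_card_mono[rotated])
    moreover have "?e + d \<in> D" by (rule D_add[OF clf_D[OF gG g1] less.prems])
    ultimately have "?e + d \<in> S" by (rule less.hyps)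
    then have "?e + (?e + d) \<in> S" by (rule assms(3)[OF cls[OF gG g1]])
    then show ?thesis by simp
  qed (simp add: assms(2))
qed

lemma dlt_in_D: "x \<in> T \<Longrightarrow> dlt x \<in> D"
proof -
  assume x: "x \<in> T"
  have "dlt x g = 0" if "g \<in> carrier G" "g \<otimes> g = \<one>" for g
  proof (cases "g = \<one>")
    case True
    \<comment> \<open>The identity is not covered by \<open>conv_star_involution\<close>; the
      coefficient there equals the one at the involution \<open>c\<close>, because
      \<open>dlt x\<close> lies in \<open>K\<close>.\<close>
    have "dlt x c = 0" by (simp add: dlt_def conv_star_involution sing_def)
    moreover have "dlt x (c \<otimes> \<one>) = dlt x \<one>" using x unfolding T_def K_def by blast
    ultimately show ?thesis using True by simp
  next
    case False
    then show ?thesis using that by (simp add: dlt_def conv_star_involution sing_def)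
  qed
  moreover have "dlt x (inv g) = dlt x g" if "g \<in> carrier G" for g
  proof -
    have "star (dlt x) = dlt x" using x by (simp add: dlt_def star_add conv_star_sym T_A)
    from fun_cong[OF this, of g] show ?thesis using that by (simp add: fg_star_def)
  qed
  ultimately show ?thesis using x unfolding D_def T_def by blast
qed

section \<open>Class functions in the image of delta\<close>

lemma uno_T: "uno \<in> T" and dlt_uno: "dlt uno = 0"
  using K_0 by (simp_all add: T_def dlt_def)

lemma dlt_image_add: "d \<in> dlt ` T \<Longrightarrow> e \<in> dlt ` T \<Longrightarrow> d + e \<in> dlt ` T"
  by (auto simp: dlt_conv[symmetric] T_conv)

lemma zero_dlt_image: "0 \<in> dlt ` T"
  using imageI[OF uno_T, of dlt] by (simp only: dlt_uno)

text \<open>The two diagonal terms both contribute b^2 at the identity and cancel, which is the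
  reason for using two monomials with the same coefficient.\<close>

lemma dlt_two_eq:
  assumes "u \<in> carrier G" "w \<in> carrier G"
  shows "dlt (uno + (sing u b + sing w b)) = sing u b + sing (inv u) b + sing w b + sing (inv w) b
    + sing (u \<otimes> inv w) (b\<^sup>2) + sing (w \<otimes> inv u) (b\<^sup>2)"
  using assms
  by (simp add: dlt_def conv_add_left conv_add_right star_add power2_eq_square ac_simps)

lemma dlt_twoI:
  assumes "u \<in> carrier G" "w \<in> carrier G" 
    "d = sing u b + sing (inv u) b + sing w b + sing (inv w) b
    + sing (u \<otimes> inv w) (b\<^sup>2) + sing (w \<otimes> inv u) (b\<^sup>2)" "d \<in> D"
  shows "d \<in> dlt ` T"
proof (rule image_eqI)
  show "d = dlt (uno + (sing u b + sing w b))" using assms dlt_two_eq by simp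
  then show "uno + (sing u b + sing w b) \<in> T" using assms by (simp add: T_def D_def)
qed

lemma clf_c: "g \<in> carrier G \<Longrightarrow> g \<otimes> g = c \<Longrightarrow> clf g a = sing g a + sing (inv g) a"
  using inv_eq_iff[of g] by (auto simp: clf_def card_cl_c sing_def fun_eq_iff)

lemma clf_4:
  assumes "g \<in> carrier G" "g \<otimes> g \<noteq> c" "g \<otimes> g \<noteq> \<one>"
  shows "clf g a = sing g a + sing (inv g) a + sing (c \<otimes> g) a + sing (c \<otimes> inv g) a"
  using cl_distinct[OF assms] by (auto simp: clf_def cl_def sing_def fun_eq_iff)

text \<open>For w = c g both cross terms are b^2 c and cancel, and the linear terms make up the
  four-element class.\<close>

lemma clf_gen:
  assumes "g \<in> carrier G" "g \<otimes> g \<noteq> c" "g \<otimes> g \<noteq> \<one>"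
  shows "clf g a \<in> dlt ` T"
proof (rule dlt_twoI[where u = g and w = "c \<otimes> g" and b = a])
  have "g \<otimes> (c \<otimes> inv g) = c" using assms c_comm[of g] by (metis c inv_closed m_assoc r_inv r_one)
  moreover have "c \<otimes> g \<otimes> inv g = c" using assms by (simp add: m_assoc)
  ultimately show "clf g a = sing g a + sing (inv g) a + sing (c \<otimes> g) a + sing (inv (c \<otimes> g)) a +
    sing (g \<otimes> inv (c \<otimes> g)) (a\<^sup>2) + sing (c \<otimes> g \<otimes> inv g) (a\<^sup>2)"
    using assms by (simp add: clf_4 inv_cg add.assoc)
qed (use assms clf_D in auto)

text \<open>Take u = g v and w = v. Besides v also g v is an involution, as (g v)^2 = c v g^2 v = 1,
  so all linear terms cancel and the cross terms leave b^2 (g + inv g).\<close>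

lemma clf_noncomm:
  assumes g: "g \<in> carrier G" "g \<otimes> g = c" and v: "v \<in> carrier G" "v \<otimes> v = \<one>" and "g \<otimes> v \<noteq> v \<otimes> g"
  shows "clf g a \<in> dlt ` T"
proof -
  obtain b where b: "a = b\<^sup>2" using ex_sqrt by blast
  have 1: "g \<otimes> v = c \<otimes> (v \<otimes> g)" using comm_cases[of g v] assms by auto
  have "(g \<otimes> v) \<otimes> (g \<otimes> v) = c \<otimes> (v \<otimes> g) \<otimes> (g \<otimes> v)" using 1 by simp
  also have "\<dots> = c \<otimes> (v \<otimes> (g \<otimes> g) \<otimes> v)" using g(1) v(1) by (simp add: m_assoc)
  also have "\<dots> = \<one>" using g v c_comm[of v] by (simp add: m_assoc)
  finally have gv: "inv (g \<otimes> v) = g \<otimes> v" using g v by (simp add: inv_equality)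
  have iv: "inv v = v" using v by (simp add: inv_equality)
  have "inv (g \<otimes> v) = v \<otimes> inv g" using g v iv by (simp add: inv_mult_group)
  then have 2: "v \<otimes> (g \<otimes> v) = inv g" using gv g v by (metis inv_closed l_inv_left iv)
  show ?thesis
  proof (rule dlt_twoI[where u = "g \<otimes> v" and w = v and b = b])
    show "clf g a = sing (g \<otimes> v) b + sing (inv (g \<otimes> v)) b + sing v b + sing (inv v) b +
      sing (g \<otimes> v \<otimes> inv v) (b\<^sup>2) + sing (v \<otimes> inv (g \<otimes> v)) (b\<^sup>2)"
      unfolding gv iv using g v 2 by (simp add: clf_c b m_assoc)
  qed (use assms clf_D in auto)
qed

text \<open>For w = inv u every linear term occurs twice, and the cross terms are b^2 times u^2 and
  its inverse.\<close>

lemma clf_square: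
  assumes u: "u \<in> carrier G" and g: "u \<otimes> u \<otimes> (u \<otimes> u) = c"
  shows "clf (u \<otimes> u) a \<in> dlt ` T"
proof -
  obtain b where b: "a = b\<^sup>2" using ex_sqrt by blast
  show ?thesis
  proof (rule dlt_twoI[where u = u and w = "inv u" and b = b])
    show "clf (u \<otimes> u) a = sing u b + sing (inv u) b + sing (inv u) b + sing (inv (inv u)) b +
      sing (u \<otimes> inv (inv u)) (b\<^sup>2) + sing (inv u \<otimes> inv u) (b\<^sup>2)"
      using u g by (simp add: clf_c b add.assoc inv_sq_eq)
  qed (use assms clf_D in auto)
qed

text \<open>Take u = g v and w = v. By commutativity (g v)^2 = c^2 = 1, so the linear terms of u
  cancel; those of v give the first class function and the cross terms the second.\<close>

lemma clf_pair:
  assumes g: "g \<in> carrier G" "g \<otimes> g = c" and v: "v \<in> carrier G" "v \<otimes> v = c" and "g \<otimes> v = v \<otimes> g"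
  shows "clf v b + clf g (b\<^sup>2) \<in> dlt ` T"
proof -
  have "(g \<otimes> v) \<otimes> (g \<otimes> v) = g \<otimes> (v \<otimes> g) \<otimes> v" using g v by (simp add: m_assoc)
  also have "\<dots> = (g \<otimes> g) \<otimes> (v \<otimes> v)" using assms(5) g(1) v(1) by (metis m_assoc m_closed)
  finally have gv: "inv (g \<otimes> v) = g \<otimes> v" using g v by (simp add: inv_equality)
  have "v \<otimes> inv (g \<otimes> v) = inv g"
    unfolding inv_mult_group[OF g(1) v(1)] using g v by simp
  moreover have "g \<otimes> v \<otimes> inv v = g" using g v by (simp add: m_assoc)
  moreover have "clf v b + clf g (b\<^sup>2) \<in> D" using g v by (simp add: D_add clf_D)
  ultimately show ?thesis 
    by (intro dlt_twoI[where u = "g \<otimes> v" and w = v and b = b]) 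
      (use g v in \<open>simp_all add: gv clf_c add.assoc\<close>)
qed

section \<open>The size of the target space\<close>

definition cls :: "'a set set" where "cls = cl ` {g \<in> carrier G. g \<otimes> g \<noteq> \<one>}"

text \<open>An element of \<open>D\<close> amounts to a free choice of one field element per class;
  \<open>SOME\<close> selects the representatives at which it is read off.\<close>

lemma card_D_cls: "card D = CARD('f) ^ card cls"
proof -
  have fc: "finite cls" using fin by (simp add: cls_def)
  have [simp]: "cl (SOME g. g \<in> C) = C" "(SOME g. g \<in> C) \<in> carrier G" if "C \<in> cls" for C
  proof -
    obtain g where g: "g \<in> carrier G" "C = cl g" using \<open>C \<in> cls\<close> unfolding cls_def by blast
    have *: "(SOME g. g \<in> C) \<in> C" using someI[of "\<lambda>g. g \<in> C" g] cl_self g by simp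
    show "cl (SOME g. g \<in> C) = C" using * cl_eq[OF g(1)] unfolding g(2) by blast
    show "(SOME g. g \<in> C) \<in> carrier G" using * cl_carrier[OF g(1)] unfolding g(2) by blast
  qed
  have inD: "(\<lambda>g. if g \<in> carrier G \<and> g \<otimes> g \<noteq> \<one> then w (cl g) else 0) \<in> D" (is "?d \<in> D") for w
  proof -
    have 1: "?d h = ?d g" if "g \<in> carrier G" "h \<in> cl g" for g h
    proof -
      have "h \<in> carrier G" using cl_carrier[OF that(1)] that(2) by blast
      then show ?thesis using cl_sq(1)[OF that] cl_eq[OF that] that(1) by simp
    qed
    have "?d \<in> A" by (simp add: FG_def)
    moreover have "\<forall>g\<in>carrier G. ?d (c \<otimes> g) = ?d g" "\<forall>g\<in>carrier G. ?d (inv g) = ?d g"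
      by (rule ballI, rule 1, assumption, simp add: cl_def)+
    ultimately show ?thesis unfolding D_def K_def by simp
  qed
  have "bij_betw (\<lambda>d. \<lambda>C\<in>cls. d (SOME g. g \<in> C)) D (cls \<rightarrow>\<^sub>E UNIV)"
  proof (rule bij_betwI[where g = "\<lambda>w g. if g \<in> carrier G \<and> g \<otimes> g \<noteq> \<one> then w (cl g) else 0"])
    show "(\<lambda>w g. if g \<in> carrier G \<and> g \<otimes> g \<noteq> \<one> then w (cl g) else 0) \<in> (cls \<rightarrow>\<^sub>E UNIV) \<rightarrow> D"
      using inD by blast
    fix d assume d: "d \<in> D"
    have "d (SOME h. h \<in> cl g) = d g" if "g \<in> carrier G" for g
      using D_cl[OF d that] someI[of "\<lambda>h. h \<in> cl g", OF cl_self] by blast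
    moreover have "d g = 0" if "\<not> (g \<in> carrier G \<and> g \<otimes> g \<noteq> \<one>)" for g
      using that d by (auto simp: D_def K_def FG_def)
    moreover have "cl g \<in> cls" if "g \<in> carrier G \<and> g \<otimes> g \<noteq> \<one>" for g
      using that unfolding cls_def by blast
    ultimately show "(\<lambda>g. if g \<in> carrier G \<and> g \<otimes> g \<noteq> \<one> then (\<lambda>C\<in>cls. d (SOME g. g \<in> C)) (cl g) else 0) = d"
      by (simp add: fun_eq_iff)
  next
    fix w :: "'a set \<Rightarrow> 'f" assume w: "w \<in> cls \<rightarrow>\<^sub>E UNIV"
    have "(SOME g. g \<in> C) \<otimes> (SOME g. g \<in> C) \<noteq> \<one>" if "C \<in> cls" for C
    proof -
      obtain g where g: "g \<in> carrier G" "C = cl g" "g \<otimes> g \<noteq> \<one>" using \<open>C \<in> cls\<close> unfolding cls_def by blast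
      have "(SOME g. g \<in> C) \<in> C" using someI[of "\<lambda>g. g \<in> C" g] cl_self g by simp
      then show ?thesis using cl_sq(1)[OF g(1), of "SOME g. g \<in> C"] g(2,3) by simp
    qed
    then show "(\<lambda>C\<in>cls. (\<lambda>g. if g \<in> carrier G \<and> g \<otimes> g \<noteq> \<one> then w (cl g) else 0) (SOME g. g \<in> C)) = w"
      using w by (auto simp: fun_eq_iff PiE_def extensional_def)
  qed auto
  then have "card D = card (cls \<rightarrow>\<^sub>E (UNIV :: 'f set))" by (rule bij_betw_same_card)
  then show ?thesis using fc by (simp add: card_PiE)
qed

text \<open>By \<open>ker\<close>, the square of g is 1 or c exactly if \<open>\<phi> g\<close> has
  square 1, and \<open>\<phi>\<close> is two-to-one.\<close>

lemma card_Omega: "card (\<Omega>\<^sub>1 G) + card (\<Omega>\<^sub>c G c) = 2 * card (\<Omega>\<^sub>1 H)"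
proof -
  define S where "S = \<Omega>\<^sub>1 G \<union> \<Omega>\<^sub>c G c"
  have S: "g \<in> S \<longleftrightarrow> g \<in> carrier G \<and> \<phi> g \<in> \<Omega>\<^sub>1 H" for g
  proof (cases "g \<in> carrier G")
    case True
    then show ?thesis using ker[of "g \<otimes> g"] by (simp add: S_def Omega_eq H.Omega_eq)
  qed (simp add: S_def Omega_eq)
  have im: "\<phi> ` S = \<Omega>\<^sub>1 H"
  proof (rule equalityI; rule subsetI)
    fix h assume h: "h \<in> \<Omega>\<^sub>1 H"
    then have "h \<in> \<phi> ` carrier G" by (simp add: surj H.Omega_eq)
    then show "h \<in> \<phi> ` S" using h S by blast
  qed (use S in blast)
  have fS: "finite S" by (rule finite_subset[OF _ fin]) (use S in blast)
  have "card S = card (\<phi> ` S) * 2"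
  proof (rule card_fibres[OF fS])
    fix k assume "k \<in> \<phi> ` S"
    then obtain g where g: "g \<in> S" "k = \<phi> g" by blast
    then have gG: "g \<in> carrier G" by (simp add: S)
    have "\<phi> g \<in> \<Omega>\<^sub>1 H" using g(1) S by blast
    then have "{x \<in> S. \<phi> x = k} = {x. x \<in> carrier G \<and> \<phi> x = \<phi> g}"
      unfolding g(2) S by (intro Collect_cong iffI conjI) simp_all
    then show "card {x \<in> S. \<phi> x = k} = 2" using gG by (simp add: fib)
  qed
  moreover have "card S = card (\<Omega>\<^sub>1 G) + card (\<Omega>\<^sub>c G c)"
    unfolding S_def
  proof (rule card_Un_disjoint)
    show "finite (\<Omega>\<^sub>1 G)" "finite (\<Omega>\<^sub>c G c)" using fS by (simp_all add: S_def)
    show "\<Omega>\<^sub>1 G \<inter> \<Omega>\<^sub>c G c = {}" using c_neq unfolding Omega_eq by blast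
  qed
  ultimately show ?thesis unfolding im by simp
qed

text \<open>Sorting G by squares 1, c and others gives |cls| = |\<Omega>_c(G)|/2 + (2|H| -
  |\<Omega>_1(G)| - |\<Omega>_c(G)|)/4, and \<open>card_Omega\<close> then eliminates
  |\<Omega>_1(G)|.\<close>

lemma card_cls: "2 * card cls + card (\<Omega>\<^sub>1 H) = order H + card (\<Omega>\<^sub>c G c)"
proof -
  define S2 where "S2 = {g \<in> carrier G. g \<otimes> g = c}"
  define S4 where "S4 = {g \<in> carrier G. g \<otimes> g \<noteq> c \<and> g \<otimes> g \<noteq> \<one>}"
  have U: "\<Union> (cl ` S2) = S2" "\<Union> (cl ` S4) = S4"
  proof -
    have *: "\<Union> (cl ` S) = S" if "\<And>g h. g \<in> S \<Longrightarrow> h \<in> cl g \<Longrightarrow> h \<in> S" for S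
    proof (rule equalityI; rule subsetI)
      fix h assume "h \<in> \<Union> (cl ` S)"
      then show "h \<in> S" using that by blast
    next
      fix h assume "h \<in> S"
      then show "h \<in> \<Union> (cl ` S)" using cl_self[of h] by blast
    qed
    show "\<Union> (cl ` S2) = S2"
    proof (rule *)
      fix g h assume "g \<in> S2" "h \<in> cl g"
      then show "h \<in> S2"
        using cl_sq(2)[of g h] cl_carrier[of g] by (simp add: S2_def subset_iff)
    qed
    show "\<Union> (cl ` S4) = S4"
    proof (rule *)
      fix g h assume "g \<in> S4" "h \<in> cl g"
      then show "h \<in> S4"
        using cl_sq[of g h] cl_carrier[of g] by (simp add: S4_def subset_iff)
    qed
  qed
  have f: "finite S2" "finite S4" using fin by (simp_all add: S2_def S4_def)
  have part: "n * card (cl ` S) = card S"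
    if "S \<subseteq> carrier G" "\<Union> (cl ` S) = S" "\<And>g. g \<in> S \<Longrightarrow> card (cl g) = n" for S n
  proof -
    have "n * card (cl ` S) = card (\<Union> (cl ` S))"
    proof (rule card_partition)
      have "finite S" using that(1) fin finite_subset by blast
      then show "finite (cl ` S)" "finite (\<Union> (cl ` S))" unfolding that(2) by auto
      show "card C = n" if "C \<in> cl ` S" for C
        using that \<open>\<And>g. g \<in> S \<Longrightarrow> card (cl g) = n\<close> by blast
      fix C1 C2 assume C: "C1 \<in> cl ` S" "C2 \<in> cl ` S" "C1 \<noteq> C2"
      then obtain g1 g2 where g: "g1 \<in> S" "g2 \<in> S" "C1 = cl g1" "C2 = cl g2" by blast
      show "C1 \<inter> C2 = {}"
      proof (rule ccontr)
        assume "C1 \<inter> C2 \<noteq> {}"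
        then obtain h where h: "h \<in> cl g1" "h \<in> cl g2" using g by blast
        have "g1 \<in> carrier G" "g2 \<in> carrier G" using g that(1) by blast+
        then have "cl h = cl g1" "cl h = cl g2" using cl_eq h by blast+
        then show False using C g by simp
      qed
    qed
    then show ?thesis by (simp only: that(2))
  qed
  have 2: "2 * card (cl ` S2) = card S2"
    by (rule part[OF _ U(1)]) (simp_all add: S2_def card_cl_c(1) subset_iff)
  have 4: "4 * card (cl ` S4) = card S4"
    by (rule part[OF _ U(2)]) (simp_all add: S4_def card_cl_4 subset_iff)
  have dis: "cl ` S2 \<inter> cl ` S4 = {}"
  proof (rule ccontr)
    assume "cl ` S2 \<inter> cl ` S4 \<noteq> {}"
    then obtain g h where gh: "g \<in> S2" "h \<in> S4" "cl g = cl h" by blast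
    then have "g \<in> S4" using U(2) cl_self by blast
    then show False using gh(1) by (simp add: S2_def S4_def)
  qed
  have "{g \<in> carrier G. g \<otimes> g \<noteq> \<one>} = S2 \<union> S4"
    using c_neq unfolding S2_def S4_def by blast
  then have "cls = cl ` S2 \<union> cl ` S4"
    by (simp add: cls_def image_Un)
  then have cc: "card cls = card (cl ` S2) + card (cl ` S4)"
    using f dis by (simp add: card_Un_disjoint)
  have "carrier G = (\<Omega>\<^sub>1 G \<union> S2) \<union> S4" unfolding Omega_eq S2_def S4_def by blast
  then have "order G = card ((\<Omega>\<^sub>1 G \<union> S2) \<union> S4)" by (simp add: order_def)
  also have "\<dots> = card (\<Omega>\<^sub>1 G \<union> S2) + card S4"
    by (rule card_Un_disjoint) (unfold Omega_eq S2_def S4_def, use fin in simp, use fin in simp, blast)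
  also have "card (\<Omega>\<^sub>1 G \<union> S2) = card (\<Omega>\<^sub>1 G) + card S2"
    by (rule card_Un_disjoint) (unfold Omega_eq S2_def, use fin in simp, use fin in simp, use c_neq in blast)
  finally have "order G = card (\<Omega>\<^sub>1 G) + card S2 + card S4" .
  moreover have "\<Omega>\<^sub>c G c = S2" by (simp add: Omega_eq S2_def)
  ultimately show ?thesis using cc 2 4 card_carrier card_Omega by simp
qed

lemma card_D: "card D ^ 2 * CARD('f) ^ card (\<Omega>\<^sub>1 H) = CARD('f) ^ (order H + card (\<Omega>\<^sub>c G c))"
  by (simp add: card_D_cls power_mult[symmetric] power_add[symmetric] card_cls[symmetric] mult.commute add.commute)

text \<open>\<open>step_card\<close> compares the two unitary groups through the image of
  \<open>dlt\<close>, and \<open>s\<close> measures how far that image is from \<open>D\<close>,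
  whose size is known up to squaring from \<open>card_D\<close>.\<close>

lemma theta_step:
  assumes "theta H F t" and im: "card D = s * card (dlt ` T)"
  shows "theta G F (s * t)"
proof -
  let ?q = "CARD('f)"
  let ?U = "card (unitaries G :: ('a \<Rightarrow> 'f) set)" and ?V = "card (unitaries H :: ('b \<Rightarrow> 'f) set)"
  let ?h = "order H" and ?o = "card (\<Omega>\<^sub>1 H)" and ?oc = "card (\<Omega>\<^sub>c G c)"
  have q: "?q > 0" by simp
  have DU: "card D * ?U = s * ?V * ?q ^ ?h"
    using step_card im by simp
  have "?U\<^sup>2 * ?q\<^sup>2 * ?q ^ (?h + ?oc) = (card D * ?U)\<^sup>2 * ?q\<^sup>2 * ?q ^ ?o"
    by (simp add: card_D[symmetric] power_mult_distrib)
  also have "\<dots> = s\<^sup>2 * (?V\<^sup>2 * ?q\<^sup>2) * (?q ^ ?h)\<^sup>2 * ?q ^ ?o"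
    unfolding DU by (simp add: power_mult_distrib)
  also have "\<dots> = (s * t)\<^sup>2 * ?q ^ (?h + ?o + 2 * ?h + ?o)"
    unfolding assms(1)[unfolded theta_def]
    by (simp only: power_mult_distrib power_add power_mult ac_simps)
  \<comment> \<open>Both sides are 3|H| + 2|\<Omega>_1(H)|, by \<open>card_carrier\<close> and
    \<open>card_Omega\<close>.\<close>
  also have "?h + ?o + 2 * ?h + ?o = order G + card (\<Omega>\<^sub>1 G) + (?h + ?oc)"
    using card_carrier card_Omega by simp
  finally show ?thesis
    using q by (simp add: theta_def power_add)
qed

text \<open>Class functions span \<open>D\<close>, and those of four-element classes are in the
  image by \<open>clf_gen\<close>, so only the square roots of \<open>c\<close> have to be
  supplied.\<close>

lemma theta_surj:
  assumes "theta H F t"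
    and "\<And>g a. g \<in> carrier G \<Longrightarrow> g \<otimes> g = c \<Longrightarrow> clf g a \<in> dlt ` T"
  shows "theta G F t"
proof -
  have "dlt ` T = D"
  proof (rule equalityI; rule subsetI)
    fix d assume "d \<in> D"
    then show "d \<in> dlt ` T"
      by (rule D_induct) (use zero_dlt_image dlt_image_add assms(2) clf_gen in blast)+
  qed (use dlt_in_D in auto)
  then show ?thesis using theta_step[OF assms(1), of 1] by simp
qed

end

section \<open>Finite abelian 2-groups\<close>

lemma iso_Omega:
  assumes "group G" "group H" "h \<in> iso G H" "c \<in> carrier G"
  shows "h ` \<Omega>\<^sub>c G c = \<Omega>\<^sub>c H (h c)" "card (\<Omega>\<^sub>c H (h c)) = card (\<Omega>\<^sub>c G c)"
proof -
  interpret G: group G by fact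
  interpret H: group H by fact
  interpret group_hom G H h
    using assms(3) by unfold_locales (simp add: iso_def)
  have b: "bij_betw h (carrier G) (carrier H)" using assms(3) by (simp add: iso_def)
  have inj: "inj_on h (carrier G)" using b bij_betw_def by blast
  have eq: "h g \<otimes>\<^bsub>H\<^esub> h g = h c \<longleftrightarrow> g \<otimes>\<^bsub>G\<^esub> g = c" if "g \<in> carrier G" for g
    using inj that assms(4) inj_on_eq_iff[OF inj, of "g \<otimes>\<^bsub>G\<^esub> g" c] by simp
  show 1: "h ` \<Omega>\<^sub>c G c = \<Omega>\<^sub>c H (h c)"
  proof (rule equalityI; rule subsetI)
    fix y assume "y \<in> h ` \<Omega>\<^sub>c G c"
    then obtain g where "g \<in> carrier G" "g \<otimes>\<^bsub>G\<^esub> g = c" "y = h g" unfolding G.Omega_eq by blast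
    then show "y \<in> \<Omega>\<^sub>c H (h c)" using eq[of g] by (simp add: H.Omega_eq)
  next
    fix y assume y: "y \<in> \<Omega>\<^sub>c H (h c)"
    then have "y \<in> h ` carrier G" using b by (simp add: H.Omega_eq bij_betw_def)
    then obtain g where g: "g \<in> carrier G" "y = h g" by blast
    then have "g \<in> \<Omega>\<^sub>c G c" using y eq[of g] by (simp add: G.Omega_eq H.Omega_eq)
    then show "y \<in> h ` \<Omega>\<^sub>c G c" using g by blast
  qed
  have "inj_on h (\<Omega>\<^sub>c G c)" by (rule inj_on_subset[OF inj]) (auto simp: \<Omega>\<^sub>c_def)
  then show "card (\<Omega>\<^sub>c H (h c)) = card (\<Omega>\<^sub>c G c)" unfolding 1[symmetric] by (rule card_image)
qed

text \<open>An injective group homomorphism induces an injective map of group algebras that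
  preserves unitarity. Applied in both directions it settles isomorphic groups.\<close>

lemma card_unitaries_le:
  fixes G :: "('a, 'm) monoid_scheme" and H :: "('b, 'n) monoid_scheme"
  assumes "push_alg TYPE('f::finite_field) G H \<phi>" "inj_on \<phi> (carrier G)"
  shows "card (unitaries G :: ('a \<Rightarrow> 'f) set) \<le> card (unitaries H :: ('b \<Rightarrow> 'f) set)"
proof -
  interpret push_alg G H "TYPE('f)" \<phi> by fact
  have at: "pu x (\<phi> g) = x g" if "g \<in> carrier G" for x g
  proof -
    have "{h. h \<in> carrier G \<and> \<phi> h = \<phi> g} = {g}" using that assms(2) by (auto dest: inj_onD)
    then show ?thesis by (simp add: push_def)
  qed
  have "inj_on pu (unitaries G)"
  proof (rule inj_onI)
    fix x y assume xy: "x \<in> unitaries G" "y \<in> unitaries G" "pu x = pu y"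
    show "x = y"
    proof
      fix g show "x g = y g"
      proof (cases "g \<in> carrier G")
        case True then show ?thesis using at[of g x] at[of g y] xy(3) by simp
      qed (use xy in \<open>simp add: unitaries_def FG_def\<close>)
    qed
  qed
  moreover have "pu ` unitaries G \<subseteq> unitaries H" using push_unitaries by blast
  ultimately show ?thesis using card_inj_on_le H.finite_unitaries by blast
qed

lemma theta_iso:
  fixes G :: "('a, 'm) monoid_scheme" and H :: "('b, 'n) monoid_scheme"
  assumes "group G" "group H" "G \<cong> H" "finite (carrier H)" "CHAR('f::finite_field) = 2"
    and "theta H (F::'f itself) t"
  shows "theta G F t"
proof -
  obtain h where h: "h \<in> iso G H" using assms(3) by (auto simp: is_iso_def)
  have b: "bij_betw h (carrier G) (carrier H)" and hh: "h \<in> hom G H" using h by (simp_all add: iso_def)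
  have fG: "finite (carrier G)" using b assms(4) bij_betw_finite by blast
  have h': "inv_into (carrier G) h \<in> iso H G" using group.iso_set_sym[OF assms(1) h] .
  have "push_alg TYPE('f) G H h" "push_alg TYPE('f) H G (inv_into (carrier G) h)"
    using assms fG hh h' by (simp_all add: push_alg_def push_alg_axioms_def grp_alg_def grp_alg_axioms_def iso_def)
  moreover have "inj_on h (carrier G)" "inj_on (inv_into (carrier G) h) (carrier H)"
    using h h' by (simp_all add: iso_def bij_betw_def)
  ultimately have "card (unitaries G :: ('a \<Rightarrow> 'f) set) = card (unitaries H :: ('b \<Rightarrow> 'f) set)"
    by (intro antisym card_unitaries_le)
  moreover have "order G = order H" using b by (simp add: order_def bij_betw_same_card)
  moreover have "card (\<Omega>\<^sub>1 G) = card (\<Omega>\<^sub>1 H)"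
    using iso_Omega(2)[OF assms(1,2) h, of "\<one>\<^bsub>G\<^esub>"] hom_one[OF hh assms(1,2)] assms(1)
    by (simp add: group.is_monoid monoid.one_closed)
  ultimately show ?thesis using assms(6) by (simp add: theta_def)
qed

text \<open>All elements other than 1 are involutions, so \<open>x \<star> star x\<close> is the
  squared augmentation at 1 and zero elsewhere. Unitary thus means augmentation 1, and there are
  |F|^(|G| - 1) such elements.\<close>

lemma theta_elementary:
  assumes "group G" "finite (carrier G)" "CHAR('f::finite_field) = 2"
    and sq: "\<And>g. g \<in> carrier G \<Longrightarrow> g \<otimes>\<^bsub>G\<^esub> g = \<one>\<^bsub>G\<^esub>"
  shows "theta G (F::'f itself) 1"
proof -
  interpret grp_alg G F
    using assms(1-3) by (simp add: grp_alg_def grp_alg_axioms_def)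
  let ?s = "\<lambda>x::'a \<Rightarrow> 'f. sum x (carrier G)"
  have unitaries: "unitaries G = {x \<in> A. ?s x = 1}"
  proof (rule equalityI; rule subsetI)
    fix x :: "'a \<Rightarrow> 'f" assume "x \<in> {x \<in> A. ?s x = 1}"
    then have x: "x \<in> A" "?s x = 1" by auto
    have "(x \<star> star x) g = uno g" for g
    proof (cases "g \<in> carrier G")
      case g: True
      show ?thesis
      proof (cases "g = \<one>\<^bsub>G\<^esub>")
        case True
        then show ?thesis using conv_star_one[of x] x by (simp add: sing_def)
      next
        case False
        then show ?thesis using conv_star_involution[OF g] sq[OF g] by (simp add: sing_def)
      qed
    next
      case False
      then show ?thesis by (auto simp: conv_def sing_def)
    qed
    then show "x \<in> unitaries G" using x by (auto simp: unitaries_def)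
  next
    fix x :: "'a \<Rightarrow> 'f" assume "x \<in> unitaries G"
    then show "x \<in> {x \<in> A. ?s x = 1}" using unitaries_sum by (auto simp: unitaries_def)
  qed
  have s_sing: "?s (sing \<one>\<^bsub>G\<^esub> a) = a" for a
    using fin by (simp add: sing_def)
  have im: "?s ` A = UNIV"
  proof (rule HOL.sym, rule UNIV_eq_I)
    show "a \<in> ?s ` A" for a by (rule image_eqI[of _ _ "sing \<one>\<^bsub>G\<^esub> a"]) (simp_all add: s_sing)
  qed
  have "card A = card (?s ` A) * card {x \<in> A. ?s x = 1}"
  proof (rule card_fibres)
    fix y assume "y \<in> ?s ` A"
    have "bij_betw (\<lambda>x. x + sing \<one>\<^bsub>G\<^esub> (y + 1)) {x \<in> A. ?s x = y} {x \<in> A. ?s x = 1}"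
      by (rule bij_betwI[where g = "\<lambda>x. x + sing \<one>\<^bsub>G\<^esub> (y + 1)"])
        (auto simp: sum.distrib s_sing add.assoc add.commute[of 1])
    then show "card {x \<in> A. ?s x = y} = card {x \<in> A. ?s x = 1}" by (rule bij_betw_same_card)
  qed simp
  then have "CARD('f) ^ order G = CARD('f) * card (unitaries G :: ('a \<Rightarrow> 'f) set)"
    unfolding im unitaries by (simp add: card_FG)
  then have "(CARD('f) * card (unitaries G :: ('a \<Rightarrow> 'f) set))\<^sup>2 = (CARD('f) ^ order G)\<^sup>2" by simp
  moreover have "\<Omega>\<^sub>1 G = carrier G" using sq by (auto simp: Omega_eq)
  ultimately show ?thesis
    by (simp add: theta_def order_def power_add power2_eq_square ac_simps)
qed

section \<open>Abelian extensions and the Artin-Schreier index\<close>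

context central_ext begin

text \<open>\<open>clf_pair\<close> with v = u^2 reaches the sum of the class functions of u^2 and
  g, and \<open>clf_square\<close> removes the first of them.\<close>

lemma clf_via_square:
  assumes u: "u \<in> carrier G" "u \<otimes> u \<otimes> (u \<otimes> u) = c"
    and g: "g \<in> carrier G" "g \<otimes> g = c" "g \<otimes> (u \<otimes> u) = (u \<otimes> u) \<otimes> g"
  shows "clf g a \<in> dlt ` T"
proof -
  obtain b where b: "a = b\<^sup>2" using ex_sqrt by blast
  have "clf (u \<otimes> u) b + (clf (u \<otimes> u) b + clf g (b\<^sup>2)) \<in> dlt ` T"
    by (rule dlt_image_add[OF clf_square[OF u] clf_pair]) (use u g in simp_all)
  then show ?thesis by (simp add: b)
qed

text \<open>Modulo the image, every class function of a square root of \<open>c\<close> reduces to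
  one of \<open>g0\<close>, so the cokernel is a quotient of F. The projection to the group algebra
  of Z_4 identifies it as F modulo the values b^2 + b.\<close>

lemma theta_double:
  assumes comm: "\<And>g h. g \<in> carrier G \<Longrightarrow> h \<in> carrier G \<Longrightarrow> g \<otimes> h = h \<otimes> g"
    and p: "p \<in> hom G (integer_mod_group 4)" "p c = 2"
    and g0: "g0 \<in> carrier G" "g0 \<otimes> g0 = c"
    and H: "theta H F t"
  shows "theta G F (2 * t)"
proof -
  interpret Z: push_alg G "integer_mod_group 4" F p
  proof (intro_locales)
    show "grp_alg_axioms TYPE('f) (integer_mod_group 4)"
      using char2 by (simp add: grp_alg_axioms_def carrier_integer_mod_group)
    show "push_alg_axioms G (integer_mod_group 4) p"
      using p by (simp add: push_alg_axioms_def)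
    show "Group.monoid (integer_mod_group 4)" "group_axioms (integer_mod_group 4)"
      using group_integer_mod_group[of 4] unfolding group_def by blast+
  qed
  have cZ: "carrier (integer_mod_group 4) = {0, 1, 2, 3}"
    by (auto simp: carrier_integer_mod_group)
  \<comment> \<open>The coefficient at the generator 1 of the additive group Z_4, whose identity is
    0.\<close>
  define \<sigma> where "\<sigma> = (\<lambda>d. Z.pu d 1)"
  define wp :: "'f \<Rightarrow> 'f" where "wp = (\<lambda>b. b\<^sup>2 + b)"
  have wp_add: "wp (a + b) = wp a + wp b" for a b
    by (simp add: wp_def sq_add ac_simps)
  have \<sigma>_add: "\<sigma> (d + e) = \<sigma> d + \<sigma> e" for d e
    by (simp add: \<sigma>_def Z.push_add)
  have \<sigma>_sing: "\<sigma> (sing g a) = (if p g = 1 then a else 0)" if "g \<in> carrier G" for g a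
    using that by (simp add: \<sigma>_def sing_def[of "p g"])
  have pG: "p g \<in> {0, 1, 2, 3}" if "g \<in> carrier G" for g
    using Z.hom_closed[OF that] by (simp add: cZ)
  have p_mult: "p (g \<otimes> h) = (p g + p h) mod 4" if "g \<in> carrier G" "h \<in> carrier G" for g h
    using that by (simp add: Z.hom_mult)
  have p_inv: "p (inv g) = (- p g) mod 4" if "g \<in> carrier G" for g
    using that by (simp add: Z.hom_inv)
  \<comment> \<open>If g^2 = c, then exactly one of g and its inverse maps to 1. Otherwise g and c
    (inv g) map to 1 together, and so do inv g and c g, so that the contributions cancel.\<close>
  have \<sigma>_clf: "\<sigma> (clf g a) = (if g \<otimes> g = c then a else 0)"
    if g: "g \<in> carrier G" "g \<otimes> g \<noteq> \<one>" for g a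
  proof (cases "g \<otimes> g = c")
    case True
    have "(p g + p g) mod 4 = 2" using p_mult[OF g(1) g(1)] True p(2) by simp
    then have pg: "p g = 1 \<or> p g = 3" using pG[OF g(1)] by auto
    have "p (inv g) = 1 \<longleftrightarrow> p g = 3" using p_inv[OF g(1)] pg by auto
    then show ?thesis using g(1) True pg by (elim disjE) (simp_all add: clf_c[OF g(1) True] \<sigma>_add \<sigma>_sing)
  next
    case False
    have "p (c \<otimes> g) = (2 + p g) mod 4" "p (c \<otimes> inv g) = (2 + (- p g) mod 4) mod 4"
      using g(1) p_mult[of c g] p_mult[of c "inv g"] p_inv[of g] p(2) by simp_all
    then have pp: "p (c \<otimes> g) = 1 \<longleftrightarrow> p g = 3" "p (c \<otimes> inv g) = 1 \<longleftrightarrow> p g = 1" "p (inv g) = 1 \<longleftrightarrow> p g = 3"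
      using p_inv[OF g(1)] pG[OF g(1)] by auto
    have "c \<otimes> g \<in> carrier G" "c \<otimes> inv g \<in> carrier G" "inv g \<in> carrier G" using g(1) by simp_all
    note \<sigma>s = \<sigma>_sing[OF this(1)] \<sigma>_sing[OF this(2)] \<sigma>_sing[OF this(3)] \<sigma>_sing[OF g(1)]
    show ?thesis
      unfolding clf_4[OF g(1) False g(2)] \<sigma>_add \<sigma>s pp by (simp add: False)
  qed
  have g0n: "g0 \<otimes> g0 \<noteq> \<one>" using g0 by simp
  have clf_add: "clf g0 (a + b) = clf g0 a + clf g0 b" for a b
    by (auto simp: clf_def)
  \<comment> \<open>Two instances of \<open>clf_pair\<close> that share the summand
    \<open>clf g0 b\<close> add up to the class functions of g and g0 with equal coefficients, so g
    may be traded for \<open>g0\<close>.\<close>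
  have red: "d + clf g0 (\<sigma> d) \<in> dlt ` T" if "d \<in> D" for d
  proof -
    have "d \<in> {d. d + clf g0 (\<sigma> d) \<in> dlt ` T}"
      using that
    proof (rule D_induct)
      have "\<sigma> 0 = 0" using \<sigma>_add[of 0 0] by simp
      moreover have "clf g0 0 = 0" by (auto simp: clf_def)
      ultimately show "0 \<in> {d. d + clf g0 (\<sigma> d) \<in> dlt ` T}" using zero_dlt_image by simp
    next
      fix x y assume "x \<in> {d. d + clf g0 (\<sigma> d) \<in> dlt ` T}" "y \<in> {d. d + clf g0 (\<sigma> d) \<in> dlt ` T}"
      then have "(x + clf g0 (\<sigma> x)) + (y + clf g0 (\<sigma> y)) \<in> dlt ` T"
        using dlt_image_add by blast
      then show "x + y \<in> {d. d + clf g0 (\<sigma> d) \<in> dlt ` T}"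
        by (simp add: \<sigma>_add clf_add ac_simps)
    next
      fix g a assume g: "g \<in> carrier G" "g \<otimes> g \<noteq> \<one>"
      show "clf g a \<in> {d. d + clf g0 (\<sigma> d) \<in> dlt ` T}"
      proof (cases "g \<otimes> g = c")
        case False
        moreover have "clf g0 0 = 0" by (auto simp: clf_def)
        ultimately show ?thesis using clf_gen[OF g(1) False g(2)] \<sigma>_clf[OF g] by simp
      next
        case True
        obtain b where b: "a = b\<^sup>2" using ex_sqrt by blast
        have "clf g0 b + clf g (b\<^sup>2) \<in> dlt ` T" "clf g0 b + clf g0 (b\<^sup>2) \<in> dlt ` T"
          by (rule clf_pair; use g True g0 comm in simp)+
        then have "(clf g0 b + clf g (b\<^sup>2)) + (clf g0 b + clf g0 (b\<^sup>2)) \<in> dlt ` T"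
          by (rule dlt_image_add)
        then show ?thesis using \<sigma>_clf[OF g] True b by (simp add: ac_simps)
      qed
    qed
    then show ?thesis by simp
  qed
  \<comment> \<open>In the group algebra of Z_4 the coefficient of y times its star at 1 is (y0 +
    y2)(y1 + y3). Augmentation 1 turns it into (1 + s) s = \<open>wp s\<close> for s = y1 +
    y3.\<close>
  have up: "\<sigma> (dlt x) \<in> range wp" if x: "x \<in> T" for x
  proof -
    define y where "y = Z.pu x"
    have "sum x (carrier G) = 1"
    proof -
      have "dlt x \<one> = 0" using dlt_in_D[OF x] by (simp add: D_def)
      then have "(sum x (carrier G))\<^sup>2 = 1\<^sup>2"
        using conv_star_one[of x] by (simp add: dlt_def sing_def add_eq_0_char2')
      then show ?thesis using inj_sq by (metis injD)
    qed
    moreover have "sum y (carrier (integer_mod_group 4)) = sum x (carrier G)"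
      unfolding y_def push_def by (rule sum.group) (use fin Z.hom_closed in \<open>auto simp: cZ\<close>)
    ultimately have "y 0 + (y 1 + (y 2 + y 3)) = 1" by (simp add: cZ)
    moreover have "y 0 + y 2 = (y 0 + (y 1 + (y 2 + y 3))) + (y 1 + y 3)" by (simp add: ac_simps)
    ultimately have s: "y 0 + y 2 = 1 + (y 1 + y 3)" by simp
    have "Z.pu (dlt x) = conv (integer_mod_group 4) y (fg_star (integer_mod_group 4) y) + sing 0 1"
      by (simp add: dlt_def Z.push_add Z.push_conv Z.push_star y_def)
    then have "\<sigma> (dlt x) = (\<Sum>h\<in>{0, 1, 2, 3}. y h * y ((inv\<^bsub>integer_mod_group 4\<^esub> 1 \<otimes>\<^bsub>integer_mod_group 4\<^esub> h)))"
      by (simp add: \<sigma>_def sing_def Z.H.conv_star_apply cZ)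
    also have "\<dots> = (y 0 + y 2) * (y 1 + y 3)"
      by (simp add: cZ algebra_simps)
    also have "\<dots> = wp (y 1 + y 3)"
      by (simp add: s wp_def power2_eq_square algebra_simps)
    finally show ?thesis by simp
  qed
  have im: "dlt ` T = {d \<in> D. \<sigma> d \<in> range wp}"
  proof (rule equalityI; rule subsetI)
    fix d assume "d \<in> dlt ` T" then show "d \<in> {d \<in> D. \<sigma> d \<in> range wp}" using up dlt_in_D by blast
  next
    fix d assume "d \<in> {d \<in> D. \<sigma> d \<in> range wp}"
    then obtain b where d: "d \<in> D" "\<sigma> d = b\<^sup>2 + b" by (auto simp: wp_def)
    have "clf g0 b + clf g0 (b\<^sup>2) \<in> dlt ` T"
      by (rule clf_pair) (use g0 in simp_all)
    then have "clf g0 (\<sigma> d) \<in> dlt ` T" unfolding d(2) clf_add by (simp add: add.commute)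
    from dlt_image_add[OF red[OF d(1)] this] show "d \<in> dlt ` T" by (simp add: add.assoc)
  qed
  define n where "n = card {d \<in> D. \<sigma> d = 0}"
  have fib: "card {d \<in> D. \<sigma> d = y} = n" for y
  proof -
    have "bij_betw (\<lambda>d. d + clf g0 y) {d \<in> D. \<sigma> d = y} {d \<in> D. \<sigma> d = 0}"
      by (rule bij_betwI[where g = "\<lambda>d. d + clf g0 y"])
        (auto simp: D_add clf_D g0 \<sigma>_add \<sigma>_clf add.assoc)
    then show ?thesis unfolding n_def by (rule bij_betw_same_card)
  qed
  have \<sigma>_surj: "\<exists>d\<in>D. \<sigma> d = y" for y
    using clf_D[OF g0(1) g0n] \<sigma>_clf[OF g0(1) g0n] g0 by (intro bexI[of _ "clf g0 y"]) simp_all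
  have 1: "card D = card (\<sigma> ` D) * n"
    by (rule card_fibres) (simp_all add: fib)
  have "\<sigma> ` D = UNIV"
  proof (rule HOL.sym, rule UNIV_eq_I)
    fix y show "y \<in> \<sigma> ` D" using \<sigma>_surj[of y] by blast
  qed
  moreover have "card (dlt ` T) = card (\<sigma> ` dlt ` T) * n"
  proof (rule card_fibres)
    fix y assume "y \<in> \<sigma> ` dlt ` T"
    then have "y \<in> range wp" unfolding im by blast
    then have "{d \<in> dlt ` T. \<sigma> d = y} = {d \<in> D. \<sigma> d = y}" unfolding im by blast
    then show "card {d \<in> dlt ` T. \<sigma> d = y} = n" by (simp add: fib)
  qed simp
  moreover have "\<sigma> ` dlt ` T = range wp"
    unfolding im
  proof (rule equalityI; rule subsetI)
    fix y assume "y \<in> range wp"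
    moreover obtain d where "d \<in> D" "\<sigma> d = y" using \<sigma>_surj by blast
    ultimately show "y \<in> \<sigma> ` {d \<in> D. \<sigma> d \<in> range wp}" by (intro image_eqI[of _ _ d]) simp_all
  qed blast
  \<comment> \<open>\<open>wp\<close> is additive with kernel {0, 1}: this is the source of the
    factor 2.\<close>
  moreover have "card (UNIV :: 'f set) = card (range wp) * 2"
  proof (rule card_fibres)
    fix y assume "y \<in> range wp"
    then obtain b where b: "y = wp b" by blast
    have "wp x = wp b \<longleftrightarrow> x = b \<or> x = b + 1" for x
    proof -
      have "wp x = wp b \<longleftrightarrow> wp (x + b) = 0" by (simp add: wp_add add_eq_0_char2')
      also have "\<dots> \<longleftrightarrow> (x + b) * (x + b + 1) = 0"
        by (simp add: wp_def power2_eq_square distrib_left)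
      also have "\<dots> \<longleftrightarrow> x = b \<or> x = b + 1"
        by (simp add: add_eq_0_char2' add.assoc)
      finally show ?thesis .
    qed
    then have "{x \<in> UNIV. wp x = y} = {b, b + 1}" using b by auto
    then show "card {x \<in> UNIV. wp x = y} = 2" by simp
  qed simp
  ultimately have "card D = 2 * card (dlt ` T)" using 1 by simp
  then show ?thesis by (rule theta_step[OF H])
qed

end

section \<open>Building up cyclic factors\<close>

lemma DirProd_comm_group:
  assumes "comm_group G" "comm_group H" shows "comm_group (G \<times>\<times> H)"
proof -
  interpret G: comm_group G by fact
  interpret H: comm_group H by fact
  interpret group "G \<times>\<times> H" by (intro DirProd_group G.is_group H.is_group)
  show ?thesis
    by unfold_locales (auto simp: G.m_comm H.m_comm)
qed

lemma pow2_mod_pow2: "i \<ge> 1 \<Longrightarrow> (x mod 2 ^ i) mod 2 ^ (i - 1) = x mod (2 ^ (i - 1) :: int)"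
  by (simp add: mod_mod_cancel le_imp_power_dvd)

lemma mod_pow2_eq_0:
  assumes "i \<ge> 1" "x \<in> {0..<2 ^ i}"
  shows "x mod 2 ^ (i - 1) = (0::int) \<longleftrightarrow> x = 0 \<or> x = 2 ^ (i - 1)"
proof
  obtain j where j: "i = Suc j" using assms by (cases i) auto
  assume "x mod 2 ^ (i - 1) = 0"
  then obtain k where k: "x = 2 ^ j * k" by (auto simp: j)
  then have "k \<ge> 0" "k < 2" using assms(2) by (auto simp: j zero_le_mult_iff)
  then have "k = 0 \<or> k = 1" by auto
  then show "x = 0 \<or> x = 2 ^ (i - 1)" using k by (auto simp: j)
qed auto

lemma theta_cyclic_factor_aux:
  assumes K: "comm_group K" "finite (carrier K)" and char2: "CHAR('f::finite_field) = 2" and i: "i \<ge> 2"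
  shows "central_ext TYPE('f) (integer_mod_group (2 ^ i) \<times>\<times> K) (integer_mod_group (2 ^ (i - 1)) \<times>\<times> K)
    (\<lambda>(x, k). (x mod 2 ^ (i - 1), k)) (2 ^ (i - 1), \<one>\<^bsub>K\<^esub>)"
proof -
  interpret K: comm_group K by fact
  have g: "group (integer_mod_group (2 ^ i) \<times>\<times> K)"
    by (intro DirProd_group) auto
  have h: "comm_group (integer_mod_group (2 ^ (i - 1)) \<times>\<times> K)"
    by (intro DirProd_comm_group K) simp
  have p: "(2::int) ^ (i - 1) < 2 ^ i" using i by (intro power_strict_increasing) auto
  let ?\<phi> = "\<lambda>(x, k). (x mod 2 ^ (i - 1), k) :: int \<times> _"
  have ax: "central_ext_axioms (integer_mod_group (2 ^ i) \<times>\<times> K) (integer_mod_group (2 ^ (i - 1)) \<times>\<times> K)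
    ?\<phi> (2 ^ (i - 1), \<one>\<^bsub>K\<^esub>)"
  proof
    show "?\<phi> \<in> hom (integer_mod_group (2 ^ i) \<times>\<times> K) (integer_mod_group (2 ^ (i - 1)) \<times>\<times> K)"
      using i by (auto simp: hom_def carrier_integer_mod_group pow2_mod_pow2[unfolded One_nat_def] mod_add_eq)
    have "(x, k) \<in> ?\<phi> ` ({0..<2 ^ i} \<times> carrier K)" if "x \<in> {0..<2 ^ (i - 1)}" "k \<in> carrier K" for x k
    proof (rule image_eqI[of _ _ "(x, k)"])
      have "x < 2 ^ i" using that(1) less_trans[OF _ p] by simp
      then show "(x, k) \<in> {0..<2 ^ i} \<times> carrier K" using that by simp
    qed (use that in simp)
    then show "?\<phi> ` carrier (integer_mod_group (2 ^ i) \<times>\<times> K) = carrier (integer_mod_group (2 ^ (i - 1)) \<times>\<times> K)"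
      by (auto simp: carrier_integer_mod_group)
    show "(2 ^ (i - 1), \<one>\<^bsub>K\<^esub>) \<in> carrier (integer_mod_group (2 ^ i) \<times>\<times> K)"
      using p by (simp add: carrier_integer_mod_group)
    fix g assume "g \<in> carrier (integer_mod_group (2 ^ i) \<times>\<times> K)"
    then show "(?\<phi> g = \<one>\<^bsub>integer_mod_group (2 ^ (i - 1)) \<times>\<times> K\<^esub>) =
      (g = \<one>\<^bsub>integer_mod_group (2 ^ i) \<times>\<times> K\<^esub> \<or> g = (2 ^ (i - 1), \<one>\<^bsub>K\<^esub>))"
      using i mod_pow2_eq_0[of i "fst g"] by (cases g) (auto simp: carrier_integer_mod_group)
  qed simp
  show ?thesis
    using g h ax K(2) char2
    by (simp add: central_ext_def grp_alg_def grp_alg_axioms_def carrier_integer_mod_group)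
qed

text \<open>The step from Z_2 to Z_4 doubles by \<open>theta_double\<close> with the projection to
  Z_4. In all later steps \<open>c\<close> is a fourth power, so \<open>clf_via_square\<close> makes
  \<open>dlt\<close> onto.\<close>

lemma theta_cyclic_factor:
  assumes K: "comm_group K" "finite (carrier K)" and char2: "CHAR('f::finite_field) = 2" and "i \<ge> 2"
    and "theta (integer_mod_group 2 \<times>\<times> K) (F::'f itself) t"
  shows "theta (integer_mod_group (2 ^ i) \<times>\<times> K) F (2 * t)"
  using \<open>i \<ge> 2\<close>
proof (induction i rule: dec_induct)
  case base
  interpret K: comm_group K by fact
  let ?G = "integer_mod_group (2 ^ 2) \<times>\<times> K"
  interpret central_ext ?G "integer_mod_group (2 ^ (2 - 1)) \<times>\<times> K" F
    "\<lambda>(x, k). (x mod 2 ^ (2 - 1), k)" "(2 ^ (2 - 1), \<one>\<^bsub>K\<^esub>)"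
    by (rule theta_cyclic_factor_aux[OF K char2]) simp
  have "comm_group ?G" by (intro DirProd_comm_group K) simp
  then interpret G: comm_group ?G .
  show ?case
  proof (rule theta_double[where p = fst and ?g0.0 = "(1, \<one>\<^bsub>K\<^esub>)"])
    show "fst \<in> hom ?G (integer_mod_group 4)"
      by (auto simp: hom_def)
    show "theta (integer_mod_group (2 ^ (2 - 1)) \<times>\<times> K) F t" using assms(5) by simp
  qed (auto simp: carrier_integer_mod_group G.m_comm[simplified])
next
  case (step j)
  interpret K: comm_group K by fact
  let ?G = "integer_mod_group (2 ^ Suc j) \<times>\<times> K"
  interpret central_ext ?G "integer_mod_group (2 ^ (Suc j - 1)) \<times>\<times> K" F
    "\<lambda>(x, k). (x mod 2 ^ (Suc j - 1), k)" "(2 ^ (Suc j - 1), \<one>\<^bsub>K\<^esub>)"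
    by (rule theta_cyclic_factor_aux[OF K char2]) (use step in simp)
  have "comm_group ?G" by (intro DirProd_comm_group K) simp
  then interpret G: comm_group ?G .
  \<comment> \<open>Since j >= 2, there is room for 2^(j-2), four times which is 2^j, the element
    \<open>c\<close> of Z_(2^(j+1)).\<close>
  obtain l where l: "j = Suc (Suc l)" using step by (metis Suc_le_D numeral_2_eq_2 Suc_le_mono)
  have u: "(2 ^ l, \<one>\<^bsub>K\<^esub>) \<in> carrier ?G"
    by (simp add: carrier_integer_mod_group l)
  have u2: "(2 ^ l, \<one>\<^bsub>K\<^esub>) \<otimes>\<^bsub>?G\<^esub> (2 ^ l, \<one>\<^bsub>K\<^esub>) = (2 ^ Suc l, \<one>\<^bsub>K\<^esub>)"
    by (simp add: l)
  show ?case
  proof (rule theta_surj)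
    show "theta (integer_mod_group (2 ^ (Suc j - 1)) \<times>\<times> K) F (2 * t)" using step.IH by simp
    fix g a assume g: "g \<in> carrier ?G" "g \<otimes>\<^bsub>?G\<^esub> g = (2 ^ (Suc j - 1), \<one>\<^bsub>K\<^esub>)"
    show "clf g a \<in> dlt ` T"
    proof (rule clf_via_square[OF u _ g])
      show "(2 ^ l, \<one>\<^bsub>K\<^esub>) \<otimes>\<^bsub>?G\<^esub> (2 ^ l, \<one>\<^bsub>K\<^esub>) \<otimes>\<^bsub>?G\<^esub> ((2 ^ l, \<one>\<^bsub>K\<^esub>) \<otimes>\<^bsub>?G\<^esub> (2 ^ l, \<one>\<^bsub>K\<^esub>)) = (2 ^ (Suc j - 1), \<one>\<^bsub>K\<^esub>)"
        unfolding u2 by (simp add: l)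
    qed (rule G.m_comm[OF g(1)], use u in blast)
  qed
qed

text \<open>Starting from Z_2 x Z_2 x E, the factor Z_(2^n) is built first, then the factors are
  swapped and Z_(2^m) is built. For m = 1 the second stage is empty, hence 2 instead of 4.\<close>

lemma theta_abelian:
  assumes E: "comm_group E" "finite (carrier E)" and sq: "\<And>x. x \<in> carrier E \<Longrightarrow> x \<otimes>\<^bsub>E\<^esub> x = \<one>\<^bsub>E\<^esub>"
    and char2: "CHAR('f::finite_field) = 2" and "n \<ge> 2" "m \<ge> 1"
  shows "theta (integer_mod_group (2 ^ m) \<times>\<times> (integer_mod_group (2 ^ n) \<times>\<times> E)) (F::'f itself)
    (if m = 1 then 2 else 4)"
proof -
  let ?Z = "\<lambda>n. integer_mod_group (2 ^ n)"
  have Z2: "comm_group (integer_mod_group 2)" "finite (carrier (integer_mod_group 2))"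
    by (simp_all add: carrier_integer_mod_group)
  have c: "comm_group (?Z n \<times>\<times> E)" "finite (carrier (?Z n \<times>\<times> E))" "comm_group (integer_mod_group 2 \<times>\<times> E)"
    using E Z2 by (auto intro!: DirProd_comm_group simp: carrier_integer_mod_group)
  have "theta (integer_mod_group 2 \<times>\<times> (integer_mod_group 2 \<times>\<times> E)) F 1"
  proof (rule theta_elementary)
    show "group (integer_mod_group 2 \<times>\<times> (integer_mod_group 2 \<times>\<times> E))"
      using comm_group.axioms(2)[OF DirProd_comm_group[OF Z2(1) c(3)]] .
  qed (use E sq char2 in \<open>auto simp: carrier_integer_mod_group\<close>)
  then have 1: "theta (?Z n \<times>\<times> (integer_mod_group 2 \<times>\<times> E)) F 2"
    using theta_cyclic_factor[OF c(3) _ char2 \<open>n \<ge> 2\<close>, of F 1] E by (simp add: carrier_integer_mod_group)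
  have 2: "theta (integer_mod_group 2 \<times>\<times> (?Z n \<times>\<times> E)) F 2"
  proof (rule theta_iso[OF _ _ _ _ char2 1])
    show "group (integer_mod_group 2 \<times>\<times> (?Z n \<times>\<times> E))" "group (?Z n \<times>\<times> (integer_mod_group 2 \<times>\<times> E))"
      using comm_group.axioms(2)[OF DirProd_comm_group[OF Z2(1) c(1)]]
        comm_group.axioms(2)[OF DirProd_comm_group[OF _ c(3)], of "?Z n"] by simp_all
    have "(\<lambda>(a, b, e). (b, a, e)) \<in> iso (integer_mod_group 2 \<times>\<times> (?Z n \<times>\<times> E)) (?Z n \<times>\<times> (integer_mod_group 2 \<times>\<times> E))"
      by (auto simp: iso_def hom_def bij_betw_def inj_on_def image_iff)
    then show "integer_mod_group 2 \<times>\<times> (?Z n \<times>\<times> E) \<cong> ?Z n \<times>\<times> (integer_mod_group 2 \<times>\<times> E)"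
      by (auto simp: is_iso_def)
  qed (use E in \<open>simp add: carrier_integer_mod_group\<close>)
  show ?thesis
  proof (cases "m = 1")
    case False
    then show ?thesis using theta_cyclic_factor[OF c(1,2) char2 _ 2, of m] \<open>m \<ge> 1\<close> by simp
  qed (use 2 in simp)
qed

section \<open>Cocycle extensions\<close>

text \<open>Booleans serve as the field of two elements with \<open>\<noteq>\<close> as addition.
  The first term accounts for moving an odd power of the cyclic generator a past the generator b of
  the same factor; \<open>B\<close> is the part that does not involve the cyclic coordinate.\<close>

definition cw :: "('v \<Rightarrow> bool) \<Rightarrow> ('v \<Rightarrow> 'v \<Rightarrow> bool) \<Rightarrow> int \<times> 'v \<Rightarrow> int \<times> 'v \<Rightarrow> bool" where
  "cw \<beta> B g h \<longleftrightarrow> (odd (fst g) \<and> \<beta> (snd h)) \<noteq> B (snd g) (snd h)"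

definition cocycle_ext :: "nat \<Rightarrow> 'v monoid \<Rightarrow> ('v \<Rightarrow> bool) \<Rightarrow> ('v \<Rightarrow> 'v \<Rightarrow> bool) \<Rightarrow> (int \<times> 'v) monoid" where
  "cocycle_ext m V \<beta> B = \<lparr>carrier = {0..<2 ^ (m + 1)} \<times> carrier V,
     monoid.mult = (\<lambda>g h. ((fst g + fst h + 2 ^ m * of_bool (cw \<beta> B g h)) mod 2 ^ (m + 1), snd g \<otimes>\<^bsub>V\<^esub> snd h)),
     one = (0, \<one>\<^bsub>V\<^esub>)\<rparr>"

text \<open>Reduces associativity to the cocycle identity modulo q, which is the hypothesis.\<close>

lemma mod_assoc_aux:
  assumes "(p + s) mod q = (t + u) mod (q::int)"
  shows "((g + h + p) mod q + x + s) mod q = (g + (h + x + t) mod q + u) mod q"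
proof -
  have "((g + h + p) mod q + x + s) mod q = (g + h + p + (x + s)) mod q"
    by (simp only: add.assoc[of _ x s] mod_add_left_eq)
  also have "\<dots> = (g + h + x + (p + s)) mod q" by (simp add: ac_simps)
  also have "\<dots> = (g + h + x + (t + u)) mod q" using assms by (metis mod_add_right_eq)
  also have "\<dots> = (h + x + t + (g + u)) mod q" by (simp add: ac_simps)
  also have "\<dots> = ((h + x + t) mod q + (g + u)) mod q" by (simp only: mod_add_left_eq)
  finally show ?thesis by (simp only: ac_simps)
qed

locale twist = V: comm_group V for V :: "'v monoid" (structure) +
  fixes m :: nat and \<beta> :: "'v \<Rightarrow> bool" and B :: "'v \<Rightarrow> 'v \<Rightarrow> bool"
  assumes m: "m \<ge> 1" and finV: "finite (carrier V)"
    and elem: "v \<in> carrier V \<Longrightarrow> v \<otimes> v = \<one>"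
    and \<beta>: "v \<in> carrier V \<Longrightarrow> w \<in> carrier V \<Longrightarrow> \<beta> (v \<otimes> w) = (\<beta> v \<noteq> \<beta> w)"
    and B1: "v \<in> carrier V \<Longrightarrow> w \<in> carrier V \<Longrightarrow> x \<in> carrier V \<Longrightarrow> B (v \<otimes> w) x = (B v x \<noteq> B w x)"
    and B2: "v \<in> carrier V \<Longrightarrow> w \<in> carrier V \<Longrightarrow> x \<in> carrier V \<Longrightarrow> B x (v \<otimes> w) = (B x v \<noteq> B x w)"
begin

abbreviation "W \<equiv> cocycle_ext m V \<beta> B"
abbreviation "w2 \<equiv> cw \<beta> B"
abbreviation multW (infixl "\<bullet>" 70) where "g \<bullet> h \<equiv> g \<otimes>\<^bsub>W\<^esub> h"

lemma carrier_W: "carrier W = {0..<2 ^ (m + 1)} \<times> carrier V"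
  and one_W: "\<one>\<^bsub>W\<^esub> = (0, \<one>)"
  and mult_W: "g \<bullet> h = ((fst g + fst h + 2 ^ m * of_bool (w2 g h)) mod 2 ^ (m + 1), snd g \<otimes> snd h)"
  by (simp_all add: cocycle_ext_def)

lemma \<beta>_one [simp]: "\<not> \<beta> \<one>" and B_one [simp]: "x \<in> carrier V \<Longrightarrow> \<not> B \<one> x" "x \<in> carrier V \<Longrightarrow> \<not> B x \<one>"
  using \<beta>[of \<one> \<one>] B1[of \<one> \<one> x] B2[of \<one> \<one> x] by auto

lemma odd_mod [simp]: "odd ((x::int) mod 2 ^ (m + 1)) = odd x"
  by (simp add: dvd_mod_iff)

lemma mult_W_closed [simp]: "g \<in> carrier W \<Longrightarrow> h \<in> carrier W \<Longrightarrow> g \<bullet> h \<in> carrier W"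
  by (auto simp: carrier_W mult_W)

lemma odd_mult_W: "odd (fst (g \<bullet> h)) \<longleftrightarrow> odd (fst g) \<noteq> odd (fst h)"
  unfolding mult_W fst_conv odd_mod using m by simp

lemma snd_mult_W: "snd (g \<bullet> h) = snd g \<otimes> snd h"
  by (simp add: mult_W)

lemma snd_W: "g \<in> carrier W \<Longrightarrow> snd g \<in> carrier V"
  by (auto simp: carrier_W)

lemma w2_mult1:
  assumes "g \<in> carrier W" "h \<in> carrier W" "x \<in> carrier W"
  shows "w2 (g \<bullet> h) x = (w2 g x \<noteq> w2 h x)"
  unfolding cw_def odd_mult_W snd_mult_W B1[OF assms[THEN snd_W]]
  by (cases "\<beta> (snd x)"; cases "odd (fst g)") auto

lemma w2_mult2:
  assumes "g \<in> carrier W" "h \<in> carrier W" "x \<in> carrier W"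
  shows "w2 x (g \<bullet> h) = (w2 x g \<noteq> w2 x h)"
  unfolding cw_def snd_mult_W B2[OF assms[THEN snd_W]] \<beta>[OF assms(1,2)[THEN snd_W]]
  by (cases "odd (fst x)"; cases "\<beta> (snd g)") auto

lemma W_group: "group W"
proof (rule groupI)
  fix g h x assume gh: "g \<in> carrier W" "h \<in> carrier W" and x: "x \<in> carrier W"
  have V: "snd g \<in> carrier V" "snd h \<in> carrier V" "snd x \<in> carrier V" using gh x by (auto simp: carrier_W)
  \<comment> \<open>The cocycle identity, with a, b, c for the values of \<open>w2\<close> at (g,
    h), (g, x), (h, x), after expanding by bilinearity.\<close>
  have e: "(2 ^ m * of_bool a + 2 ^ m * of_bool (b \<noteq> c) :: int) mod 2 ^ (m + 1) =
    (2 ^ m * of_bool c + 2 ^ m * of_bool (a \<noteq> b)) mod 2 ^ (m + 1)" for a b c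
    by (cases a; cases b; cases c) auto
  have "fst (g \<bullet> h \<bullet> x) = fst (g \<bullet> (h \<bullet> x))"
    unfolding mult_W[of "g \<bullet> h"] mult_W[of g "h \<bullet> x"] w2_mult1[OF gh x] w2_mult2[OF gh(2) x gh(1)]
    unfolding mult_W fst_conv by (rule mod_assoc_aux) (rule e)
  then show "g \<bullet> h \<bullet> x = g \<bullet> (h \<bullet> x)"
    by (rule prod_eqI) (simp add: snd_mult_W V.m_assoc V)
next
  fix g assume g: "g \<in> carrier W"
  show "\<one>\<^bsub>W\<^esub> \<bullet> g = g"
    using g by (auto simp: mult_W one_W carrier_W cw_def)
  \<comment> \<open>The correction term appears twice in the product, once from \<open>h\<close> and
    once as \<open>w2 h g\<close> = \<open>w2 g g\<close>, and twice 2^m vanishes modulo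
    2^(m+1).\<close>
  define h where "h = ((- fst g + 2 ^ m * of_bool (w2 g g)) mod 2 ^ (m + 1), snd g)"
  have h: "h \<in> carrier W" using g by (auto simp: h_def carrier_W)
  have "w2 h g = w2 g g"
    unfolding h_def cw_def fst_conv snd_conv odd_mod using m by simp
  then have "fst (h \<bullet> g) = ((- fst g + 2 ^ m * of_bool (w2 g g)) mod 2 ^ (m + 1) + (fst g + 2 ^ m * of_bool (w2 g g))) mod 2 ^ (m + 1)"
    unfolding mult_W fst_conv by (simp only: h_def fst_conv add.assoc)
  also have "\<dots> = (2 * 2 ^ m * of_bool (w2 g g)) mod 2 ^ (m + 1)"
    unfolding mod_add_left_eq by simp
  also have "\<dots> = 0" by simp
  finally have "fst (h \<bullet> g) = 0" .
  moreover have "snd (h \<bullet> g) = \<one>" using snd_W[OF g] by (simp add: snd_mult_W h_def elem)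
  ultimately have "h \<bullet> g = \<one>\<^bsub>W\<^esub>" by (simp add: prod_eq_iff one_W)
  then show "\<exists>h\<in>carrier W. h \<bullet> g = \<one>\<^bsub>W\<^esub>" using h by blast
qed (erule (1) mult_W_closed, simp add: carrier_W one_W)

sublocale W: group W by (rule W_group)

lemma finite_W [simp]: "finite (carrier W)"
  using finV by (simp add: carrier_W)

definition cW :: "int \<times> 'v" where "cW = (2 ^ m, \<one>)"

lemma cW [simp]: "cW \<in> carrier W" "cW \<noteq> \<one>\<^bsub>W\<^esub>"
  by (simp_all add: cW_def carrier_W one_W)

lemma W_sq: "g \<in> carrier W \<Longrightarrow> g \<bullet> g = ((2 * fst g + 2 ^ m * of_bool (w2 g g)) mod 2 ^ (m + 1), \<one>)"
  by (auto simp: mult_W carrier_W elem)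

lemma of_bool_cancel: "(x + 2 ^ m * of_bool a) mod 2 ^ (m + 1) = (x + 2 ^ m * of_bool b) mod (2 ^ (m + 1)::int) \<longleftrightarrow> a = b"
proof (cases "a = b")
  case False
  have "\<not> (2 * 2 ^ m :: int) dvd 2 ^ m" using zdvd_imp_le[of "2 * 2 ^ m" "2 ^ m :: int"] by auto
  then show ?thesis using False by (cases a; cases b) (auto simp: mod_eq_dvd_iff)
qed simp

lemma W_commute_iff:
  "g \<in> carrier W \<Longrightarrow> h \<in> carrier W \<Longrightarrow> g \<bullet> h = h \<bullet> g \<longleftrightarrow> w2 g h = w2 h g"
  using of_bool_cancel[of "fst g + fst h" "w2 g h" "w2 h g"]
  by (auto simp: mult_W carrier_W V.m_comm add.commute)

text \<open>Modulo 4 the doubled exponent is 2 exactly for odd exponents, and \<open>w2 g g\<close>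
  adds another 2. The square is 1 if both or neither occur.\<close>

lemma W_sq_m1:
  assumes "m = 1" "g \<in> carrier W"
  shows "g \<bullet> g = (if odd (fst g) = w2 g g then \<one>\<^bsub>W\<^esub> else cW)"
proof -
  have p: "(2::int) ^ m = 2" "(2::int) ^ (m + 1) = 4" by (simp_all add: assms)
  have "fst g \<in> {0, 1, 2, 3}" using assms(2) unfolding carrier_W p by auto
  then show ?thesis unfolding W_sq[OF assms(2)] one_W cW_def p by auto
qed

end

text \<open>The commutator of g and h is g h times the inverse of h g, hence 1 or c, and {1, c} is a
  subgroup.\<close>

lemma (in group) derived_subset_pair:
  assumes c: "c \<in> carrier G" "c \<otimes> c = \<one>"
    and comm: "\<And>g h. g \<in> carrier G \<Longrightarrow> h \<in> carrier G \<Longrightarrow> g \<otimes> h = h \<otimes> g \<or> g \<otimes> h = c \<otimes> (h \<otimes> g)"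
  shows "derived G (carrier G) \<subseteq> {\<one>, c}"
proof -
  have "inv c = c" using c by (simp add: inv_equality)
  then have "subgroup {\<one>, c} G"
    using c by unfold_locales auto
  moreover have "derived_set G (carrier G) \<subseteq> {\<one>, c}"
  proof
    fix x assume "x \<in> derived_set G (carrier G)"
    then obtain g h where gh: "g \<in> carrier G" "h \<in> carrier G"
      and x: "x = g \<otimes> h \<otimes> inv g \<otimes> inv h" by blast
    have x': "x = g \<otimes> h \<otimes> inv (h \<otimes> g)"
      using gh by (simp add: x inv_mult_group m_assoc)
    from comm[OF gh] show "x \<in> {\<one>, c}"
    proof
      assume "g \<otimes> h = h \<otimes> g"
      then show ?thesis using gh unfolding x' by (simp only: r_inv m_closed insert_iff simp_thms)
    next
      assume "g \<otimes> h = c \<otimes> (h \<otimes> g)"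
      then have "x = c \<otimes> ((h \<otimes> g) \<otimes> inv (h \<otimes> g))"
        using gh c(1) unfolding x' by (simp only: m_assoc m_closed inv_closed)
      then show ?thesis using gh c(1) by (simp only: r_inv m_closed r_one insert_iff simp_thms)
    qed
  qed
  ultimately show ?thesis
    unfolding derived_def by (intro generate_subgroup_incl)
qed

lemma (in central_ext) derived_subset: "derived G (carrier G) \<subseteq> {\<one>\<^bsub>G\<^esub>, c}"
  by (rule derived_subset_pair[OF c c_sq comm_cases])

lemma double_mod_pow2_eq_0:
  assumes "i \<ge> 1" "x \<in> {0..<2 ^ i}"
  shows "(x + x) mod 2 ^ i = (0::int) \<longleftrightarrow> x = 0 \<or> x = 2 ^ (i - 1)"
proof -
  obtain j where j: "i = Suc j" using assms by (cases i) auto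
  have "(x + x) mod 2 ^ i = 2 * (x mod 2 ^ j)"
    by (simp only: j power_Suc mult_2[symmetric] mult_mod_right)
  then have "(x + x) mod 2 ^ i = 0 \<longleftrightarrow> x mod 2 ^ (i - 1) = 0" by (simp only: j diff_Suc_1) simp
  then show ?thesis using mod_pow2_eq_0[OF assms] by (simp only:)
qed

context twist begin

lemma cW_mult: "g \<in> carrier W \<Longrightarrow> cW \<bullet> g = ((2 ^ m + fst g) mod 2 ^ (m + 1), snd g)"
  using m by (auto simp: mult_W cW_def cw_def carrier_W)

lemma W_comm_cases:
  assumes "g \<in> carrier W" "h \<in> carrier W"
  shows "g \<bullet> h = h \<bullet> g \<or> g \<bullet> h = cW \<bullet> (h \<bullet> g)"
proof (cases "w2 g h = w2 h g")
  case False
  have "(2 ^ m + (s + 2 ^ m * of_bool (\<not> b)) mod 2 ^ (m + 1)) mod 2 ^ (m + 1) =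
    (s + 2 ^ m * of_bool b) mod (2 ^ (m + 1) :: int)" for s b
  proof (cases b)
    case False
    have "2 ^ m + (s + 2 ^ m) = 2 ^ (m + 1) + s" by simp
    then show ?thesis
      using False unfolding mod_add_right_eq by (simp only: mod_add_self1 not_False_eq_True of_bool_eq mult_1_right mult_zero_right add_0_right)
  next
    case True
    then show ?thesis
      unfolding mod_add_right_eq by (simp add: add.commute)
  qed
  from this[of "fst g + fst h" "w2 g h"]
  have "fst (g \<bullet> h) = fst (cW \<bullet> (h \<bullet> g))"
    using False unfolding cW_mult[OF mult_W_closed[OF assms(2,1)]]
    by (simp only: mult_W fst_conv add.commute[of "fst h"]) (cases "w2 g h"; simp)
  moreover have "snd (g \<bullet> h) = snd (cW \<bullet> (h \<bullet> g))"
    unfolding cW_mult[OF mult_W_closed[OF assms(2,1)]] snd_conv snd_mult_W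
    using V.m_comm assms[THEN snd_W] by blast
  ultimately show ?thesis by (simp only: prod_eq_iff simp_thms)
qed (use W_commute_iff assms in blast)

lemma cW_sq: "cW \<bullet> cW = \<one>\<^bsub>W\<^esub>"
  unfolding cW_mult[OF cW(1)] by (simp add: cW_def one_W)

lemma derived_W:
  assumes "g \<in> carrier W" "h \<in> carrier W" "g \<bullet> h \<noteq> h \<bullet> g"
  shows "derived W (carrier W) = {\<one>\<^bsub>W\<^esub>, cW}"
proof -
  have sub: "derived W (carrier W) \<subseteq> {\<one>\<^bsub>W\<^esub>, cW}"
    by (rule W.derived_subset_pair[OF cW(1) cW_sq W_comm_cases])
  let ?x = "g \<bullet> h \<bullet> inv\<^bsub>W\<^esub> g \<bullet> inv\<^bsub>W\<^esub> h"
  have x: "?x \<in> derived W (carrier W)"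
    unfolding derived_def by (rule generate.incl) (use assms(1,2) in blast)
  have "?x \<noteq> \<one>\<^bsub>W\<^esub>"
  proof
    assume "?x = \<one>\<^bsub>W\<^esub>"
    moreover have "?x = (g \<bullet> h) \<bullet> inv\<^bsub>W\<^esub> (h \<bullet> g)"
      using assms(1,2) by (simp only: W.inv_mult_group W.m_assoc W.m_closed W.inv_closed)
    ultimately have *: "(g \<bullet> h) \<bullet> inv\<^bsub>W\<^esub> (h \<bullet> g) = \<one>\<^bsub>W\<^esub>" by simp
    have "g \<bullet> h = ((g \<bullet> h) \<bullet> inv\<^bsub>W\<^esub> (h \<bullet> g)) \<bullet> (h \<bullet> g)"
      using assms(1,2) by (simp only: W.m_assoc W.m_closed W.inv_closed W.l_inv W.r_one)
    also have "\<dots> = h \<bullet> g"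
      unfolding * by (rule W.l_one[OF mult_W_closed[OF assms(2,1)]])
    finally show False using assms(3) by contradiction
  qed
  with x obtain y where y: "y \<in> derived W (carrier W)" "y \<noteq> \<one>\<^bsub>W\<^esub>" by (rule that)
  moreover from subsetD[OF sub y(1)] y(2) have "y = cW" by (simp only: insert_iff empty_iff simp_thms)
  moreover have "\<one>\<^bsub>W\<^esub> \<in> derived W (carrier W)" unfolding derived_def by (rule generate.one)
  ultimately have "{\<one>\<^bsub>W\<^esub>, cW} \<subseteq> derived W (carrier W)" by (simp only: insert_subset empty_subsetI simp_thms)
  with sub show ?thesis by (rule equalityI)
qed

end

section \<open>The direct product with a cyclic group\<close>

locale twist_prod = twist V m \<beta> B for V :: "'v monoid" (structure) and m \<beta> B +
  fixes n :: nat and F :: "'f::finite_field itself"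
  assumes n: "n \<ge> 2" and char2: "CHAR('f) = 2"
begin

abbreviation "Zn \<equiv> integer_mod_group (2 ^ n)"
abbreviation "GG \<equiv> W \<times>\<times> Zn"
abbreviation multG (infixl "\<diamondop>" 70) where "g \<diamondop> h \<equiv> g \<otimes>\<^bsub>GG\<^esub> h"
abbreviation "HH \<equiv> integer_mod_group (2 ^ m) \<times>\<times> (Zn \<times>\<times> V)"

text \<open>The quotient map modulo \<open>c\<close>: the cyclic coordinate is reduced, and the
  components are put into the order used in \<open>theta_abelian\<close>.\<close>

definition \<phi> :: "(int \<times> 'v) \<times> int \<Rightarrow> int \<times> (int \<times> 'v)" where
  "\<phi> g = (fst (fst g) mod 2 ^ m, (snd g, snd (fst g)))"

lemma GG_group: "group GG"
  by (intro DirProd_group W_group) simp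

lemma mod_2m: "(x::int) mod 2 ^ (m + 1) mod 2 ^ m = x mod 2 ^ m"
  using pow2_mod_pow2[of "m + 1" x] by simp

lemma HH_comm: "comm_group HH"
  by (intro DirProd_comm_group V.comm_group_axioms) simp_all

lemma ext: "central_ext TYPE('f) GG HH \<phi> (cW, 0)"
proof -
  have "central_ext_axioms GG HH \<phi> (cW, 0)"
  proof
    show "\<phi> \<in> hom GG HH"
    proof (rule homI)
      fix g assume "g \<in> carrier GG"
      then show "\<phi> g \<in> carrier HH"
        by (auto simp: \<phi>_def carrier_W carrier_integer_mod_group)
    next
      fix g h assume "g \<in> carrier GG" "h \<in> carrier GG"
      have "(fst (fst g) + fst (fst h) + 2 ^ m * of_bool b) mod 2 ^ (m + 1) mod 2 ^ m =
        (fst (fst g) mod 2 ^ m + fst (fst h) mod 2 ^ m) mod 2 ^ m" for b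
        unfolding mod_2m by (simp add: mod_add_eq)
      then show "\<phi> (g \<diamondop> h) = \<phi> g \<otimes>\<^bsub>HH\<^esub> \<phi> h"
        by (simp add: mult_DirProd' \<phi>_def mult_W)
    qed
    show "\<phi> ` carrier GG = carrier HH"
    proof (rule equalityI; rule subsetI)
      fix y assume y: "y \<in> carrier HH"
      have "(2::int) ^ m < 2 ^ (m + 1)" by simp
      then have "((fst y, snd (snd y)), fst (snd y)) \<in> carrier GG" "\<phi> ((fst y, snd (snd y)), fst (snd y)) = y"
        using y by (auto simp: \<phi>_def carrier_W carrier_integer_mod_group)
      then show "y \<in> \<phi> ` carrier GG" by (metis imageI)
    qed (auto simp: \<phi>_def carrier_W carrier_integer_mod_group)
    show "(cW, 0) \<in> carrier GG" by simp
    show "(cW, 0) \<noteq> \<one>\<^bsub>GG\<^esub>" using cW(2) by simp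
    fix g assume g: "g \<in> carrier GG"
    have "fst (fst g) mod 2 ^ m = 0 \<longleftrightarrow> fst (fst g) = 0 \<or> fst (fst g) = 2 ^ m"
      using mod_pow2_eq_0[of "m + 1" "fst (fst g)"] g by (auto simp: carrier_W)
    then show "(\<phi> g = \<one>\<^bsub>HH\<^esub>) = (g = \<one>\<^bsub>GG\<^esub> \<or> g = (cW, 0))"
      by (auto simp: \<phi>_def one_W cW_def prod_eq_iff)
  qed
  then show ?thesis
    using GG_group HH_comm char2
    by (simp add: central_ext_def grp_alg_def grp_alg_axioms_def carrier_integer_mod_group)
qed

sublocale X: central_ext GG HH F \<phi> "(cW, 0)" by (rule ext)

lemma theta_HH: "theta HH F (if m = 1 then 2 else 4)"
  by (rule theta_abelian) (use V.comm_group_axioms finV elem char2 n m in auto)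

text \<open>For \<open>m \<ge> 2\<close> the square \<open>\<zeta>\<close> of \<open>u\<close> is a central square root of \<open>c\<close>, although \<open>u\<close> is not central if \<open>m = 2\<close>.\<close>

definition u :: "(int \<times> 'v) \<times> int" where "u = ((2 ^ (m - 2), \<one>), 0)"

definition \<zeta> :: "(int \<times> 'v) \<times> int" where "\<zeta> = ((2 ^ (m - 1), \<one>), 0)"

lemma u: "m \<ge> 2 \<Longrightarrow> u \<in> carrier GG" "m \<ge> 2 \<Longrightarrow> u \<diamondop> u = \<zeta>"
  and \<zeta>: "\<zeta> \<in> carrier GG" "m \<ge> 2 \<Longrightarrow> \<zeta> \<diamondop> \<zeta> = (cW, 0)"
    "m \<ge> 2 \<Longrightarrow> g \<in> carrier GG \<Longrightarrow> g \<diamondop> \<zeta> = \<zeta> \<diamondop> g"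
proof -
  have lt: "(2::int) ^ (m - 1) < 2 ^ (m + 1)" "(2::int) ^ m < 2 ^ (m + 1)" "(2::int) ^ (m - 2) < 2 ^ (m + 1)"
    by (rule power_strict_increasing; simp)+
  show "u \<in> carrier GG" "\<zeta> \<in> carrier GG"
    using lt by (simp_all add: u_def \<zeta>_def carrier_W)
  assume m2: "m \<ge> 2"
  have "(2::int) ^ (m - 2) + 2 ^ (m - 2) = 2 ^ (m - 1)" "(2::int) ^ (m - 1) + 2 ^ (m - 1) = 2 ^ m"
    using m2 by (cases m; cases "m - 1"; simp)+
  then have e: "((2::int) ^ (m - 2) + 2 ^ (m - 2)) mod 2 ^ (m + 1) = 2 ^ (m - 1)"
    "((2::int) ^ (m - 1) + 2 ^ (m - 1)) mod 2 ^ (m + 1) = 2 ^ m"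
    using lt by (simp_all only: mod_pos_pos_trivial zero_le_power zero_le_numeral)
  have nw: "w2 (x, \<one>) (y, \<one>) = False" for x y by (simp add: cw_def)
  note simps = mult_DirProd mult_W fst_conv snd_conv nw of_bool_eq(1) mult_zero_right add_0_right e
    V.l_one V.one_closed mult_integer_mod_group mod_0
  show "u \<diamondop> u = \<zeta>"
    by (simp only: u_def \<zeta>_def simps)
  show "\<zeta> \<diamondop> \<zeta> = (cW, 0)"
    by (simp only: cW_def \<zeta>_def simps)
  assume g: "g \<in> carrier GG"
  \<comment> \<open>With \<open>\<zeta>\<close> on the right \<open>w2\<close> vanishes because its
    second component is trivial; with \<open>\<zeta>\<close> on the left the even exponent is needed
    as well. This is where m >= 2 enters.\<close>
  have "even ((2::int) ^ (m - 1))" using m2 by simp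
  then have "w2 (fst g) (fst \<zeta>) = w2 (fst \<zeta>) (fst g)"
    using g by (auto simp: cw_def \<zeta>_def carrier_W)
  then have "fst g \<bullet> fst \<zeta> = fst \<zeta> \<bullet> fst g"
    using W_commute_iff[of "fst g" "fst \<zeta>"] g \<open>\<zeta> \<in> carrier GG\<close> by (simp add: mem_Times_iff)
  then show "g \<diamondop> \<zeta> = \<zeta> \<diamondop> g"
    by (simp add: mult_DirProd' add.commute)
qed

text \<open>For m >= 2 every g commutes with \<open>\<zeta>\<close>, the square of \<open>u\<close>,
  so \<open>clf_via_square\<close> applies. For m = 1 the assumed involution is lifted to the direct
  product and fed into \<open>clf_noncomm\<close>.\<close>

lemma theta_GG:
  assumes "\<And>g. m = 1 \<Longrightarrow> g \<in> carrier W \<Longrightarrow> g \<bullet> g = cW \<Longrightarrow>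
     \<exists>h\<in>carrier W. h \<bullet> h = \<one>\<^bsub>W\<^esub> \<and> g \<bullet> h \<noteq> h \<bullet> g"
  shows "theta GG F (if m = 1 then 2 else 4)"
proof (rule X.theta_surj[OF theta_HH])
  fix g a assume g: "g \<in> carrier GG" "g \<diamondop> g = (cW, 0)"
  show "X.clf g a \<in> X.dlt ` X.T"
  proof (cases "m = 1")
    case True
    have "fst g \<in> carrier W" "fst g \<bullet> fst g = cW"
      using g by (auto simp: mult_DirProd' mem_Times_iff)
    from assms[OF True this] obtain h where h: "h \<in> carrier W" "h \<bullet> h = \<one>\<^bsub>W\<^esub>" "fst g \<bullet> h \<noteq> h \<bullet> fst g"
      by blast
    show ?thesis
    proof (rule X.clf_noncomm[OF g])
      show "(h, 0) \<in> carrier GG" "(h, 0) \<diamondop> (h, 0) = \<one>\<^bsub>GG\<^esub>" using h by simp_all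
      show "g \<diamondop> (h, 0) \<noteq> (h, 0) \<diamondop> g" using h by (simp add: mult_DirProd')
    qed
  next
    case False
    then have m2: "m \<ge> 2" using m by simp
    show ?thesis
      by (rule X.clf_via_square[OF u(1)[OF m2] _ g]) (use u(2)[OF m2] \<zeta>(2)[OF m2] \<zeta>(3)[OF m2 g(1)] in simp_all)
  qed
qed

lemma card_Omega_HH: "card (\<Omega>\<^sub>1 HH) = 4 * card (carrier V)"
proof -
  have lt: "(2::int) ^ (m - 1) < 2 ^ m" "(2::int) ^ (n - 1) < 2 ^ n"
    using m n by (auto intro!: power_strict_increasing)
  have n1: "n \<ge> 1" using n by simp
  have "(i, z, v) \<in> \<Omega>\<^sub>1 HH \<longleftrightarrow> (i, z, v) \<in> {0, 2 ^ (m - 1)} \<times> ({0, 2 ^ (n - 1)} \<times> carrier V)" for i z v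
  proof -
    have "(i, z, v) \<in> \<Omega>\<^sub>1 HH \<longleftrightarrow> (i \<in> {0..<2 ^ m} \<and> (i + i) mod 2 ^ m = 0) \<and>
      (z \<in> {0..<2 ^ n} \<and> (z + z) mod 2 ^ n = 0) \<and> v \<in> carrier V"
      using elem[of v] unfolding X.H.Omega_eq by (auto simp add: carrier_integer_mod_group)
    also have "i \<in> {0..<2 ^ m} \<and> (i + i) mod 2 ^ m = 0 \<longleftrightarrow> i = 0 \<or> i = 2 ^ (m - 1)"
      using double_mod_pow2_eq_0[OF m, of i] lt(1) by force
    also have "z \<in> {0..<2 ^ n} \<and> (z + z) mod 2 ^ n = 0 \<longleftrightarrow> z = 0 \<or> z = 2 ^ (n - 1)"
      using double_mod_pow2_eq_0[OF n1, of z] lt(2) by force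
    finally show ?thesis by blast
  qed
  then have "h \<in> \<Omega>\<^sub>1 HH \<longleftrightarrow> h \<in> {0, 2 ^ (m - 1)} \<times> ({0, 2 ^ (n - 1)} \<times> carrier V)" for h
    by (cases h rule: prod_cases3) (simp only:)
  then have "\<Omega>\<^sub>1 HH = {0, 2 ^ (m - 1)} \<times> ({0, 2 ^ (n - 1)} \<times> carrier V)" by (rule Set.set_eqI)
  then show ?thesis by (simp add: card_cartesian_product)
qed

lemma card_Omega_sum: "card (\<Omega>\<^sub>1 GG) + card (\<Omega>\<^sub>c GG (cW, 0)) = 8 * card (carrier V)"
  using X.card_Omega card_Omega_HH by simp

text \<open>Multiplication by the central \<open>\<zeta>\<close> is injective and multiplies squares
  by c. As c^2 = 1, it gives both inequalities between the two cardinalities, and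
  \<open>card_Omega_sum\<close> fixes the common value.\<close>

lemma card_Omega_m2:
  assumes "m \<ge> 2"
  shows "card (\<Omega>\<^sub>1 GG) = 4 * card (carrier V)" "card (\<Omega>\<^sub>c GG (cW, 0)) = 4 * card (carrier V)"
proof -
  note z = \<zeta>(1) \<zeta>(2)[OF assms] and zc = \<zeta>(3)[OF assms]
  have sq: "(\<zeta> \<diamondop> g) \<diamondop> (\<zeta> \<diamondop> g) = (cW, 0) \<diamondop> (g \<diamondop> g)" if g: "g \<in> carrier GG" for g
  proof -
    have "(\<zeta> \<diamondop> g) \<diamondop> (\<zeta> \<diamondop> g) = \<zeta> \<diamondop> (g \<diamondop> \<zeta>) \<diamondop> g"
      using g z(1) by (simp only: X.m_assoc X.m_closed)
    also have "\<dots> = (\<zeta> \<diamondop> \<zeta>) \<diamondop> (g \<diamondop> g)"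
      unfolding zc[OF g] using g z(1) by (simp only: X.m_assoc X.m_closed)
    finally show ?thesis by (simp only: z(2))
  qed
  have inj: "inj_on (\<lambda>g. \<zeta> \<diamondop> g) A" if "A \<subseteq> carrier GG" for A
  proof (rule inj_onI)
    fix a b assume "a \<in> A" "b \<in> A" and eq: "\<zeta> \<diamondop> a = \<zeta> \<diamondop> b"
    then have "a \<in> carrier GG" "b \<in> carrier GG" using that by blast+
    from X.l_cancel[OF eq this z(1)] show "a = b" .
  qed
  have fO: "finite (\<Omega>\<^sub>c GG d)" "\<Omega>\<^sub>c GG d \<subseteq> carrier GG" for d
    unfolding X.Omega_eq using X.fin by auto
  have maps: "(\<lambda>g. \<zeta> \<diamondop> g) ` \<Omega>\<^sub>c GG d \<subseteq> \<Omega>\<^sub>c GG ((cW, 0) \<diamondop> d)" for d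
  proof
    fix y assume "y \<in> (\<lambda>g. \<zeta> \<diamondop> g) ` \<Omega>\<^sub>c GG d"
    then obtain g where g: "g \<in> carrier GG" "g \<diamondop> g = d" "y = \<zeta> \<diamondop> g" unfolding X.Omega_eq by blast
    from sq[OF g(1)] have "y \<diamondop> y = (cW, 0) \<diamondop> d" unfolding g(2,3) .
    moreover have "y \<in> carrier GG" unfolding g(3) by (rule X.m_closed[OF z(1) g(1)])
    ultimately show "y \<in> \<Omega>\<^sub>c GG ((cW, 0) \<diamondop> d)" unfolding X.Omega_eq by blast
  qed
  have "card (\<Omega>\<^sub>1 GG) \<le> card (\<Omega>\<^sub>c GG (cW, 0))"
    using card_inj_on_le[OF inj[OF fO(2)] maps fO(1), of "\<one>\<^bsub>GG\<^esub>"] unfolding X.r_one[OF X.c] .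
  moreover have "card (\<Omega>\<^sub>c GG (cW, 0)) \<le> card (\<Omega>\<^sub>1 GG)"
    using card_inj_on_le[OF inj[OF fO(2)] maps fO(1), of "(cW, 0)"] unfolding X.c_sq .
  ultimately have "card (\<Omega>\<^sub>1 GG) = card (\<Omega>\<^sub>c GG (cW, 0))" by (rule antisym)
  then show "card (\<Omega>\<^sub>1 GG) = 4 * card (carrier V)" "card (\<Omega>\<^sub>c GG (cW, 0)) = 4 * card (carrier V)"
    using card_Omega_sum by simp_all
qed

lemma card_Omega_GG:
  assumes "d \<in> carrier W" shows "card (\<Omega>\<^sub>c GG (d, 0)) = 2 * card (\<Omega>\<^sub>c W d)"
proof -
  have lt: "(2::int) ^ (n - 1) < 2 ^ n" using n by (auto intro!: power_strict_increasing)
  have n1: "n \<ge> 1" using n by simp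
  have "(w, z) \<in> \<Omega>\<^sub>c GG (d, 0) \<longleftrightarrow> (w, z) \<in> \<Omega>\<^sub>c W d \<times> {0, 2 ^ (n - 1)}" for w z
  proof -
    have "(w, z) \<in> \<Omega>\<^sub>c GG (d, 0) \<longleftrightarrow> w \<in> \<Omega>\<^sub>c W d \<and> (z \<in> {0..<2 ^ n} \<and> (z + z) mod 2 ^ n = 0)"
      unfolding X.Omega_eq W.Omega_eq by (auto simp add: carrier_integer_mod_group)
    also have "z \<in> {0..<2 ^ n} \<and> (z + z) mod 2 ^ n = 0 \<longleftrightarrow> z = 0 \<or> z = 2 ^ (n - 1)"
      using double_mod_pow2_eq_0[OF n1, of z] lt by force
    finally show ?thesis by blast
  qed
  then have "h \<in> \<Omega>\<^sub>c GG (d, 0) \<longleftrightarrow> h \<in> \<Omega>\<^sub>c W d \<times> {0, 2 ^ (n - 1)}" for h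
    by (cases h) (simp only:)
  then have "\<Omega>\<^sub>c GG (d, 0) = \<Omega>\<^sub>c W d \<times> {0, 2 ^ (n - 1)}" by (rule Set.set_eqI)
  then show ?thesis by (simp add: card_cartesian_product)
qed

text \<open>The difference is a sum of signs over W. For fixed v outside \<open>\<beta>\<close>,
  even and odd exponents have opposite signs and cancel. For v in \<open>\<beta>\<close> the parity
  of the exponent drops out of the condition, and all four exponents contribute the same
  sign.\<close>

lemma card_Omega_m1:
  assumes "m = 1"
  shows "int (card (\<Omega>\<^sub>1 W)) - int (card (\<Omega>\<^sub>c W cW)) =
    4 * (\<Sum>v | v \<in> carrier V \<and> \<beta> v. if B v v then - 1 else 1)"
proof -
  let ?s = "\<lambda>g. if odd (fst g) = w2 g g then 1 else - 1 :: int"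
  let ?b = "\<lambda>v. if B v v then - 1 else 1 :: int"
  have p: "(2::int) ^ m = 2" "(2::int) ^ (m + 1) = 4" by (simp_all add: assms)
  have cW: "carrier W = {0, 1, 2, 3} \<times> carrier V"
    unfolding carrier_W p by auto
  have "g \<bullet> g = \<one>\<^bsub>W\<^esub> \<longleftrightarrow> odd (fst g) = w2 g g" "g \<bullet> g = cW \<longleftrightarrow> \<not> odd (fst g) = w2 g g"
    if "g \<in> carrier W" for g
    using W_sq_m1[OF assms that] twist.cW(2)[OF twist_axioms] by metis+
  then have "\<Omega>\<^sub>1 W = {g \<in> carrier W. odd (fst g) = w2 g g}" "\<Omega>\<^sub>c W cW = {g \<in> carrier W. \<not> odd (fst g) = w2 g g}"
    unfolding W.Omega_eq by blast+
  then have "int (card (\<Omega>\<^sub>1 W)) - int (card (\<Omega>\<^sub>c W cW)) =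
    (\<Sum>g\<in>{g \<in> carrier W. odd (fst g) = w2 g g}. 1) + (\<Sum>g\<in>{g \<in> carrier W. \<not> odd (fst g) = w2 g g}. - 1)"
    by simp
  also have "\<dots> = (\<Sum>g\<in>carrier W. ?s g)"
  proof -
    have "{g \<in> carrier W. odd (fst g) = w2 g g} = carrier W \<inter> {g. odd (fst g) = w2 g g}"
      "{g \<in> carrier W. \<not> odd (fst g) = w2 g g} = carrier W \<inter> - {g. odd (fst g) = w2 g g}" by blast+
    then show ?thesis by (simp only: sum.If_cases[OF finite_W])
  qed
  also have "\<dots> = (\<Sum>i\<in>{0, 1, 2, 3}. \<Sum>v\<in>carrier V. ?s (i, v))"
    unfolding cW sum.cartesian_product by (rule sum.cong[OF HOL.refl]) (simp only: split_beta prod.collapse)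
  also have "\<dots> = (\<Sum>v\<in>carrier V. \<Sum>i\<in>{0, 1, 2, 3}. ?s (i, v))"
    by (rule sum.swap)
  also have "\<dots> = (\<Sum>v\<in>carrier V. if \<beta> v then 4 * ?b v else 0)"
  proof (rule sum.cong)
    fix v
    have q: "w2 (i, v) (i, v) \<longleftrightarrow> (odd i \<and> \<beta> v) \<noteq> B v v" for i by (simp add: cw_def)
    show "(\<Sum>i\<in>{0, 1, 2, 3}. ?s (i, v)) = (if \<beta> v then 4 * ?b v else 0)"
      unfolding q fst_conv by (cases "\<beta> v"; cases "B v v") simp_all
  qed simp
  also have "\<dots> = (\<Sum>v | v \<in> carrier V \<and> \<beta> v. 4 * ?b v)"
    by (rule sum.inter_filter[symmetric, OF finV])
  finally show ?thesis by (simp add: sum_distrib_left)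
qed

lemma order_GG: "order GG = 2 ^ (m + 1) * card (carrier V) * 2 ^ n"
proof -
  have "card {0..<2 ^ i :: int} = 2 ^ i" for i by (simp add: nat_power_eq)
  moreover have "carrier Zn = {0..<2 ^ n}" by (simp add: carrier_integer_mod_group)
  ultimately show ?thesis
    by (simp only: order_def carrier_W carrier_DirProd card_cartesian_product)
qed

end

section \<open>The factors as concrete groups\<close>

text \<open>The value of a word under the assignment \<open>f\<close> of generators, that is, the
  induced homomorphism of the free group written on words.\<close>

definition ev :: "('k, 'm) monoid_scheme \<Rightarrow> ('x \<Rightarrow> 'k) \<Rightarrow> 'x word \<Rightarrow> 'k" where
  "ev K f w = foldr (\<lambda>l y. (if snd l then inv\<^bsub>K\<^esub> f (fst l) else f (fst l)) \<otimes>\<^bsub>K\<^esub> y) w \<one>\<^bsub>K\<^esub>"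

lemma pres_class_eq_iff: "pres_class R u = pres_class R v \<longleftrightarrow> pres_eq R u v"
proof
  assume *: "pres_class R u = pres_class R v"
  have "v \<in> pres_class R v" unfolding pres_class_def by (simp add: pres_eq.refl)
  then show "pres_eq R u v" unfolding *[symmetric] by (simp add: pres_class_def)
next
  assume "pres_eq R u v"
  then show "pres_class R u = pres_class R v"
    unfolding pres_class_def by (blast intro: pres_eq.trans pres_eq.sym)
qed

lemma pres_eq_append:
  assumes "pres_eq R u u'" "pres_eq R v v'" shows "pres_eq R (u @ v) (u' @ v')"
  using pres_eq.cong[OF assms(1), of "[]" v] pres_eq.cong[OF assms(2), of u' "[]"]
  by (auto intro: pres_eq.trans)

lemma pres_eq_Cons: "pres_eq R u v \<Longrightarrow> pres_eq R (l # u) (l # v)"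
  using pres_eq.cong[of R u v "[l]" "[]"] by simp

lemma presented_mult:
  "pres_class R u \<otimes>\<^bsub>presented_group R\<^esub> pres_class R v = pres_class R (u @ v)"
proof -
  have *: "pres_class R (u' @ v') = pres_class R (u @ v)" if "u' \<in> pres_class R u" "v' \<in> pres_class R v" for u' v'
    unfolding pres_class_eq_iff by (rule pres_eq.sym, rule pres_eq_append) (use that in \<open>simp_all add: pres_class_def\<close>)
  have "u \<in> pres_class R u" "v \<in> pres_class R v"
    by (simp_all add: pres_class_def pres_eq.refl)
  then have "(\<Union>u'\<in>pres_class R u. \<Union>v'\<in>pres_class R v. pres_class R (u' @ v')) = pres_class R (u @ v)"
    using * by (intro equalityI subsetI) blast+
  then show ?thesis
    by (simp add: presented_group_def)
qed

context group
begin

lemma ev_closed [simp]: "(\<And>x. f x \<in> carrier G) \<Longrightarrow> ev G f w \<in> carrier G"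
  by (induction w) (auto simp: ev_def)

lemma ev_append: "(\<And>x. f x \<in> carrier G) \<Longrightarrow> ev G f (u @ v) = ev G f u \<otimes> ev G f v"
proof (induction u)
  case (Cons l u)
  have "ev G f (u @ v) = ev G f u \<otimes> ev G f v" "ev G f u \<in> carrier G" "ev G f v \<in> carrier G"
    using Cons ev_closed by blast+
  then show ?case using Cons.prems by (simp add: ev_def m_assoc)
next
  case Nil
  have "ev G f v \<in> carrier G" using Nil ev_closed by blast
  then show ?case by (simp add: ev_def)
qed

text \<open>The von Dyck property: the assignment descends to the presented group.\<close>

lemma pres_eq_ev:
  assumes "pres_eq R u v" and f: "\<And>x. f x \<in> carrier G"
    and R: "\<And>u v. (u, v) \<in> R \<Longrightarrow> ev G f u = ev G f v"
  shows "ev G f u = ev G f v"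
  using assms(1)
proof induction
  case (cancel x e)
  then show ?case using f[of x] by (simp add: ev_def)
next
  case (cong u v p q)
  then show ?case by (simp add: ev_append f)
qed (simp_all add: R)

text \<open>\<open>nf\<close> chooses a word for each element of the group. By \<open>step\<close>
  and induction every word is equivalent to the chosen word of its value, which bounds the presented
  group from above, while \<open>ev\<close> separates the chosen words.\<close>

lemma presented_iso:
  assumes f: "\<And>x. f x \<in> carrier G"
    and R: "\<And>u v. (u, v) \<in> R \<Longrightarrow> ev G f u = ev G f v"
    and nf: "\<And>y. y \<in> carrier G \<Longrightarrow> ev G f (nf y) = y"
    and nf1: "nf \<one> = []"
    and step: "\<And>x y. y \<in> carrier G \<Longrightarrow> pres_eq R ((x, False) # nf y) (nf (f x \<otimes> y))"
  shows "presented_group R \<cong> G" "group (presented_group R)"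
proof -
  have red: "pres_eq R w (nf (ev G f w))" for w
  proof (induction w)
    case Nil
    then show ?case by (simp add: ev_def nf1 pres_eq.refl)
  next
    case (Cons l w)
    obtain x b where l: "l = (x, b)" by (cases l)
    let ?y = "ev G f w"
    have y: "?y \<in> carrier G" using f by (rule ev_closed)
    have 1: "pres_eq R (l # w) (l # nf ?y)" by (rule pres_eq_Cons[OF Cons.IH])
    have "pres_eq R (l # nf ?y) (nf (ev G f (l # w)))"
    proof (cases b)
      case False
      then show ?thesis using step[OF y, of x] by (simp add: l ev_def)
    next
      case True
      \<comment> \<open>An inverse letter is treated by applying \<open>step\<close> to this element
        and reading the result backwards after cancellation.\<close>
      let ?z = "inv (f x) \<otimes> ?y"
      have z: "?z \<in> carrier G" using y f[of x] by simp
      have "f x \<otimes> ?z = ?y" using y f[of x] by (simp add: m_assoc[symmetric])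
      then have "pres_eq R ((x, False) # nf ?z) (nf ?y)" using step[OF z, of x] by simp
      then have "pres_eq R ((x, True) # (x, False) # nf ?z) ((x, True) # nf ?y)" by (rule pres_eq_Cons)
      moreover have "pres_eq R ((x, True) # (x, False) # nf ?z) (nf ?z)"
        using pres_eq.cong[OF pres_eq.cancel[of R x True], of "[]" "nf ?z"] by simp
      ultimately have "pres_eq R ((x, True) # nf ?y) (nf ?z)" by (blast intro: pres_eq.trans pres_eq.sym)
      then show ?thesis using True by (simp add: l ev_def)
    qed
    with 1 show ?case by (rule pres_eq.trans)
  qed
  let ?h = "\<lambda>y. pres_class R (nf y)"
  have "?h \<in> iso G (presented_group R)"
  proof (rule isoI)
    show "?h \<in> hom G (presented_group R)"
    proof (rule homI)
      fix y z assume yz: "y \<in> carrier G" "z \<in> carrier G"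
      have "ev G f (nf y @ nf z) = y \<otimes> z" using yz by (simp add: ev_append f nf)
      then show "?h (y \<otimes> z) = ?h y \<otimes>\<^bsub>presented_group R\<^esub> ?h z"
        unfolding presented_mult pres_class_eq_iff using red[of "nf y @ nf z"] by (simp add: pres_eq.sym)
    qed (simp add: presented_group_def)
    show "bij_betw ?h (carrier G) (carrier (presented_group R))"
    proof (rule bij_betwI')
      fix y z assume yz: "y \<in> carrier G" "z \<in> carrier G"
      have "ev G f (nf y) = ev G f (nf z)" if "?h y = ?h z"
        using that unfolding pres_class_eq_iff by (rule pres_eq_ev[OF _ f R])
      then show "?h y = ?h z \<longleftrightarrow> y = z"
        using nf yz by auto
    next
      fix A assume "A \<in> carrier (presented_group R)"
      then obtain w where "A = pres_class R w" by (auto simp: presented_group_def)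
      moreover have "ev G f w \<in> carrier G" using f by (rule ev_closed)
      ultimately show "\<exists>y\<in>carrier G. A = ?h y" using red[of w] by (auto simp: pres_class_eq_iff)
    qed (simp add: presented_group_def)
  qed
  moreover from iso_imp_img_group[OF this] have "group (presented_group R)"
    by (simp add: nf1 presented_group_def)
  ultimately show "presented_group R \<cong> G" "group (presented_group R)"
    using iso_sym by (auto simp: is_iso_def)
qed

end

definition bool_group :: "bool monoid" where
  "bool_group = \<lparr>carrier = UNIV, monoid.mult = (\<noteq>), one = False\<rparr>"

lemma comm_group_bool_group: "comm_group bool_group"
  by (rule comm_groupI) (auto simp: bool_group_def)

text \<open>The pair \<open>(i, j)\<close> stands for \<open>b\<^sup>j a\<^sup>i\<close>, and \<open>e\<close> tells whether \<open>b\<^sup>2 = a ^ (2 ^ m)\<close> or \<open>b\<^sup>2 = 1\<close>.\<close>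

definition metacyclic :: "nat \<Rightarrow> bool \<Rightarrow> (int \<times> bool) monoid" where
  "metacyclic m e = cocycle_ext m bool_group (\<lambda>j. j) (\<lambda>j j'. e \<and> j \<and> j')"

lemma twist_metacyclic: "m \<ge> 1 \<Longrightarrow> twist bool_group m (\<lambda>j. j) (\<lambda>j j'. e \<and> j \<and> j')"
  unfolding twist_def twist_axioms_def using comm_group_bool_group by (auto simp: bool_group_def)

lemma group_metacyclic: "m \<ge> 1 \<Longrightarrow> group (metacyclic m e)"
  unfolding metacyclic_def by (rule twist.W_group[OF twist_metacyclic])

lemma carrier_metacyclic: "carrier (metacyclic m e) = {0..<2 ^ (m + 1)} \<times> UNIV"
  and one_metacyclic: "\<one>\<^bsub>metacyclic m e\<^esub> = (0, False)"
  and mult_metacyclic: "(i, j) \<otimes>\<^bsub>metacyclic m e\<^esub> (i', j') =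
    ((i + i' + 2 ^ m * of_bool ((odd i \<and> j') \<noteq> (e \<and> j \<and> j'))) mod 2 ^ (m + 1), j \<noteq> j')"
  by (simp_all add: metacyclic_def cocycle_ext_def bool_group_def cw_def)

definition gens :: "gen2 \<Rightarrow> int \<times> bool" where
  "gens x = (case x of GenA \<Rightarrow> (1, False) | GenB \<Rightarrow> (0, True))"

lemma ev_apow_metacyclic: "ev (metacyclic m e) gens (apow k) = (int k mod 2 ^ (m + 1), False)"
proof (induction k)
  case (Suc k)
  have "ev (metacyclic m e) gens (apow (Suc k)) = (1, False) \<otimes>\<^bsub>metacyclic m e\<^esub> ev (metacyclic m e) gens (apow k)"
    by (simp add: ev_def apow_def gens_def)
  then show ?case unfolding Suc by (simp add: mult_metacyclic mod_simps)
qed (simp add: ev_def apow_def one_metacyclic)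

text \<open>The relations only have to follow from \<open>R\<close>, so that the presentations of
  M_2(m+1,1), D_8 and Q_8 are covered at once. Normal forms are b^j a^i; a letter a moves past b by
  a b = b a^(1 + 2^m).\<close>

lemma metacyclic_presented:
  assumes m: "m \<ge> 1"
    and a: "pres_eq R (apow (2 ^ (m + 1))) []"
    and b: "pres_eq R (bpow 2) (apow (if e then 2 ^ m else 0))"
    and ab: "pres_eq R a_conj_b (apow (1 + 2 ^ m))"
    and R: "\<And>u v. (u, v) \<in> R \<Longrightarrow> ev (metacyclic m e) gens u = ev (metacyclic m e) gens v"
  shows "presented_group R \<cong> metacyclic m e" "group (presented_group R)"
proof -
  interpret group "metacyclic m e" by (rule group_metacyclic[OF m])
  let ?q = "2 ^ (m + 1) :: nat"
  define nf where "nf = (\<lambda>(i, j). (if j then bpow 1 else []) @ apow (nat i))"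
  have g: "gens x \<in> carrier (metacyclic m e)" for x
  proof -
    have "(1::int) < 2 ^ (m + 1)" by (rule one_less_power) auto
    then show ?thesis by (cases x) (simp_all add: gens_def carrier_metacyclic)
  qed
  have apow_add: "apow (k + l) = apow k @ apow l" for k l by (simp add: apow_def replicate_add)
  have apow_mult: "pres_eq R (apow (?q * k)) []" for k
  proof (induction k)
    case (Suc k)
    have "apow (?q * Suc k) = apow ?q @ apow (?q * k)" by (simp only: mult_Suc_right apow_add)
    then show ?case using pres_eq_append[OF a Suc] by simp
  qed (simp add: apow_def pres_eq.refl)
  have apow_mod: "pres_eq R (apow k) (apow (k mod ?q))" for k
  proof -
    have "apow k = apow (?q * (k div ?q)) @ apow (k mod ?q)"
      by (simp only: apow_add[symmetric] mult_div_mod_eq)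
    then show ?thesis using pres_eq_append[OF apow_mult pres_eq.refl] by fastforce
  qed
  have AB: "pres_eq R [(GenA, False), (GenB, False)] ((GenB, False) # apow (1 + 2 ^ m))"
  proof -
    have "pres_eq R ((GenB, False) # a_conj_b) ((GenB, False) # apow (1 + 2 ^ m))"
      by (rule pres_eq_Cons[OF ab])
    moreover have "pres_eq R ((GenB, False) # a_conj_b) [(GenA, False), (GenB, False)]"
      using pres_eq.cong[OF pres_eq.cancel[of R GenB False], of "[]" "[(GenA, False), (GenB, False)]"]
      by (simp add: a_conj_b_def)
    ultimately show ?thesis by (blast intro: pres_eq.trans pres_eq.sym)
  qed
  have nat_mod: "nat ((int k) mod 2 ^ (m + 1)) = k mod ?q" for k
    by (metis nat_int of_nat_numeral of_nat_power zmod_int)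
  have main: "ev (metacyclic m e) gens (nf y) = y \<and> (\<forall>x. pres_eq R ((x, False) # nf y) (nf (gens x \<otimes>\<^bsub>metacyclic m e\<^esub> y)))"
    if y: "y \<in> carrier (metacyclic m e)" for y
  proof (intro conjI allI)
    obtain i j where ij: "y = (i, j)" "0 \<le> i" "i < 2 ^ (m + 1)"
      using y unfolding carrier_metacyclic by auto
    then obtain k where k: "i = int k" "k < ?q"
      by (metis nat_less_numeral_power_cancel_iff zero_le_imp_eq_int nat_int)
    then have im: "i mod 2 ^ (m + 1) = i" using ij by (simp add: mod_pos_pos_trivial)
    show "ev (metacyclic m e) gens (nf y) = y"
    proof (cases j)
      case True
      have "ev (metacyclic m e) gens (nf y) = (0, True) \<otimes>\<^bsub>metacyclic m e\<^esub> ev (metacyclic m e) gens (apow k)"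
        using True by (simp add: nf_def ij k bpow_def ev_def gens_def)
      then show ?thesis unfolding ev_apow_metacyclic using im True by (simp add: mult_metacyclic ij k)
    next
      case False
      then show ?thesis using im by (simp add: nf_def ij k ev_apow_metacyclic)
    qed
    fix x
    show "pres_eq R ((x, False) # nf y) (nf (gens x \<otimes>\<^bsub>metacyclic m e\<^esub> y))"
    proof (cases x; cases j)
      assume x: "x = GenA" and j: "\<not> j"
      have "gens x \<otimes>\<^bsub>metacyclic m e\<^esub> y = (int (Suc k) mod 2 ^ (m + 1), False)"
        using x j by (simp add: gens_def ij k mult_metacyclic)
      then have "nf (gens x \<otimes>\<^bsub>metacyclic m e\<^esub> y) = apow (Suc k mod ?q)"
        by (simp only: nf_def nat_mod prod.case if_False append_Nil)
      moreover have "(x, False) # nf y = apow (Suc k)"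
        using x j by (simp add: nf_def ij k apow_def)
      ultimately show ?thesis using apow_mod[of "Suc k"] by simp
    next
      assume x: "x = GenA" and j: "j"
      have "gens x \<otimes>\<^bsub>metacyclic m e\<^esub> y = (int (1 + 2 ^ m + k) mod 2 ^ (m + 1), True)"
        using x j by (simp add: gens_def ij k mult_metacyclic ac_simps)
      then have n: "nf (gens x \<otimes>\<^bsub>metacyclic m e\<^esub> y) = bpow 1 @ apow ((1 + 2 ^ m + k) mod ?q)"
        by (simp only: nf_def nat_mod prod.case if_True)
      have "(x, False) # nf y = [(GenA, False), (GenB, False)] @ apow k"
        using x j by (simp add: nf_def ij k bpow_def)
      moreover have "pres_eq R ([(GenA, False), (GenB, False)] @ apow k) (((GenB, False) # apow (1 + 2 ^ m)) @ apow k)"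
        by (rule pres_eq_append[OF AB pres_eq.refl])
      moreover have "((GenB, False) # apow (1 + 2 ^ m)) @ apow k = bpow 1 @ apow (1 + 2 ^ m + k)"
        by (simp only: apow_add) (simp add: bpow_def)
      moreover have "pres_eq R (bpow 1 @ apow (1 + 2 ^ m + k)) (bpow 1 @ apow ((1 + 2 ^ m + k) mod ?q))"
        by (rule pres_eq_append[OF pres_eq.refl apow_mod])
      ultimately show ?thesis unfolding n by (metis pres_eq.trans)
    next
      assume x: "x = GenB" and j: "\<not> j"
      have "gens x \<otimes>\<^bsub>metacyclic m e\<^esub> y = (i, True)"
        using x j im by (simp add: gens_def ij mult_metacyclic)
      then show ?thesis using x j by (simp add: nf_def ij bpow_def pres_eq.refl)
    next
      assume x: "x = GenB" and j: "j"
      let ?l = "if e then 2 ^ m else 0 :: nat"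
      have "gens x \<otimes>\<^bsub>metacyclic m e\<^esub> y = (int (?l + k) mod 2 ^ (m + 1), False)"
        using x j by (simp add: gens_def ij k mult_metacyclic add.commute)
      then have n: "nf (gens x \<otimes>\<^bsub>metacyclic m e\<^esub> y) = apow ((?l + k) mod ?q)"
        by (simp only: nf_def nat_mod prod.case if_False append_Nil)
      have "(x, False) # nf y = bpow 2 @ apow k"
        using x j by (simp add: nf_def ij k bpow_def numeral_2_eq_2)
      moreover have "pres_eq R (bpow 2 @ apow k) (apow ?l @ apow k)"
        by (rule pres_eq_append[OF b pres_eq.refl])
      ultimately show ?thesis unfolding n using apow_mod[of "?l + k"] by (metis apow_add pres_eq.trans)
    qed
  qed
  have nf1: "nf \<one>\<^bsub>metacyclic m e\<^esub> = []" by (simp add: nf_def one_metacyclic apow_def)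
  show "presented_group R \<cong> metacyclic m e"
    by (rule presented_iso(1)[of gens R nf, OF g R _ nf1]) (use main in blast)+
  show "group (presented_group R)"
    by (rule presented_iso(2)[of gens R nf, OF g R _ nf1]) (use main in blast)+
qed

lemma inv_metacyclic_gens:
  assumes "m \<ge> 1"
  shows "inv\<^bsub>metacyclic m e\<^esub> (1, False) = (2 ^ (m + 1) - 1, False)"
    "inv\<^bsub>metacyclic m e\<^esub> (0, True) = (if e then 2 ^ m else 0, True)"
proof -
  interpret group "metacyclic m e" by (rule group_metacyclic[OF assms])
  have "even (2 ^ m :: int)" using assms by simp
  then show "inv\<^bsub>metacyclic m e\<^esub> (0, True) = (if e then 2 ^ m else 0, True)"
    by (intro inv_equality) (simp_all add: mult_metacyclic one_metacyclic carrier_metacyclic)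
  have "(1::int) < 2 ^ (m + 1)" by (rule one_less_power) auto
  then show "inv\<^bsub>metacyclic m e\<^esub> (1, False) = (2 ^ (m + 1) - 1, False)"
    by (intro inv_equality) (simp_all add: mult_metacyclic one_metacyclic carrier_metacyclic)
qed

lemma ev_metacyclic_relations:
  assumes "m \<ge> 1"
  shows "ev (metacyclic m e) gens (apow (2 ^ (m + 1))) = ev (metacyclic m e) gens []"
    "ev (metacyclic m e) gens (bpow 2) = ev (metacyclic m e) gens (apow (if e then 2 ^ m else 0))"
    "ev (metacyclic m e) gens a_conj_b = ev (metacyclic m e) gens (apow (1 + 2 ^ m))"
    "ev (metacyclic m e) gens [] = (0, False)"
proof -
  have 0: "ev (metacyclic m e) gens [] = (0, False)" by (simp add: ev_def one_metacyclic)
  then show "ev (metacyclic m e) gens [] = (0, False)" .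
  show "ev (metacyclic m e) gens (apow (2 ^ (m + 1))) = ev (metacyclic m e) gens []"
    unfolding ev_apow_metacyclic 0 by simp
  show "ev (metacyclic m e) gens (bpow 2) = ev (metacyclic m e) gens (apow (if e then 2 ^ m else 0))"
    unfolding ev_apow_metacyclic by (simp add: ev_def bpow_def numeral_2_eq_2 gens_def one_metacyclic mult_metacyclic)
  have "ev (metacyclic m e) gens a_conj_b = (if e then 2 ^ m else 0, True) \<otimes>\<^bsub>metacyclic m e\<^esub>
    ((1 + 2 ^ m) mod 2 ^ (m + 1), True)"
    by (simp add: ev_def a_conj_b_def gens_def inv_metacyclic_gens[OF assms] one_metacyclic mult_metacyclic)
  also have "\<dots> = ((1 + 2 ^ m) mod 2 ^ (m + 1), False)"
  proof -
    have *: "even (2 ^ m :: int)" using assms by simp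
    have "(2 ^ m + (1 + 2 ^ m) mod 2 ^ (m + 1) + 2 ^ m) mod 2 ^ (m + 1) = (2 ^ m + 2 ^ m + (1 + 2 ^ m) mod 2 ^ (m + 1)) mod (2 ^ (m + 1) :: int)"
      by (simp only: ac_simps)
    also have "\<dots> = (1 + 2 ^ m) mod 2 ^ (m + 1)"
    proof -
      have "(2 ^ m + 2 ^ m :: int) = 2 ^ (m + 1)" by simp
      then show ?thesis unfolding mod_add_right_eq by (simp only: mod_add_self1)
    qed
    finally have F: "(2 ^ m + (1 + 2 ^ m) mod 2 ^ (m + 1) + 2 ^ m) mod 2 ^ (m + 1) = ((1 + 2 ^ m) mod 2 ^ (m + 1) :: int)" .
    show ?thesis
    proof (cases e)
      case True
      have "((odd (2 ^ m :: int) \<and> True) \<noteq> (e \<and> True \<and> True)) = True" using * True by simp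
      then show ?thesis by (simp only: True mult_metacyclic if_True of_bool_eq mult_1_right F) simp
    next
      case False
      then show ?thesis by (simp add: mult_metacyclic)
    qed
  qed
  finally show "ev (metacyclic m e) gens a_conj_b = ev (metacyclic m e) gens (apow (1 + 2 ^ m))"
    unfolding ev_apow_metacyclic by simp
qed

lemma M2_metacyclic:
  assumes "m \<ge> 1" shows "M2 (m + 1) 1 \<cong> metacyclic m False" "group (M2 (m + 1) 1)"
proof -
  let ?R = "{(apow (2 ^ (m + 1)), []), (bpow (2 ^ 1), []), (a_conj_b, apow (1 + 2 ^ (m + 1 - 1)))}"
  have 0: "apow 0 = []" by (simp add: apow_def)
  have "pres_eq ?R (apow (2 ^ (m + 1))) []" "pres_eq ?R (bpow 2) (apow (if False then 2 ^ m else 0))"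
    "pres_eq ?R a_conj_b (apow (1 + 2 ^ m))"
    by (rule pres_eq.rel; simp add: 0)+
  moreover have "ev (metacyclic m False) gens x = ev (metacyclic m False) gens y" if "(x, y) \<in> ?R" for x y
    using that ev_metacyclic_relations[OF assms, of False] by (auto simp: 0)
  ultimately show "M2 (m + 1) 1 \<cong> metacyclic m False" "group (M2 (m + 1) 1)"
    unfolding M2_def using metacyclic_presented[OF assms, of ?R False] by blast+
qed

text \<open>Matches the relation of D_8 and Q_8, which has the inverse of a, with the exponent 1 +
  2^m = 3 for m = 1.\<close>

lemma apow_cancel:
  assumes "pres_eq R (apow 4) []" shows "pres_eq R [(GenA, True)] (apow 3)"
proof -
  have "pres_eq R ([(GenA, True)] @ apow 4) ([(GenA, True)] @ [])"
    by (rule pres_eq_append[OF pres_eq.refl assms])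
  moreover have "pres_eq R ([(GenA, True)] @ apow 4) (apow 3)"
    using pres_eq.cong[OF pres_eq.cancel[of R GenA True], of "[]" "apow 3"]
    by (simp add: apow_def numeral_3_eq_3 eval_nat_numeral)
  ultimately show ?thesis by (simp) (blast intro: pres_eq.trans pres_eq.sym)
qed

lemma D8_Q8_metacyclic:
  assumes R: "R = {(apow 4, []), (bpow 2, apow (if e then 2 else 0)), (a_conj_b, [(GenA, True)])}"
  shows "presented_group R \<cong> metacyclic 1 e" "group (presented_group R)"
proof -
  have 4: "pres_eq R (apow 4) []" "pres_eq R (bpow 2) (apow (if e then 2 else 0))"
    by (rule pres_eq.rel; simp add: R)+
  have "pres_eq R a_conj_b [(GenA, True)]" by (rule pres_eq.rel) (simp add: R)
  note 5 = pres_eq.trans[OF this apow_cancel[OF 4(1)]]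
  have eqs: "(2::nat) ^ (1 + 1) = 4" "(2::nat) ^ 1 = 2" "1 + (2::nat) = 3" by simp_all
  have rel: "pres_eq R (apow (2 ^ (1 + 1))) []" "pres_eq R (bpow 2) (apow (if e then 2 ^ 1 else 0))"
    "pres_eq R a_conj_b (apow (1 + 2 ^ 1))"
    unfolding eqs by (fact 4 5)+
  have A: "ev (metacyclic 1 e) gens [(GenA, True)] = (3, False)"
    using inv_metacyclic_gens[of 1 e] by (simp add: ev_def gens_def one_metacyclic mult_metacyclic)
  have "ev (metacyclic 1 e) gens x = ev (metacyclic 1 e) gens y" if "(x, y) \<in> R" for x y
  proof -
    have E: "ev (metacyclic 1 e) gens (apow 4) = ev (metacyclic 1 e) gens []"
      "ev (metacyclic 1 e) gens (bpow 2) = ev (metacyclic 1 e) gens (apow (if e then 2 else 0))"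
      "ev (metacyclic 1 e) gens a_conj_b = ev (metacyclic 1 e) gens (apow 3)"
      using ev_metacyclic_relations[of 1 e] unfolding eqs by blast+
    have "ev (metacyclic 1 e) gens (apow 3) = (3, False)" unfolding ev_apow_metacyclic by simp
    then show ?thesis using that E A unfolding R by (elim insertE emptyE) (simp_all only: prod.inject)
  qed
  then show "presented_group R \<cong> metacyclic 1 e" "group (presented_group R)"
    using metacyclic_presented[of 1 R e] rel by blast+
qed

lemma D8_metacyclic: "D8 \<cong> metacyclic 1 False" "group D8"
  using D8_Q8_metacyclic[of _ False] unfolding D8_def by (simp_all add: apow_def)

lemma Q8_metacyclic: "Q8 \<cong> metacyclic 1 True" "group Q8"
  using D8_Q8_metacyclic[of _ True] unfolding Q8_def by simp_all

section \<open>Central products as concrete groups\<close>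

text \<open>A pair \<open>(J, X)\<close> records the factors in which the exponent of \<open>b\<close>, respectively of \<open>a\<close>, is odd. The
  first factor, number 0, is absent from \<open>X\<close> because its exponents of \<open>a\<close> form the cyclic part of the extension.\<close>

definition plane_grp :: "nat \<Rightarrow> (nat set \<times> nat set) monoid" where
  "plane_grp k = \<lparr>carrier = Pow {..<k} \<times> Pow {1..<k},
     monoid.mult = (\<lambda>v w. (sym_diff (fst v) (fst w), sym_diff (snd v) (snd w))), one = ({}, {})\<rparr>"

text \<open>The exponent of c produced by (b^j a^x)(b^j' a^x') in a factor of order 8: the carry a^2
  = c if x = x' = 1, the exchange of a^x with b^j', and b^2 = c in the quaternion case.\<close>

definition plane_bit :: "bool \<Rightarrow> bool \<Rightarrow> bool \<Rightarrow> bool \<Rightarrow> bool \<Rightarrow> bool" where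
  "plane_bit e x j x' j' \<longleftrightarrow> ((x \<and> x') \<noteq> (x \<and> j')) \<noteq> (e \<and> j \<and> j')"

text \<open>A sum modulo 2 over the factors, written as a parity. Factor 0 is left out since
  \<open>cw\<close> treats it through the cyclic coordinate.\<close>

definition plane_form :: "(nat \<Rightarrow> bool) \<Rightarrow> nat \<Rightarrow> nat set \<times> nat set \<Rightarrow> nat set \<times> nat set \<Rightarrow> bool" where
  "plane_form e k v w \<longleftrightarrow> odd (card {t \<in> {1..<k}. plane_bit (e t) (t \<in> snd v) (t \<in> fst v) (t \<in> snd w) (t \<in> fst w)})"

text \<open>Modulo 2 the cardinality of a symmetric difference is the sum of the cardinalities; this
  makes \<open>plane_form\<close> bilinear.\<close>

lemma odd_card_xor:
  assumes "finite S"
  shows "odd (card {t \<in> S. P t \<noteq> Q t}) \<longleftrightarrow> odd (card {t \<in> S. P t}) \<noteq> odd (card {t \<in> S. Q t})"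
  using assms
proof (induction S)
  case (insert s S)
  have *: "{t \<in> insert s S. R t} = (if R s then insert s {t \<in> S. R t} else {t \<in> S. R t})" for R by auto
  have "card {t \<in> insert s S. R t} = (if R s then Suc (card {t \<in> S. R t}) else card {t \<in> S. R t})" for R
    using insert.hyps unfolding * by simp
  then show ?case using insert.IH by (cases "P s"; cases "Q s") simp_all
qed simp

lemma mem_sym_diff: "t \<in> sym_diff A B \<longleftrightarrow> (t \<in> A) \<noteq> (t \<in> B)"
  by blast

lemma plane_grp_comm_group: "comm_group (plane_grp k)"
proof (rule comm_groupI)
  fix v assume "v \<in> carrier (plane_grp k)"
  then show "\<exists>w\<in>carrier (plane_grp k). w \<otimes>\<^bsub>plane_grp k\<^esub> v = \<one>\<^bsub>plane_grp k\<^esub>"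
    by (intro bexI[of _ v]) (auto simp: plane_grp_def)
qed (auto simp: plane_grp_def)

lemma twist_plane_grp: "m \<ge> 1 \<Longrightarrow> twist (plane_grp k) m (\<lambda>v. 0 \<in> fst v) (plane_form e k)"
proof -
  assume m: "m \<ge> 1"
  have S: "finite {1..<k}" by simp
  have "twist_axioms (plane_grp k) m (\<lambda>v. 0 \<in> fst v) (plane_form e k)"
  proof
    fix v w x
    have 1: "plane_bit b (t \<in> sym_diff A C) (t \<in> sym_diff D E) y j \<longleftrightarrow>
      (plane_bit b (t \<in> A) (t \<in> D) y j \<noteq> plane_bit b (t \<in> C) (t \<in> E) y j)" for b t A C D E y j
      unfolding mem_sym_diff plane_bit_def
      by (cases "t \<in> A"; cases "t \<in> C"; cases "t \<in> D"; cases "t \<in> E"; cases b; cases y; cases j; simp)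
    have 2: "plane_bit b y j (t \<in> sym_diff A C) (t \<in> sym_diff D E) \<longleftrightarrow>
      (plane_bit b y j (t \<in> A) (t \<in> D) \<noteq> plane_bit b y j (t \<in> C) (t \<in> E))" for b t A C D E y j
      unfolding mem_sym_diff plane_bit_def
      by (cases "t \<in> A"; cases "t \<in> C"; cases "t \<in> D"; cases "t \<in> E"; cases b; cases y; cases j; simp)
    show "plane_form e k (v \<otimes>\<^bsub>plane_grp k\<^esub> w) x = (plane_form e k v x \<noteq> plane_form e k w x)"
      unfolding plane_form_def odd_card_xor[OF S, symmetric] by (simp only: plane_grp_def monoid.simps fst_conv snd_conv 1)
    show "plane_form e k x (v \<otimes>\<^bsub>plane_grp k\<^esub> w) = (plane_form e k x v \<noteq> plane_form e k x w)"
      unfolding plane_form_def odd_card_xor[OF S, symmetric] by (simp only: plane_grp_def monoid.simps fst_conv snd_conv 2)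
    show "m \<ge> 1" by (rule m)
    show "finite (carrier (plane_grp k))" by (simp add: plane_grp_def)
    show "v \<otimes>\<^bsub>plane_grp k\<^esub> v = \<one>\<^bsub>plane_grp k\<^esub>" by (simp add: plane_grp_def)
    show "(0 \<in> fst (v \<otimes>\<^bsub>plane_grp k\<^esub> w)) = ((0 \<in> fst v) \<noteq> (0 \<in> fst w))"
      by (simp only: plane_grp_def monoid.simps fst_conv mem_sym_diff)
  qed
  then show ?thesis using plane_grp_comm_group by (simp add: twist_def)
qed

lemma card_plane_grp: "card (carrier (plane_grp k)) = 2 ^ k * 2 ^ (k - 1)"
  by (simp add: plane_grp_def card_cartesian_product card_Pow)

lemma MC1_cases: "p \<in> carrier (metacyclic 1 e) \<Longrightarrow> fst p \<in> {0, 1, 2, 3}"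
  by (auto simp: carrier_metacyclic)

text \<open>An exponent of a below 4 is x + 2s with x its parity and s the exponent of c = a^2, read
  off as \<open>2 \<le> fst p\<close>. Multiplication adds the s up to the defect
  \<open>plane_bit\<close>, which is a finite check.\<close>

lemma MC1_mult:
  assumes "p \<in> carrier (metacyclic 1 e)" "q \<in> carrier (metacyclic 1 e)"
  shows "2 \<le> fst (p \<otimes>\<^bsub>metacyclic 1 e\<^esub> q) \<longleftrightarrow> ((2 \<le> fst p) \<noteq> (2 \<le> fst q)) \<noteq> plane_bit e (odd (fst p)) (snd p) (odd (fst q)) (snd q)"
    "odd (fst (p \<otimes>\<^bsub>metacyclic 1 e\<^esub> q)) \<longleftrightarrow> odd (fst p) \<noteq> odd (fst q)"
    "snd (p \<otimes>\<^bsub>metacyclic 1 e\<^esub> q) \<longleftrightarrow> snd p \<noteq> snd q"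
proof -
  obtain i j i' j' where pq: "p = (i, j)" "q = (i', j')" by fastforce
  have i: "i \<in> {0, 1, 2, 3}" "i' \<in> {0, 1, 2, 3}"
    using MC1_cases[OF assms(1)] MC1_cases[OF assms(2)] unfolding pq fst_conv by blast+
  have "\<forall>i\<in>{0, 1, 2, 3}. \<forall>i'\<in>{0, 1, 2, 3}.
    (2 \<le> (i + i' + 2 * of_bool ((odd i \<and> j') \<noteq> (e \<and> j \<and> j'))) mod (4::int)) =
    (((2 \<le> i) \<noteq> (2 \<le> i')) \<noteq> plane_bit e (odd i) j (odd i') j')"
    unfolding plane_bit_def by (cases e; cases j; cases j') simp_all
  note this[rule_format, OF i]
  moreover have pw: "(2::int) ^ 1 = 2" "(2::int) ^ (1 + 1) = 4" by simp_all
  ultimately show "2 \<le> fst (p \<otimes>\<^bsub>metacyclic 1 e\<^esub> q) \<longleftrightarrow> ((2 \<le> fst p) \<noteq> (2 \<le> fst q)) \<noteq> plane_bit e (odd (fst p)) (snd p) (odd (fst q)) (snd q)"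
    unfolding pq mult_metacyclic fst_conv snd_conv pw by (simp only:)
  have "odd ((i + i' + 2 * of_bool b) mod (4::int)) \<longleftrightarrow> odd i \<noteq> odd i'" for b
    by (simp add: dvd_mod_iff)
  then show "odd (fst (p \<otimes>\<^bsub>metacyclic 1 e\<^esub> q)) \<longleftrightarrow> odd (fst p) \<noteq> odd (fst q)"
    unfolding pq mult_metacyclic by simp
  show "snd (p \<otimes>\<^bsub>metacyclic 1 e\<^esub> q) \<longleftrightarrow> snd p \<noteq> snd q"
    unfolding pq mult_metacyclic by simp
qed

lemma derived_metacyclic: "m \<ge> 1 \<Longrightarrow> derived (metacyclic m e) (carrier (metacyclic m e)) = {(0, False), (2 ^ m, False)}"
proof -
  assume m: "m \<ge> 1"
  interpret twist bool_group m "\<lambda>j. j" "\<lambda>j j'. e \<and> j \<and> j'" by (rule twist_metacyclic[OF m])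
  have "(1::int) < 2 ^ (m + 1)" by (rule one_less_power) auto
  then have c: "(1, False) \<in> carrier (metacyclic m e)" "(0, True) \<in> carrier (metacyclic m e)" by (simp_all add: carrier_metacyclic)
  have "derived (metacyclic m e) (carrier (metacyclic m e)) = {\<one>\<^bsub>metacyclic m e\<^esub>, cW}"
    unfolding metacyclic_def by (rule derived_W[OF c[unfolded metacyclic_def]]) (simp add: W_commute_iff[OF c[unfolded metacyclic_def]] cw_def)
  moreover have "cW = (2 ^ m, False)" unfolding cW_def by (simp add: bool_group_def)
  ultimately show ?thesis by (simp only: one_metacyclic)
qed

lemma if_card: "card A = n \<Longrightarrow> card (if b then A else C) = (if b then n else card C)"
  by simp

section \<open>Central products as quotients of direct products\<close>

locale cprod =
  fixes Gs :: "('a, 'm) monoid_scheme list" and m k :: nat and e :: "nat \<Rightarrow> bool" and h :: "nat \<Rightarrow> 'a \<Rightarrow> int \<times> bool"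
  assumes len: "length Gs = k" and k: "k \<ge> 1" and m: "m \<ge> 1" and e0: "\<not> e 0"
    and grp: "\<And>t. t < k \<Longrightarrow> group (Gs ! t)"
    and iso: "\<And>t. t < k \<Longrightarrow> h t \<in> iso (Gs ! t) (metacyclic (if t = 0 then m else 1) (e t))"
begin

abbreviation "\<mu> t \<equiv> if t = 0 then m else 1"
abbreviation "M t \<equiv> metacyclic (\<mu> t) (e t)"
abbreviation "P \<equiv> product_group {..<k} ((!) Gs)"
abbreviation "W \<equiv> cocycle_ext m (plane_grp k) (\<lambda>v. 0 \<in> fst v) (plane_form e k)"

text \<open>Each factor t >= 1 carries a power of its own c, present if the exponent of a is at
  least 2. All these powers are transferred to the first factor as multiples of 2^m.\<close>

definition \<Psi> :: "(nat \<Rightarrow> 'a) \<Rightarrow> int \<times> nat set \<times> nat set" where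
  "\<Psi> f = ((fst (h 0 (f 0)) + 2 ^ m * of_bool (odd (card {t \<in> {1..<k}. 2 \<le> fst (h t (f t))}))) mod 2 ^ (m + 1),
     {t \<in> {..<k}. snd (h t (f t))}, {t \<in> {1..<k}. odd (fst (h t (f t)))})"

lemma mu: "\<mu> t \<ge> 1"
  using m by simp

lemma h_group_hom: "t < k \<Longrightarrow> group_hom (Gs ! t) (M t) (h t)"
  using grp iso[of t] group_metacyclic[OF mu[of t], of "e t"] by (simp add: group_hom_def group_hom_axioms_def iso_def)

lemma h_closed: "t < k \<Longrightarrow> x \<in> carrier (Gs ! t) \<Longrightarrow> h t x \<in> carrier (M t)"
  using group_hom.hom_closed[OF h_group_hom] by blast

lemma h_mult: "t < k \<Longrightarrow> x \<in> carrier (Gs ! t) \<Longrightarrow> y \<in> carrier (Gs ! t) \<Longrightarrow>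
    h t (x \<otimes>\<^bsub>Gs ! t\<^esub> y) = h t x \<otimes>\<^bsub>M t\<^esub> h t y"
  using group_hom.hom_mult[OF h_group_hom] by blast

lemma h_one: "t < k \<Longrightarrow> h t \<one>\<^bsub>Gs ! t\<^esub> = (0, False)"
  using group_hom.hom_one[OF h_group_hom] by (simp add: one_metacyclic)

lemma h_bij: "t < k \<Longrightarrow> bij_betw (h t) (carrier (Gs ! t)) (carrier (M t))"
  using iso by (simp add: iso_def)

lemma h_inj: "t < k \<Longrightarrow> x \<in> carrier (Gs ! t) \<Longrightarrow> y \<in> carrier (Gs ! t) \<Longrightarrow> h t x = h t y \<longleftrightarrow> x = y"
  using h_bij[of t] inj_on_eq_iff unfolding bij_betw_def by metis

lemma P_group: "group P"
  by (rule product_group) (simp add: grp)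

lemma P_carrier: "f \<in> carrier P \<Longrightarrow> t < k \<Longrightarrow> f t \<in> carrier (Gs ! t)"
  by auto

lemma P_mult: "t < k \<Longrightarrow> (f \<otimes>\<^bsub>P\<^esub> g) t = f t \<otimes>\<^bsub>Gs ! t\<^esub> g t"
  by simp

lemma tw: "twist (plane_grp k) m (\<lambda>v. 0 \<in> fst v) (plane_form e k)"
  by (rule twist_plane_grp[OF m])

lemma Psi_hom: "\<Psi> \<in> hom P W"
proof (rule homI)
  fix f assume "f \<in> carrier P"
  show "\<Psi> f \<in> carrier W"
    unfolding twist.carrier_W[OF tw] \<Psi>_def by (auto simp: plane_grp_def)
next
  fix f g assume f: "f \<in> carrier P" and g: "g \<in> carrier P"
  let ?y = "\<lambda>f t. h t (f t)"
  have y: "?y f t \<in> carrier (M t)" "?y g t \<in> carrier (M t)" "?y (f \<otimes>\<^bsub>P\<^esub> g) t = ?y f t \<otimes>\<^bsub>M t\<^esub> ?y g t"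
    if "t < k" for t
    using h_closed h_mult that P_carrier[OF f that] P_carrier[OF g that] P_mult[OF that] by auto
  have t1: "t \<in> {1..<k} \<Longrightarrow> t < k \<and> M t = metacyclic 1 (e t)" for t by auto
  have J: "snd (?y (f \<otimes>\<^bsub>P\<^esub> g) t) \<longleftrightarrow> snd (?y f t) \<noteq> snd (?y g t)" if "t < k" for t
    unfolding y(3)[OF that] by (cases "?y f t"; cases "?y g t") (simp add: mult_metacyclic)
  have X: "odd (fst (?y (f \<otimes>\<^bsub>P\<^esub> g) t)) \<longleftrightarrow> odd (fst (?y f t)) \<noteq> odd (fst (?y g t))"
    and s: "2 \<le> fst (?y (f \<otimes>\<^bsub>P\<^esub> g) t) \<longleftrightarrow> ((2 \<le> fst (?y f t)) \<noteq> (2 \<le> fst (?y g t)))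
      \<noteq> plane_bit (e t) (odd (fst (?y f t))) (snd (?y f t)) (odd (fst (?y g t))) (snd (?y g t))" if "t \<in> {1..<k}" for t
  proof -
    have t: "t < k" "M t = metacyclic 1 (e t)" using t1[OF that] by auto
    note a = y(1)[OF t(1), unfolded t(2)] y(2)[OF t(1), unfolded t(2)]
    show "odd (fst (?y (f \<otimes>\<^bsub>P\<^esub> g) t)) \<longleftrightarrow> odd (fst (?y f t)) \<noteq> odd (fst (?y g t))"
      unfolding y(3)[OF t(1)] t(2) by (rule MC1_mult(2)[OF a])
    show "2 \<le> fst (?y (f \<otimes>\<^bsub>P\<^esub> g) t) \<longleftrightarrow> ((2 \<le> fst (?y f t)) \<noteq> (2 \<le> fst (?y g t)))
      \<noteq> plane_bit (e t) (odd (fst (?y f t))) (snd (?y f t)) (odd (fst (?y g t))) (snd (?y g t))"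
      unfolding y(3)[OF t(1)] t(2) by (rule MC1_mult(1)[OF a])
  qed
  define sg where "sg = (\<lambda>f. odd (card {t \<in> {1..<k}. 2 \<le> fst (?y f t)}))"
  define b where "b \<longleftrightarrow> plane_form e k (snd (\<Psi> f)) (snd (\<Psi> g))"
  have bb: "b \<longleftrightarrow> odd (card {t \<in> {1..<k}. plane_bit (e t) (odd (fst (?y f t))) (snd (?y f t)) (odd (fst (?y g t))) (snd (?y g t))})"
  proof -
    have "{t \<in> {1..<k}. plane_bit (e t) (t \<in> snd (snd (\<Psi> f))) (t \<in> fst (snd (\<Psi> f))) (t \<in> snd (snd (\<Psi> g))) (t \<in> fst (snd (\<Psi> g)))}
      = {t \<in> {1..<k}. plane_bit (e t) (odd (fst (?y f t))) (snd (?y f t)) (odd (fst (?y g t))) (snd (?y g t))}"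
      by (rule Collect_cong) (auto simp: \<Psi>_def)
    then show ?thesis unfolding b_def plane_form_def by (simp only:)
  qed
  \<comment> \<open>The c-parts add up factor by factor with defect \<open>plane_bit\<close>, and
    the total defect is the value \<open>b\<close> of the form.\<close>
  have sfg: "sg (f \<otimes>\<^bsub>P\<^esub> g) \<longleftrightarrow> (sg f \<noteq> sg g) \<noteq> b"
  proof -
    have "{t \<in> {1..<k}. 2 \<le> fst (?y (f \<otimes>\<^bsub>P\<^esub> g) t)} =
      {t \<in> {1..<k}. ((2 \<le> fst (?y f t)) \<noteq> (2 \<le> fst (?y g t)))
        \<noteq> plane_bit (e t) (odd (fst (?y f t))) (snd (?y f t)) (odd (fst (?y g t))) (snd (?y g t))}"
      by (rule Collect_cong, rule conj_cong[OF HOL.refl], rule s)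
    then show ?thesis
      unfolding sg_def bb by (simp only: odd_card_xor finite_atLeastLessThan)
  qed
  define i j i' j' where "i = fst (?y f 0)" "j = snd (?y f 0)" "i' = fst (?y g 0)" "j' = snd (?y g 0)"
  note ij = i_j_i'_j'_def
  have "fst (?y (f \<otimes>\<^bsub>P\<^esub> g) 0) = (i + i' + 2 ^ m * of_bool (odd i \<and> j')) mod 2 ^ (m + 1)"
    using y(3)[of 0] k e0 mult_metacyclic[where i = i and j = j and i' = i' and j' = j' and m = m and e = "e 0"]
    unfolding ij by simp
  then have 1: "fst (\<Psi> (f \<otimes>\<^bsub>P\<^esub> g)) = ((i + i' + 2 ^ m * of_bool (odd i \<and> j')) mod 2 ^ (m + 1)
    + 2 ^ m * of_bool ((sg f \<noteq> sg g) \<noteq> b)) mod 2 ^ (m + 1)"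
    unfolding sfg[symmetric] by (simp only: \<Psi>_def sg_def fst_conv)
  have 2: "fst (\<Psi> f) = (i + 2 ^ m * of_bool (sg f)) mod 2 ^ (m + 1)" "fst (\<Psi> g) = (i' + 2 ^ m * of_bool (sg g)) mod 2 ^ (m + 1)"
    by (simp_all add: \<Psi>_def sg_def ij)
  have "odd (fst (\<Psi> f)) \<longleftrightarrow> odd i"
    unfolding 2 twist.odd_mod[OF tw] using m by simp
  moreover have "0 \<in> fst (snd (\<Psi> g)) \<longleftrightarrow> j'" using k by (simp add: \<Psi>_def ij)
  ultimately have w: "cw (\<lambda>v. 0 \<in> fst v) (plane_form e k) (\<Psi> f) (\<Psi> g) \<longleftrightarrow> (odd i \<and> j') \<noteq> b"
    by (simp only: cw_def b_def)
  \<comment> \<open>For all values of the four bits the unreduced sums differ by a multiple of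
    2^(m+1).\<close>
  have eq: "((i + i' + 2 ^ m * of_bool w) mod 2 ^ (m + 1) + 2 ^ m * of_bool ((s1 \<noteq> s2) \<noteq> b)) mod 2 ^ (m + 1) =
    ((i + 2 ^ m * of_bool s1) mod 2 ^ (m + 1) + (i' + 2 ^ m * of_bool s2) mod 2 ^ (m + 1) + 2 ^ m * of_bool (w \<noteq> b)) mod (2 ^ (m + 1) :: int)"
    for w s1 s2
  proof -
    have "(2 ^ (m + 1) :: int) dvd (i + i' + 2 ^ m * of_bool w + 2 ^ m * of_bool ((s1 \<noteq> s2) \<noteq> b)) -
      (i + 2 ^ m * of_bool s1 + (i' + 2 ^ m * of_bool s2) + 2 ^ m * of_bool (w \<noteq> b))"
      by (cases w; cases s1; cases s2; cases b) simp_all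
    then have "(i + i' + 2 ^ m * of_bool w + 2 ^ m * of_bool ((s1 \<noteq> s2) \<noteq> b)) mod (2 ^ (m + 1) :: int) =
      (i + 2 ^ m * of_bool s1 + (i' + 2 ^ m * of_bool s2) + 2 ^ m * of_bool (w \<noteq> b)) mod 2 ^ (m + 1)"
      by (simp only: mod_eq_dvd_iff)
    moreover have "(a mod q + c mod q + z) mod q = (a + c + z) mod q" for a c z q :: int
      using mod_add_left_eq[of "a mod q + c mod q" q z] mod_add_left_eq[of "a + c" q z] by (simp only: mod_add_eq)
    ultimately show ?thesis by (simp only: mod_add_left_eq)
  qed
  have "fst (\<Psi> (f \<otimes>\<^bsub>P\<^esub> g)) = fst (\<Psi> f \<otimes>\<^bsub>W\<^esub> \<Psi> g)"
    unfolding twist.mult_W[OF tw] fst_conv w 1 2 by (rule eq)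
  moreover have "snd (\<Psi> (f \<otimes>\<^bsub>P\<^esub> g)) = snd (\<Psi> f \<otimes>\<^bsub>W\<^esub> \<Psi> g)"
  proof -
    have "{t \<in> {..<k}. snd (?y (f \<otimes>\<^bsub>P\<^esub> g) t)} = sym_diff {t \<in> {..<k}. snd (?y f t)} {t \<in> {..<k}. snd (?y g t)}"
      using J by blast
    moreover have "{t \<in> {1..<k}. odd (fst (?y (f \<otimes>\<^bsub>P\<^esub> g) t))} =
      sym_diff {t \<in> {1..<k}. odd (fst (?y f t))} {t \<in> {1..<k}. odd (fst (?y g t))}"
      using X by blast
    ultimately show ?thesis
      unfolding twist.snd_mult_W[OF tw] by (simp only: \<Psi>_def plane_grp_def monoid.simps snd_conv fst_conv)
  qed
  ultimately show "\<Psi> (f \<otimes>\<^bsub>P\<^esub> g) = \<Psi> f \<otimes>\<^bsub>W\<^esub> \<Psi> g" by (rule prod_eqI)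
qed

text \<open>The nontrivial element of the derived subgroup of factor t, as shown in
  \<open>derived_Gs\<close>.\<close>

definition \<kappa> :: "nat \<Rightarrow> 'a" where
  "\<kappa> t = inv_into (carrier (Gs ! t)) (h t) (2 ^ \<mu> t, False)"

lemma h_inv_into:
  assumes "t < k" "y \<in> carrier (M t)"
  shows "inv_into (carrier (Gs ! t)) (h t) y \<in> carrier (Gs ! t)" "h t (inv_into (carrier (Gs ! t)) (h t) y) = y"
  using h_bij[OF assms(1)] assms(2) unfolding bij_betw_def by (auto simp: inv_into_into f_inv_into_f)

lemma kappa: "t < k \<Longrightarrow> \<kappa> t \<in> carrier (Gs ! t)" "t < k \<Longrightarrow> h t (\<kappa> t) = (2 ^ \<mu> t, False)"
proof -
  assume t: "t < k"
  have "(2 ^ \<mu> t, False) \<in> carrier (M t)" unfolding carrier_metacyclic by simp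
  from h_inv_into[OF t this] show "\<kappa> t \<in> carrier (Gs ! t)" "h t (\<kappa> t) = (2 ^ \<mu> t, False)"
    unfolding \<kappa>_def by auto
qed

lemma kappa_iff:
  assumes "t < k" "x \<in> carrier (Gs ! t)"
  shows "x = \<kappa> t \<longleftrightarrow> h t x = (2 ^ \<mu> t, False)" "x = \<one>\<^bsub>Gs ! t\<^esub> \<longleftrightarrow> h t x = (0, False)"
proof -
  interpret group "Gs ! t" by (rule grp[OF assms(1)])
  show "x = \<kappa> t \<longleftrightarrow> h t x = (2 ^ \<mu> t, False)" "x = \<one>\<^bsub>Gs ! t\<^esub> \<longleftrightarrow> h t x = (0, False)"
    unfolding kappa(2)[OF assms(1), symmetric] h_one[OF assms(1), symmetric]
    using h_inj[OF assms(1,2)] kappa(1)[OF assms(1)] one_closed by blast+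
qed

lemma kappa_neq: "t < k \<Longrightarrow> \<kappa> t \<noteq> \<one>\<^bsub>Gs ! t\<^esub>"
  using kappa_iff(2)[OF _ kappa(1)] kappa(2) by simp

lemma derived_Gs: assumes t: "t < k" shows "derived (Gs ! t) (carrier (Gs ! t)) = {\<one>\<^bsub>Gs ! t\<^esub>, \<kappa> t}"
proof -
  interpret group_hom "Gs ! t" "M t" "h t" by (rule h_group_hom[OF t])
  have sub: "derived (Gs ! t) (carrier (Gs ! t)) \<subseteq> carrier (Gs ! t)"
    by (rule G.derived_in_carrier) simp
  have im: "h t ` derived (Gs ! t) (carrier (Gs ! t)) = {(0, False), (2 ^ \<mu> t, False)}"
    using derived_img[of "carrier (Gs ! t)"] h_bij[OF t] derived_metacyclic[OF mu[of t], of "e t"]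
    unfolding bij_betw_def by simp
  show ?thesis
  proof (rule equalityI; rule subsetI)
    fix x assume x: "x \<in> derived (Gs ! t) (carrier (Gs ! t))"
    then have "h t x \<in> {(0, False), (2 ^ \<mu> t, False)}" using im by blast
    then show "x \<in> {\<one>\<^bsub>Gs ! t\<^esub>, \<kappa> t}" using kappa_iff[OF t subsetD[OF sub x]] by blast
  next
    fix x assume x: "x \<in> {\<one>\<^bsub>Gs ! t\<^esub>, \<kappa> t}"
    then have xc: "x \<in> carrier (Gs ! t)" using kappa(1)[OF t] by auto
    then have "h t x \<in> h t ` derived (Gs ! t) (carrier (Gs ! t))"
      unfolding im using x kappa_iff[OF t xc] by blast
    then obtain z where z: "z \<in> derived (Gs ! t) (carrier (Gs ! t))" "h t x = h t z" by blast
    then show "x \<in> derived (Gs ! t) (carrier (Gs ! t))" using h_inj[OF t xc subsetD[OF sub z(1)]] by simp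
  qed
qed

lemma kappa_sq: assumes t: "t < k" shows "\<kappa> t \<otimes>\<^bsub>Gs ! t\<^esub> \<kappa> t = \<one>\<^bsub>Gs ! t\<^esub>" "inv\<^bsub>Gs ! t\<^esub> \<kappa> t = \<kappa> t"
proof -
  interpret group "Gs ! t" by (rule grp[OF t])
  have "even ((2::int) ^ \<mu> t)" using mu[of t] by simp
  then have "h t (\<kappa> t \<otimes>\<^bsub>Gs ! t\<^esub> \<kappa> t) = (0, False)"
    unfolding h_mult[OF t kappa(1)[OF t] kappa(1)[OF t]] kappa(2)[OF t] mult_metacyclic by simp
  then show 1: "\<kappa> t \<otimes>\<^bsub>Gs ! t\<^esub> \<kappa> t = \<one>\<^bsub>Gs ! t\<^esub>"
    using kappa_iff(2)[OF t] kappa(1)[OF t] by blast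
  show "inv\<^bsub>Gs ! t\<^esub> \<kappa> t = \<kappa> t" by (rule inv_equality[OF 1 kappa(1)[OF t] kappa(1)[OF t]])
qed

lemma Psi_surj: "\<Psi> ` carrier P = carrier W"
proof (rule equalityI; rule subsetI)
  fix w assume "w \<in> \<Psi> ` carrier P"
  then show "w \<in> carrier W" using Psi_hom by (auto simp: hom_def)
next
  fix w assume w: "w \<in> carrier W"
  obtain i Y Z where iYX: "w = (i, Y, Z)" by (cases w rule: prod_cases3)
  have c: "i \<in> {0..<2 ^ (m + 1)}" "Y \<subseteq> {..<k}" "Z \<subseteq> {1..<k}"
    using w unfolding twist.carrier_W[OF tw] iYX by (auto simp: plane_grp_def)
  \<comment> \<open>Exponents 0 and 1 outside factor 0 keep the c-parts there trivial, so that the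
    cyclic coordinate is exactly \<open>i\<close>.\<close>
  define y where "y = (\<lambda>t. if t = 0 then (i, 0 \<in> Y) else (of_bool (t \<in> Z), t \<in> Y))"
  define f where "f = (\<lambda>t\<in>{..<k}. inv_into (carrier (Gs ! t)) (h t) (y t))"
  have y: "y t \<in> carrier (M t)" for t
    unfolding y_def carrier_metacyclic using c(1) by auto
  have hf: "h t (f t) = y t" "f t \<in> carrier (Gs ! t)" if "t < k" for t
    using h_inv_into[OF that y] that unfolding f_def by simp_all
  have fP: "f \<in> carrier P" using hf(2) by (simp add: f_def)
  have 1: "{t \<in> {1..<k}. 2 \<le> fst (h t (f t))} = {}"
    using hf(1) by (auto simp: y_def)
  have 2: "fst (h 0 (f 0)) = i" using hf(1)[of 0] k by (simp add: y_def)
  have 3: "{t \<in> {..<k}. snd (h t (f t))} = Y"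
    using c(2) hf(1) by (auto simp: y_def split: if_splits)
  have 4: "{t \<in> {1..<k}. odd (fst (h t (f t)))} = Z"
    using c(3) hf(1) by (auto simp: y_def split: if_splits)
  have "\<Psi> f = w"
    unfolding \<Psi>_def iYX 1 2 3 4 using c(1) by (simp add: mod_pos_pos_trivial)
  then show "w \<in> \<Psi> ` carrier P" using fP by blast
qed

end

context cprod begin

text \<open>On tuples of elements of derived subgroups the cyclic coordinate is 2^m times the number
  of entries \<open>\<kappa> t\<close>. Conversely, a trivial image leaves each coordinate no other
  values.\<close>

lemma Psi_kernel_iff:
  assumes f: "f \<in> carrier P"
  shows "\<Psi> f = \<one>\<^bsub>W\<^esub> \<longleftrightarrow>
    (\<forall>t<k. f t = \<one>\<^bsub>Gs ! t\<^esub> \<or> f t = \<kappa> t) \<and> even (card {t \<in> {..<k}. f t = \<kappa> t})"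
proof -
  let ?y = "\<lambda>t. h t (f t)"
  let ?b = "odd (card {t \<in> {1..<k}. 2 \<le> fst (?y t)})"
  have fc: "f t \<in> carrier (Gs ! t)" if "t < k" for t using P_carrier[OF f that] .
  note iff = kappa_iff[OF _ fc]
  have y0: "fst (?y 0) \<in> {0..<2 ^ (m + 1)}"
    using h_closed[OF _ fc, of 0] k unfolding carrier_metacyclic by auto
  have one: "\<Psi> f = \<one>\<^bsub>W\<^esub> \<longleftrightarrow> (fst (?y 0) + 2 ^ m * of_bool ?b) mod 2 ^ (m + 1) = 0 \<and>
    (\<forall>t<k. \<not> snd (?y t)) \<and> (\<forall>t\<in>{1..<k}. even (fst (?y t)))"
    unfolding \<Psi>_def twist.one_W[OF tw] by (auto simp: plane_grp_def)
  have cond: "(\<forall>t<k. f t = \<one>\<^bsub>Gs ! t\<^esub> \<or> f t = \<kappa> t) \<longleftrightarrow> (fst (?y 0) = 0 \<or> fst (?y 0) = 2 ^ m) \<and>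
    (\<forall>t<k. \<not> snd (?y t)) \<and> (\<forall>t\<in>{1..<k}. even (fst (?y t)))" (is "?L \<longleftrightarrow> ?R")
  proof
    assume L: ?L
    have yt: "?y t = (0, False) \<or> ?y t = (2 ^ \<mu> t, False)" if "t < k" for t
      using L iff[OF that that] that by blast
    have "fst (?y 0) = 0 \<or> fst (?y 0) = 2 ^ m" using yt[of 0] k by auto
    moreover have "\<not> snd (?y t)" if "t < k" for t using yt[OF that] by auto
    moreover have "even (fst (?y t))" if "t \<in> {1..<k}" for t using yt[of t] that by auto
    ultimately show ?R by blast
  next
    assume R: ?R
    show ?L
    proof (intro allI impI)
      fix t assume t: "t < k"
      have "?y t = (0, False) \<or> ?y t = (2 ^ \<mu> t, False)"
      proof (cases "t = 0")
        case True
        then show ?thesis using R t by (cases "?y 0") auto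
      next
        case False
        then have "?y t \<in> carrier (metacyclic 1 (e t))" using h_closed[OF t fc[OF t]] by simp
        from MC1_cases[OF this] have "fst (?y t) = 0 \<or> fst (?y t) = 2"
          using R False t by (elim insertE emptyE) (auto dest!: bspec[of _ _ t])
        then show ?thesis using R False t by (cases "?y t") auto
      qed
      then show "f t = \<one>\<^bsub>Gs ! t\<^esub> \<or> f t = \<kappa> t" using iff[OF t t] by blast
    qed
  qed
  have z: "(fst (?y 0) + 2 ^ m * of_bool ?b) mod 2 ^ (m + 1) = 0 \<longleftrightarrow>
    (fst (?y 0) = 0 \<or> fst (?y 0) = 2 ^ m) \<and> (fst (?y 0) = 2 ^ m \<longleftrightarrow> ?b)"
  proof -
    have lt: "(2::int) ^ m < 2 ^ (m + 1)" by simp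
    have "(x + 2 ^ m * of_bool b) mod 2 ^ (m + 1) = 0 \<longleftrightarrow> (x = 0 \<or> x = 2 ^ m) \<and> (x = 2 ^ m \<longleftrightarrow> b)"
      if x: "x \<in> {0..<2 ^ (m + 1)}" for x :: int and b
    proof (cases b)
      case False
      then show ?thesis using x by (auto simp: mod_pos_pos_trivial)
    next
      case True
      show ?thesis
      proof (cases "x < 2 ^ m")
        case T: True
        then have "(x + 2 ^ m) mod 2 ^ (m + 1) = x + 2 ^ m"
          using x by (intro mod_pos_pos_trivial) auto
        then show ?thesis using True T x by auto
      next
        case F: False
        have "x + 2 ^ m = x - 2 ^ m + 2 ^ (m + 1)" by simp
        then have "(x + 2 ^ m) mod 2 ^ (m + 1) = (x - 2 ^ m) mod 2 ^ (m + 1)" by (simp only: mod_add_self2)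
        also have "\<dots> = x - 2 ^ m" using F x by (subst mod_pos_pos_trivial) auto
        finally show ?thesis using True F by auto
      qed
    qed
    from this[OF y0] show ?thesis .
  qed
  \<comment> \<open>Factor 0 is counted separately: its \<open>\<kappa>\<close> appears as the
    exponent 2^m, those of the other factors as the exponent 2.\<close>
  have par: "even (card {t \<in> {..<k}. f t = \<kappa> t}) \<longleftrightarrow> (fst (?y 0) = 2 ^ m \<longleftrightarrow> ?b)" if R: "\<forall>t<k. f t = \<one>\<^bsub>Gs ! t\<^esub> \<or> f t = \<kappa> t"
  proof -
    have yt: "?y t = (0, False) \<or> ?y t = (2 ^ \<mu> t, False)" if "t < k" for t
      using R iff[OF that that] that by blast
    have N: "{t \<in> {1..<k}. f t = \<kappa> t} = {t \<in> {1..<k}. 2 \<le> fst (?y t)}"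
    proof (rule Collect_cong, rule conj_cong[OF HOL.refl])
      fix t assume t: "t \<in> {1..<k}"
      then have "t < k" "\<mu> t = 1" by auto
      then show "f t = \<kappa> t \<longleftrightarrow> 2 \<le> fst (?y t)" using iff(1)[of t] yt[of t] by auto
    qed
    have 0: "f 0 = \<kappa> 0 \<longleftrightarrow> fst (?y 0) = 2 ^ m" using iff(1)[of 0] yt[of 0] k by auto
    have 1: "{t \<in> {..<k}. f t = \<kappa> t} = (if f 0 = \<kappa> 0 then insert 0 {t \<in> {1..<k}. f t = \<kappa> t} else {t \<in> {1..<k}. f t = \<kappa> t})"
    proof -
      have "{..<k} = insert 0 {1..<k}" using k by auto
      moreover have "{t \<in> insert a S. Q t} = (if Q a then insert a {t \<in> S. Q t} else {t \<in> S. Q t})" for a S Q by auto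
      ultimately show ?thesis by (simp only:)
    qed
    have "card {t \<in> {..<k}. f t = \<kappa> t} = (if f 0 = \<kappa> 0 then Suc (card {t \<in> {1..<k}. f t = \<kappa> t}) else card {t \<in> {1..<k}. f t = \<kappa> t})"
    proof -
      have "0 \<notin> {t \<in> {1..<k}. f t = \<kappa> t}" "finite {t \<in> {1..<k}. f t = \<kappa> t}" by auto
      then have "card (insert 0 {t \<in> {1..<k}. f t = \<kappa> t}) = Suc (card {t \<in> {1..<k}. f t = \<kappa> t})"
        by (intro card_insert_disjoint)
      then show ?thesis unfolding 1 by (rule if_card)
    qed
    then show ?thesis unfolding N 0 by (cases "fst (?y 0) = 2 ^ m") (simp_all only: if_True if_False even_Suc simp_thms)
  qed
  \<comment> \<open>The propositional skeleton that combines \<open>one\<close>,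
    \<open>cond\<close>, \<open>z\<close> and \<open>par\<close>; \<open>Q3\<close> and
    \<open>Q4\<close> are the conjuncts shared by the first two.\<close>
  have "(Q1 \<longleftrightarrow> Q2 \<and> Q3 \<and> Q4) \<Longrightarrow> (Q5 \<longleftrightarrow> Q6 \<and> Q3 \<and> Q4) \<Longrightarrow> (Q2 \<longleftrightarrow> Q6 \<and> Q7) \<Longrightarrow>
    (Q5 \<Longrightarrow> (Q8 \<longleftrightarrow> Q7)) \<Longrightarrow> (Q1 \<longleftrightarrow> Q5 \<and> Q8)" for Q1 Q2 Q3 Q4 Q5 Q6 Q7 Q8
    by blast
  from this[OF one cond z par] show ?thesis .
qed

text \<open>A tuple in the kernel has an even number of entries \<open>\<kappa> t\<close>, and the
  generators are the tuples \<open>z i j\<close> with exactly two. The induction splits off two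
  positions at a time.\<close>

lemma kernel_generate: "kernel P W \<Psi> = generate P (identifying_elems Gs)"
proof -
  interpret P: group P by (rule P_group)
  interpret group_hom P W \<Psi>
    using P_group twist.W_group[OF tw] Psi_hom by (simp add: group_hom_def group_hom_axioms_def)
  let ?I = "identifying_elems Gs"
  define z where "z = (\<lambda>i j. \<lambda>t\<in>{..<k}. if t = i \<or> t = j then \<kappa> t else \<one>\<^bsub>Gs ! t\<^esub>)"
  have one_c: "\<one>\<^bsub>Gs ! t\<^esub> \<in> carrier (Gs ! t)" if "t < k" for t
    using grp[OF that] by (simp add: group.is_monoid monoid.one_closed)
  have zP: "z i j \<in> carrier P" for i j
    using kappa(1) one_c by (auto simp: z_def)
  have I: "?I = {z i j | i j. i < k \<and> j < k \<and> i \<noteq> j}"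
  proof (rule equalityI; rule subsetI)
    fix x assume "x \<in> ?I"
    then obtain i j a b where x: "x = (\<lambda>t\<in>{..<k}. if t = i then a else if t = j then inv\<^bsub>Gs ! j\<^esub> b else \<one>\<^bsub>Gs ! t\<^esub>)"
      and ij: "i < k" "j < k" "i \<noteq> j" and a: "a \<in> derived (Gs ! i) (carrier (Gs ! i))" "a \<noteq> \<one>\<^bsub>Gs ! i\<^esub>"
      and b: "b \<in> derived (Gs ! j) (carrier (Gs ! j))" "b \<noteq> \<one>\<^bsub>Gs ! j\<^esub>"
      unfolding identifying_elems_def len by blast
    have "a = \<kappa> i" using a unfolding derived_Gs[OF ij(1)] by blast
    moreover have "b = \<kappa> j" using b unfolding derived_Gs[OF ij(2)] by blast
    ultimately have "x = z i j"
      unfolding x z_def using kappa_sq(2)[OF ij(2)] ij(3) by (intro restrict_ext) auto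
    then show "x \<in> {z i j | i j. i < k \<and> j < k \<and> i \<noteq> j}" using ij by blast
  next
    fix x assume "x \<in> {z i j | i j. i < k \<and> j < k \<and> i \<noteq> j}"
    then obtain i j where ij: "i < k" "j < k" "i \<noteq> j" and x: "x = z i j" by blast
    have "x = (\<lambda>t\<in>{..<k}. if t = i then \<kappa> i else if t = j then inv\<^bsub>Gs ! j\<^esub> \<kappa> j else \<one>\<^bsub>Gs ! t\<^esub>)"
      unfolding x z_def using kappa_sq(2)[OF ij(2)] ij(3) by (intro restrict_ext) auto
    moreover have "\<kappa> i \<in> derived (Gs ! i) (carrier (Gs ! i))" "\<kappa> i \<noteq> \<one>\<^bsub>Gs ! i\<^esub>"
      "\<kappa> j \<in> derived (Gs ! j) (carrier (Gs ! j))" "\<kappa> j \<noteq> \<one>\<^bsub>Gs ! j\<^esub>"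
      using derived_Gs kappa_neq ij by auto
    ultimately show "x \<in> ?I" unfolding identifying_elems_def len using ij by blast
  qed
  have zval: "z i j t = (if t = i \<or> t = j then \<kappa> t else \<one>\<^bsub>Gs ! t\<^esub>)" if "t < k" for i j t
    using that by (simp add: z_def)
  have ker: "f \<in> kernel P W \<Psi> \<longleftrightarrow> f \<in> carrier P \<and> (\<forall>t<k. f t = \<one>\<^bsub>Gs ! t\<^esub> \<or> f t = \<kappa> t) \<and> even (card {t \<in> {..<k}. f t = \<kappa> t})" for f
    using Psi_kernel_iff[of f] unfolding kernel_def by blast
  show ?thesis
  proof (rule equalityI)
    show "generate P ?I \<subseteq> kernel P W \<Psi>"
    proof (rule P.generate_subgroup_incl)
      show "subgroup (kernel P W \<Psi>) P" by (rule subgroup_kernel)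
      show "?I \<subseteq> kernel P W \<Psi>"
      proof
        fix x assume "x \<in> ?I"
        then obtain i j where ij: "i < k" "j < k" "i \<noteq> j" and x: "x = z i j" unfolding I by blast
        have "{t \<in> {..<k}. z i j t = \<kappa> t} = {i, j}"
        proof (rule equalityI; rule subsetI)
          fix t assume t: "t \<in> {t \<in> {..<k}. z i j t = \<kappa> t}"
          then show "t \<in> {i, j}" using kappa_neq[of t] zval[of t i j] by (auto split: if_splits)
        qed (use ij zval in auto)
        then have "even (card {t \<in> {..<k}. z i j t = \<kappa> t})" using ij by simp
        then show "x \<in> kernel P W \<Psi>" unfolding ker x using zP zval by auto
      qed
    qed
    show "kernel P W \<Psi> \<subseteq> generate P ?I"
    proof
      fix f assume "f \<in> kernel P W \<Psi>"
      then show "f \<in> generate P ?I"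
      proof (induction "card {t \<in> {..<k}. f t = \<kappa> t}" arbitrary: f rule: less_induct)
        case less
        let ?D = "\<lambda>f. {t \<in> {..<k}. f t = \<kappa> t}"
        have f: "f \<in> carrier P" "\<forall>t<k. f t = \<one>\<^bsub>Gs ! t\<^esub> \<or> f t = \<kappa> t" "even (card (?D f))"
          using less.prems unfolding ker by blast+
        show ?case
        proof (cases "?D f = {}")
          case True
          have "f = \<one>\<^bsub>P\<^esub>"
          proof (rule PiE_ext)
            show "f \<in> (\<Pi>\<^sub>E t\<in>{..<k}. carrier (Gs ! t))" using f(1) by simp
            show "\<one>\<^bsub>P\<^esub> \<in> (\<Pi>\<^sub>E t\<in>{..<k}. carrier (Gs ! t))" using P.one_closed by simp
            fix t assume "t \<in> {..<k}"
            then show "f t = \<one>\<^bsub>P\<^esub> t" using f(2) True by auto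
          qed
          then show ?thesis using generate.one[of P] by simp
        next
          case False
          then obtain i where i: "i \<in> ?D f" by blast
          have "?D f \<noteq> {i}" using f(3) by force
          then obtain j where j: "j \<in> ?D f" "i \<noteq> j" using i by blast
          have ij: "i < k" "j < k" using i j by auto
          define g where "g = (\<lambda>t\<in>{..<k}. if t = i \<or> t = j then \<one>\<^bsub>Gs ! t\<^esub> else f t)"
          have gP: "g \<in> carrier P" using f(1) one_c by (auto simp: g_def)
          have gval: "g t = (if t = i \<or> t = j then \<one>\<^bsub>Gs ! t\<^esub> else f t)" if "t < k" for t
            using that by (simp add: g_def)
          have Dg: "?D g = ?D f - {i, j}"
          proof (rule equalityI; rule subsetI)
            fix t assume t: "t \<in> ?D g"
            then show "t \<in> ?D f - {i, j}" using gval[of t] kappa_neq[of t] by (simp split: if_splits)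
          next
            fix t assume t: "t \<in> ?D f - {i, j}"
            then show "t \<in> ?D g" using gval[of t] by simp
          qed
          have "card (?D f) = Suc (Suc (card (?D g)))"
          proof -
            have fD: "finite (?D f)" by simp
            have sub: "{i, j} \<subseteq> ?D f" using i j by blast
            have "card (?D g) = card (?D f) - card {i, j}"
              unfolding Dg by (rule card_Diff_subset[OF _ sub]) simp
            moreover have "card {i, j} \<le> card (?D f)" by (rule card_mono[OF fD sub])
            moreover have "card {i, j} = 2" using j(2) by simp
            ultimately show ?thesis by linarith
          qed
          then have "card (?D g) < card (?D f)" "even (card (?D g))" using f(3) by (simp_all only: even_Suc not_not) 
          moreover have "\<forall>t<k. g t = \<one>\<^bsub>Gs ! t\<^esub> \<or> g t = \<kappa> t" using gval f(2) by auto
          ultimately have "g \<in> generate P ?I" using less.hyps[of g] gP ker by blast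
          moreover have "z i j \<in> generate P ?I" by (rule generate.incl) (use I ij j in blast)
          ultimately have "z i j \<otimes>\<^bsub>P\<^esub> g \<in> generate P ?I" by (intro generate.eng)
          moreover have "z i j \<otimes>\<^bsub>P\<^esub> g = f"
          proof (rule PiE_ext)
            show "z i j \<otimes>\<^bsub>P\<^esub> g \<in> (\<Pi>\<^sub>E t\<in>{..<k}. carrier (Gs ! t))" using P.m_closed[OF zP gP] by simp
            show "f \<in> (\<Pi>\<^sub>E t\<in>{..<k}. carrier (Gs ! t))" using f(1) by simp
            fix t assume t: "t \<in> {..<k}"
            then have tk: "t < k" by simp
            interpret group "Gs ! t" by (rule grp[OF tk])
            show "(z i j \<otimes>\<^bsub>P\<^esub> g) t = f t"
            proof (cases "t = i \<or> t = j")
              case True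
              then have "f t = \<kappa> t" using i j by auto
              then show ?thesis unfolding P_mult[OF tk] zval[OF tk] gval[OF tk] using True kappa(1)[OF tk] by simp
            next
              case False
              then show ?thesis unfolding P_mult[OF tk] zval[OF tk] gval[OF tk] using P_carrier[OF f(1) tk] by simp
            qed
          qed
          ultimately show ?thesis by simp
        qed
      qed
    qed
  qed
qed

lemma central_product_iso: "central_product Gs \<cong> W"
proof -
  interpret group_hom P W \<Psi>
    using P_group twist.W_group[OF tw] Psi_hom by (simp add: group_hom_def group_hom_axioms_def)
  show ?thesis
    using FactGroup_iso[OF Psi_surj] unfolding kernel_generate central_product_def Let_def len .
qed

end

lemma (in cprod) group_central_product: "group (central_product Gs)"
proof -
  interpret group_hom P W \<Psi>
    using P_group twist.W_group[OF tw] Psi_hom by (simp add: group_hom_def group_hom_axioms_def)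
  show ?thesis
    using normal.factorgroup_is_group[OF normal_kernel]
    unfolding kernel_generate central_product_def Let_def len .
qed

section \<open>Involutions that do not commute with a square root of c\<close>

lemma odd_card_single:
  assumes "finite S" "t \<in> S" "\<And>s. s \<in> S \<Longrightarrow> s \<noteq> t \<Longrightarrow> \<not> R s"
  shows "odd (card {s \<in> S. R s}) \<longleftrightarrow> R t"
proof -
  have "{s \<in> S. R s} = (if R t then {t} else {})" using assms(2,3) by auto
  then show ?thesis by simp
qed

lemma plane_form_single:
  assumes "t \<in> {1..<k}" "A \<subseteq> {t}" "C \<subseteq> {t}"
  shows "plane_form e k v (A, C) \<longleftrightarrow> plane_bit (e t) (t \<in> snd v) (t \<in> fst v) (t \<in> C) (t \<in> A)"
    "plane_form e k (A, C) v \<longleftrightarrow> plane_bit (e t) (t \<in> C) (t \<in> A) (t \<in> snd v) (t \<in> fst v)"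
proof -
  have n: "s \<notin> A" "s \<notin> C" if "s \<noteq> t" for s using assms that by auto
  show "plane_form e k v (A, C) \<longleftrightarrow> plane_bit (e t) (t \<in> snd v) (t \<in> fst v) (t \<in> C) (t \<in> A)"
    unfolding plane_form_def fst_conv snd_conv by (rule odd_card_single) (use assms(1) n in \<open>simp_all add: plane_bit_def\<close>)
  show "plane_form e k (A, C) v \<longleftrightarrow> plane_bit (e t) (t \<in> C) (t \<in> A) (t \<in> snd v) (t \<in> fst v)"
    unfolding plane_form_def fst_conv snd_conv by (rule odd_card_single) (use assms(1) n in \<open>simp_all add: plane_bit_def\<close>)
qed

lemma plane_form_zero: "\<not> plane_form e k v ({0}, {})" "\<not> plane_form e k ({0}, {}) v"
proof -
  have "{t \<in> {1..<k}. plane_bit (e t) (t \<in> snd v) (t \<in> fst v) (t \<in> {}) (t \<in> {0})} = {}"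
    "{t \<in> {1..<k}. plane_bit (e t) (t \<in> {}) (t \<in> {0}) (t \<in> snd v) (t \<in> fst v)} = {}"
    by (auto simp: plane_bit_def)
  then show "\<not> plane_form e k v ({0}, {})" "\<not> plane_form e k ({0}, {}) v"
    unfolding plane_form_def fst_conv snd_conv by (simp_all only: card.empty even_zero not_not)
qed

text \<open>The involution is supported on a single plane in which \<open>g\<close> has a nonzero component; only if all
  such planes are of quaternion type is it corrected by an element of order four of the first factor.\<close>

lemma ex_noncommuting_involution:
  assumes k: "k \<ge> 1" and W: "W = cocycle_ext 1 (plane_grp k) (\<lambda>v. 0 \<in> fst v) (plane_form e k)"
    and g: "g \<in> carrier W" "g \<otimes>\<^bsub>W\<^esub> g = twist.cW (plane_grp k) 1"
  shows "\<exists>h\<in>carrier W. h \<otimes>\<^bsub>W\<^esub> h = \<one>\<^bsub>W\<^esub> \<and> g \<otimes>\<^bsub>W\<^esub> h \<noteq> h \<otimes>\<^bsub>W\<^esub> g"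
proof -
  interpret twist "plane_grp k" 1 "\<lambda>v. 0 \<in> fst v" "plane_form e k" by (rule twist_plane_grp) simp
  let ?w = "cw (\<lambda>v. 0 \<in> fst v) (plane_form e k)"
  obtain i Y Z where gi: "g = (i, Y, Z)" by (cases g rule: prod_cases3)
  have main: ?thesis if h: "r = 0 \<or> r = 1" "A \<subseteq> {..<k}" "C \<subseteq> {1..<k}"
    and w: "odd r = ?w (r, A, C) (r, A, C)" "?w g (r, A, C) \<noteq> ?w (r, A, C) g" for r A C
  proof -
    have hc: "(r, A, C) \<in> carrier W" using h unfolding W carrier_W by (auto simp: plane_grp_def)
    have "(r, A, C) \<otimes>\<^bsub>W\<^esub> (r, A, C) = \<one>\<^bsub>W\<^esub>"
      unfolding W W_sq_m1[OF HOL.refl hc[unfolded W]] fst_conv by (simp only: w(1) if_True simp_thms)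
    moreover have "g \<otimes>\<^bsub>W\<^esub> (r, A, C) \<noteq> (r, A, C) \<otimes>\<^bsub>W\<^esub> g"
      using w(2) unfolding W W_commute_iff[OF g(1)[unfolded W] hc[unfolded W]] .
    ultimately show ?thesis using hc by blast
  qed
  note wd = cw_def gi fst_conv snd_conv
  show ?thesis
  proof (cases "\<exists>t\<in>{1..<k}. \<not> e t \<and> (t \<in> Z \<or> t \<in> Y)")
    case True
    then obtain t where t: "t \<in> {1..<k}" "\<not> e t" "t \<in> Z \<or> t \<in> Y" by blast
    \<comment> \<open>In a dihedral plane both b and b a are involutions: b fails to commute with g
      if g has an a-component there, and otherwise b a does.\<close>
    let ?C = "if t \<in> Z then {} else {t}"
    have s: "{t} \<subseteq> {t}" "?C \<subseteq> {t}" by auto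
    show ?thesis
    proof (rule main[of 0 "{t}" ?C])
      show "odd 0 = ?w (0, {t}, ?C) (0, {t}, ?C)"
        unfolding wd plane_form_single[OF t(1) s] by (simp add: plane_bit_def t(2))
      show "?w g (0, {t}, ?C) \<noteq> ?w (0, {t}, ?C) g"
        unfolding wd plane_form_single[OF t(1) s] using t by (auto simp: plane_bit_def)
    qed (use t in auto)
  next
    case noD: False
    show ?thesis
    proof (cases "odd i \<or> 0 \<in> Y")
      case True
      \<comment> \<open>The first factor is dihedral for m = 1: b is used if the exponent of a is
        odd, and otherwise b a.\<close>
      let ?r = "if odd i then 0 else 1 :: int"
      show ?thesis
      proof (rule main[of ?r "{0}" "{}"])
        show "odd ?r = ?w (?r, {0}, {}) (?r, {0}, {})" "?w g (?r, {0}, {}) \<noteq> ?w (?r, {0}, {}) g"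
          unfolding wd using plane_form_zero True by auto
      qed (use k in auto)
    next
      case False
      \<comment> \<open>Now g^2 = c must come from a plane, which is of quaternion type by
        \<open>noD\<close>. An element of this plane not commuting with g is multiplied by a of the
        first factor: both have square c, so the product is an involution, and a commutes with g
        because 0 is not in \<open>Y\<close>.\<close>
      have "\<not> odd (fst g) = ?w g g"
        using g(2) cW(2) unfolding W W_sq_m1[OF HOL.refl g(1)[unfolded W]] by (auto split: if_splits)
      then have "plane_form e k (Y, Z) (Y, Z)" using False unfolding wd by auto
      then have "{t \<in> {1..<k}. plane_bit (e t) (t \<in> Z) (t \<in> Y) (t \<in> Z) (t \<in> Y)} \<noteq> {}"
        unfolding plane_form_def fst_conv snd_conv by (metis card.empty even_zero)
      then obtain t where t: "t \<in> {1..<k}" "plane_bit (e t) (t \<in> Z) (t \<in> Y) (t \<in> Z) (t \<in> Y)" by blast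
      then have zy: "t \<in> Z \<or> t \<in> Y" by (auto simp: plane_bit_def)
      then have et: "e t" using noD t by blast
      have t0: "t \<noteq> 0" using t(1) by auto
      let ?A = "if t \<in> Z then {t} else {}" and ?C = "if t \<in> Z then {} else {t}"
      have s: "?A \<subseteq> {t}" "?C \<subseteq> {t}" by auto
      show ?thesis
      proof (rule main[of 1 ?A ?C])
        show "odd 1 = ?w (1, ?A, ?C) (1, ?A, ?C)"
          unfolding wd plane_form_single[OF t(1) s] using et t0 by (auto simp: plane_bit_def)
        show "?w g (1, ?A, ?C) \<noteq> ?w (1, ?A, ?C) g"
          unfolding wd plane_form_single[OF t(1) s] using et zy False t0 by (auto simp: plane_bit_def)
      qed (use t in auto)
    qed
  qed
qed

section \<open>The Gauss sum\<close>

lemma sum_Pow_insert: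
  assumes "finite S" "s \<notin> S"
  shows "(\<Sum>A\<in>Pow (insert s S). f A) = (\<Sum>A\<in>Pow S. f A + f (insert s A) :: int)"
proof -
  have inj: "inj_on (insert s) (Pow S)"
    using assms(2) by (intro inj_onI) (metis PowD insert_ident subsetD)
  have "(\<Sum>A\<in>Pow (insert s S). f A) = (\<Sum>A\<in>Pow S. f A) + (\<Sum>A\<in>insert s ` Pow S. f A)"
    unfolding Pow_insert using assms by (intro sum.union_disjoint) auto
  also have "(\<Sum>A\<in>insert s ` Pow S. f A) = (\<Sum>A\<in>Pow S. f (insert s A))"
    using sum.reindex[OF inj, of f] by (simp only: o_def)
  finally show ?thesis by (simp only: sum.distrib)
qed

text \<open>Two subsets amount to independent choices of two bits for each t, so the sum of products
  is a product of sums.\<close>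

lemma sum_Pow_prod:
  assumes "finite S"
  shows "(\<Sum>A\<in>Pow S. \<Sum>C\<in>Pow S. \<Prod>t\<in>S. f t (t \<in> A) (t \<in> C) :: int) =
    (\<Prod>t\<in>S. f t False False + f t False True + f t True False + f t True True)"
  using assms
proof (induction S)
  case (insert s S)
  let ?p = "\<lambda>A C. \<Prod>t\<in>S. f t (t \<in> A) (t \<in> C)"
  have 1: "(\<Prod>t\<in>insert s S. f t (t \<in> A') (t \<in> C')) = f s (s \<in> A') (s \<in> C') * ?p A C"
    if "\<And>t. t \<in> S \<Longrightarrow> (t \<in> A') = (t \<in> A)" "\<And>t. t \<in> S \<Longrightarrow> (t \<in> C') = (t \<in> C)" for A C A' C'
    using insert.hyps that by (simp add: prod.insert)
  have 2: "(t \<in> insert s A) = (t \<in> A)" if "t \<in> S" for t A using insert.hyps that by auto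
  have n: "(s \<in> A) = False" if "A \<in> Pow S" for A using that insert.hyps by auto
  let ?q = "f s False False + f s False True + f s True False + f s True True"
  have "(\<Sum>A\<in>Pow (insert s S). \<Sum>C\<in>Pow (insert s S). \<Prod>t\<in>insert s S. f t (t \<in> A) (t \<in> C)) =
    (\<Sum>A\<in>Pow S. \<Sum>C\<in>Pow S. ?q * ?p A C)"
    unfolding sum_Pow_insert[OF insert.hyps]
  proof (rule sum.cong[OF HOL.refl])
    fix A assume A: "A \<in> Pow S"
    show "(\<Sum>C\<in>Pow S. (\<Prod>t\<in>insert s S. f t (t \<in> A) (t \<in> C)) + (\<Prod>t\<in>insert s S. f t (t \<in> A) (t \<in> insert s C))) +
      (\<Sum>C\<in>Pow S. (\<Prod>t\<in>insert s S. f t (t \<in> insert s A) (t \<in> C)) + (\<Prod>t\<in>insert s S. f t (t \<in> insert s A) (t \<in> insert s C))) =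
      (\<Sum>C\<in>Pow S. ?q * ?p A C)"
      unfolding sum.distrib[symmetric]
    proof (rule sum.cong[OF HOL.refl])
      fix C assume C: "C \<in> Pow S"
      have s: "(s \<in> insert s B) = True" for B by simp
      have "(\<Prod>t\<in>insert s S. f t (t \<in> A) (t \<in> C)) = f s False False * ?p A C"
        "(\<Prod>t\<in>insert s S. f t (t \<in> A) (t \<in> insert s C)) = f s False True * ?p A C"
        "(\<Prod>t\<in>insert s S. f t (t \<in> insert s A) (t \<in> C)) = f s True False * ?p A C"
        "(\<Prod>t\<in>insert s S. f t (t \<in> insert s A) (t \<in> insert s C)) = f s True True * ?p A C"
        using 1[of A A C C] 1[of A A "insert s C" C] 1[of "insert s A" A C C] 1[of "insert s A" A "insert s C" C]
        unfolding n[OF A] n[OF C] s by (simp_all only: 2)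
      then show "((\<Prod>t\<in>insert s S. f t (t \<in> A) (t \<in> C)) + (\<Prod>t\<in>insert s S. f t (t \<in> A) (t \<in> insert s C))) +
        ((\<Prod>t\<in>insert s S. f t (t \<in> insert s A) (t \<in> C)) + (\<Prod>t\<in>insert s S. f t (t \<in> insert s A) (t \<in> insert s C))) = ?q * ?p A C"
        by (simp only: distrib_right add.assoc)
    qed
  qed
  also have "\<dots> = ?q * (\<Sum>A\<in>Pow S. \<Sum>C\<in>Pow S. ?p A C)"
    by (simp only: sum_distrib_left)
  finally show ?case unfolding insert.IH prod.insert[OF insert.hyps] .
qed simp

lemma sign_prod:
  assumes "finite S"
  shows "(if odd (card {t \<in> S. R t}) then - 1 else 1 :: int) = (\<Prod>t\<in>S. if R t then - 1 else 1)"
  using assms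
proof (induction S)
  case (insert s S)
  have "{t \<in> insert s S. R t} = (if R s then insert s {t \<in> S. R t} else {t \<in> S. R t})" by auto
  then have "card {t \<in> insert s S. R t} = (if R s then Suc (card {t \<in> S. R t}) else card {t \<in> S. R t})"
    using insert.hyps by simp
  then show ?case using insert by (simp add: prod.insert) (auto simp: insert.IH[symmetric])
qed simp

text \<open>The coordinate 0 is fixed and can be removed. In each remaining plane the four signs
  belong to 1, a, b, b a: in the dihedral case only a has square c, giving 1 - 1 + 1 + 1 = 2, in the
  quaternion case all but 1 do, giving -2.\<close>

lemma sum_signs_plane_grp:
  assumes "k \<ge> 1"
  shows "(\<Sum>v | v \<in> carrier (plane_grp k) \<and> 0 \<in> fst v. if plane_form e k v v then - 1 else 1 :: int) =
    (\<Prod>t\<in>{1..<k}. if e t then - 2 else 2)"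
proof -
  let ?S = "{1..<k}"
  let ?f = "\<lambda>t j x. if plane_bit (e t) x j x j then - 1 else 1 :: int"
  have "(\<Sum>v | v \<in> carrier (plane_grp k) \<and> 0 \<in> fst v. if plane_form e k v v then - 1 else 1 :: int) =
    (\<Sum>(A, C)\<in>Pow ?S \<times> Pow ?S. \<Prod>t\<in>?S. ?f t (t \<in> A) (t \<in> C))"
  proof (rule sum.reindex_bij_witness[where j = "\<lambda>v. (fst v - {0}, snd v)" and i = "\<lambda>v. (insert 0 (fst v), snd v)"])
    fix v assume v: "v \<in> {v. v \<in> carrier (plane_grp k) \<and> 0 \<in> fst v}"
    have "plane_form e k v v \<longleftrightarrow> odd (card {t \<in> ?S. plane_bit (e t) (t \<in> snd v) (t \<in> fst v - {0}) (t \<in> snd v) (t \<in> fst v - {0})})"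
      unfolding plane_form_def by (intro arg_cong[where f = "\<lambda>A. odd (card A)"] Collect_cong) auto
    then show "(case (fst v - {0}, snd v) of (A, C) \<Rightarrow> \<Prod>t\<in>?S. ?f t (t \<in> A) (t \<in> C)) = (if plane_form e k v v then - 1 else 1)"
      by (simp only: prod.case sign_prod[OF finite_atLeastLessThan, symmetric])
    show "(insert 0 (fst (fst v - {0}, snd v)), snd (fst v - {0}, snd v)) = v"
      using v by (auto simp: prod_eq_iff)
    show "(fst v - {0}, snd v) \<in> Pow ?S \<times> Pow ?S" using v by (auto simp: plane_grp_def Suc_le_eq)
  qed (use assms in \<open>auto simp: plane_grp_def prod_eq_iff\<close>)
  also have "\<dots> = (\<Sum>A\<in>Pow ?S. \<Sum>C\<in>Pow ?S. \<Prod>t\<in>?S. ?f t (t \<in> A) (t \<in> C))"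
    by (rule sum.cartesian_product[symmetric])
  also have "\<dots> = (\<Prod>t\<in>?S. ?f t False False + ?f t False True + ?f t True False + ?f t True True)"
    by (rule sum_Pow_prod) simp
  also have "\<dots> = (\<Prod>t\<in>?S. if e t then - 2 else 2)"
    by (intro prod.cong) (auto simp: plane_bit_def)
  finally show ?thesis .
qed

section \<open>Transfer to the given groups\<close>

lemma theta_card_unitaries:
  assumes "theta G (F::'f::finite_field itself) t" "order G + card (\<Omega>\<^sub>1 G) = 2 * s" "s \<ge> 1"
  shows "card (unitaries G :: ('a \<Rightarrow> 'f) set) = t * CARD('f) ^ ((order G + card (\<Omega>\<^sub>1 G)) div 2 - 1)"
  (is "?U = _")
proof -
  have "(?U * CARD('f))\<^sup>2 = (t * CARD('f) ^ s)\<^sup>2"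
    using assms(1) unfolding theta_def assms(2)
    by (simp only: power_mult_distrib power_mult[symmetric] mult.commute[of s])
  then have "?U * CARD('f) = t * CARD('f) ^ s" by (simp only: power2_eq_iff_nonneg zero_le)
  also have "\<dots> = t * CARD('f) ^ (s - 1) * CARD('f)" using assms(3) by (cases s) simp_all
  finally show ?thesis using assms(2) by simp
qed

text \<open>\<open>e\<close> marks the factors of quaternion type: only factor 1, and only for l
  different from 1.\<close>

lemma iso_central_product:
  fixes l :: nat
  assumes m: "m \<ge> 1" and k: "k \<ge> 2" and Gs: "Gs = [M2 (m + 1) 1, if l = 1 then D8 else Q8] @ replicate (k - 2) D8"
    and e: "e = (\<lambda>t. l \<noteq> 1 \<and> t = (1::nat))"
  shows "central_product Gs \<cong> cocycle_ext m (plane_grp k) (\<lambda>v. 0 \<in> fst v) (plane_form e k)" "group (central_product Gs)"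
proof -
  have nth: "Gs ! t = (if t = 0 then M2 (m + 1) 1 else if t = 1 \<and> l \<noteq> 1 then Q8 else D8)" if "t < k" for t
    using that k by (auto simp: Gs nth_Cons' nth_append)
  have grp: "group (Gs ! t)" if "t < k" for t
    unfolding nth[OF that] using M2_metacyclic(2)[OF m] D8_metacyclic(2) Q8_metacyclic(2) by simp
  have iso: "Gs ! t \<cong> metacyclic (if t = 0 then m else 1) (e t)" if "t < k" for t
    unfolding nth[OF that] e using M2_metacyclic(1)[OF m] D8_metacyclic(1) Q8_metacyclic(1)
    by (cases "t = 0"; cases "t = 1"; cases "l = 1") simp_all
  define h where "h = (\<lambda>t. SOME h. h \<in> iso (Gs ! t) (metacyclic (if t = 0 then m else 1) (e t)))"
  have h: "h t \<in> iso (Gs ! t) (metacyclic (if t = 0 then m else 1) (e t))" if "t < k" for t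
    using iso[OF that] unfolding is_iso_def h_def some_in_eq .
  have "length Gs = k" unfolding Gs using k by simp
  moreover have "k \<ge> 1" using k by simp
  moreover have "\<not> e 0" unfolding e by simp
  ultimately have "cprod Gs m k e h"
    by (rule cprod.intro[OF _ _ m _ grp h])
  then interpret cprod Gs m k e h .
  show "central_product Gs \<cong> cocycle_ext m (plane_grp k) (\<lambda>v. 0 \<in> fst v) (plane_form e k)" "group (central_product Gs)"
    by (rule central_product_iso, rule group_central_product)
qed

text \<open>\<open>c\<close> generates a group of order 2, so it is not the identity. Its image is a
  nontrivial element of the other derived subgroup, which leaves only \<open>d\<close>.\<close>

lemma derived_iso_unique:
  assumes "group G" "group H" "h \<in> iso G H" and c: "c \<in> carrier G" "derived G (carrier G) = generate G {c}"
    "card (derived G (carrier G)) = 2" and sub: "derived H (carrier H) \<subseteq> {\<one>\<^bsub>H\<^esub>, d}"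
  shows "h c = d"
proof -
  interpret group_hom G H h
    using assms(1-3) by (simp add: group_hom_def group_hom_axioms_def iso_def)
  have b: "bij_betw h (carrier G) (carrier H)" using assms(3) by (simp add: iso_def)
  have "c \<noteq> \<one>\<^bsub>G\<^esub>"
  proof
    assume "c = \<one>\<^bsub>G\<^esub>"
    then have "generate G {c} = {\<one>\<^bsub>G\<^esub>}" by (simp add: G.generate_one)
    then show False using c(2,3) by simp
  qed
  then have "h c \<noteq> \<one>\<^bsub>H\<^esub>"
    using b c(1) inj_on_eq_iff[of h "carrier G" c "\<one>\<^bsub>G\<^esub>"] by (simp add: bij_betw_def)
  moreover have "c \<in> derived G (carrier G)" unfolding c(2) by (rule generate.incl) simp
  then have "h c \<in> derived H (carrier H)"
    using derived_img[of "carrier G"] b by (simp add: bij_betw_def)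
  ultimately show ?thesis using sub by blast
qed

lemma unitary_count:
  fixes G :: "('a, 'm) monoid_scheme" and l :: nat
  assumes char2: "CHAR('f::finite_field) = 2" and mn: "n > m" "m \<ge> 1" and k: "k \<ge> 2"
    and G: "group G" and iso: "G \<cong>
           central_product ([M2 (m + 1) 1, if l = 1 then D8 else Q8] @ replicate (k - 2) D8)
           \<times>\<times> integer_mod_group (2 ^ n)"
    and c: "c \<in> carrier G" "derived G (carrier G) = generate G {c}" "card (derived G (carrier G)) = 2"
  shows "m = 1 \<Longrightarrow> int (card (\<Omega>\<^sub>1 G)) = 2 ^ (2 * k + 1) + (if l = 1 then 1 else - 1) * 2 ^ (k + 1)"
    "m = 1 \<Longrightarrow> int (card (\<Omega>\<^sub>c G c)) = 2 ^ (2 * k + 1) - (if l = 1 then 1 else - 1) * 2 ^ (k + 1)"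
    "m \<ge> 2 \<Longrightarrow> card (\<Omega>\<^sub>1 G) = 2 ^ (2 * k + 1)"
    "m \<ge> 2 \<Longrightarrow> card (\<Omega>\<^sub>c G c) = 2 ^ (2 * k + 1)"
    "card (unitary_V G :: ('a \<Rightarrow> 'f) set) =
      (if m = 1 then 2 else 4) * CARD('f) ^ ((order G + card (\<Omega>\<^sub>1 G)) div 2 - 1)"
proof -
  define e where "e = (\<lambda>t. l \<noteq> 1 \<and> t = (1::nat))"
  define C where "C = central_product ([M2 (m + 1) 1, if l = 1 then D8 else Q8] @ replicate (k - 2) D8)"
  have "twist_prod TYPE('f) (plane_grp k) m (\<lambda>v. 0 \<in> fst v) (plane_form e k) n"
    using twist_plane_grp[OF mn(2)] char2 mn by (simp add: twist_prod_def twist_prod_axioms_def)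
  then interpret twist_prod "plane_grp k" m "\<lambda>v. 0 \<in> fst v" "plane_form e k" n "TYPE('f)" .
  have C: "C \<cong> W" "group C"
    unfolding C_def using iso_central_product[OF mn(2) k HOL.refl e_def] by blast+
  have "C \<times>\<times> Zn \<cong> GG"
    using group.DirProd_iso_trans[OF C(2,1) iso_refl] .
  with iso have "G \<cong> GG" unfolding C_def[symmetric] by (rule iso_trans)
  then obtain h where h: "h \<in> iso G GG" unfolding is_iso_def by blast
  have hb: "bij_betw h (carrier G) (carrier GG)" and hh: "h \<in> hom G GG" using h by (simp_all add: iso_def)
  have hc: "h c = (cW, 0)"
    by (rule derived_iso_unique[OF G GG_group h c X.derived_subset])
  have h1: "h \<one>\<^bsub>G\<^esub> = \<one>\<^bsub>GG\<^esub>" by (rule hom_one[OF hh G GG_group])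
  have O1: "card (\<Omega>\<^sub>1 G) = card (\<Omega>\<^sub>1 GG)" and Oc: "card (\<Omega>\<^sub>c G c) = card (\<Omega>\<^sub>c GG (cW, 0))"
    using iso_Omega(2)[OF G GG_group h, of "\<one>\<^bsub>G\<^esub>"] iso_Omega(2)[OF G GG_group h c(1)]
    unfolding h1 hc by (simp_all add: G group.is_monoid monoid.one_closed)
  have oG: "order G = order GG" using hb by (simp add: order_def bij_betw_same_card)
  have k2: "2 ^ (2 * k + 1) = 4 * card (carrier (plane_grp k))"
  proof -
    have "2 * k + 1 = 2 + (k + (k - 1))" using k by simp
    then have "(2::nat) ^ (2 * k + 1) = 2 ^ 2 * (2 ^ k * 2 ^ (k - 1))" by (simp only: power_add)
    then show ?thesis by (simp add: card_plane_grp)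
  qed
  have m2: "card (\<Omega>\<^sub>1 G) = 2 ^ (2 * k + 1)" "card (\<Omega>\<^sub>c G c) = 2 ^ (2 * k + 1)" if "m \<ge> 2"
    using card_Omega_m2[OF that] unfolding O1 Oc k2 by blast+
  then show "m \<ge> 2 \<Longrightarrow> card (\<Omega>\<^sub>1 G) = 2 ^ (2 * k + 1)" "m \<ge> 2 \<Longrightarrow> card (\<Omega>\<^sub>c G c) = 2 ^ (2 * k + 1)"
    by blast+
  let ?s = "if l = 1 then 1 else - 1 :: int"
  have m1: "int (card (\<Omega>\<^sub>1 G)) = 2 ^ (2 * k + 1) + ?s * 2 ^ (k + 1)" "int (card (\<Omega>\<^sub>c G c)) = 2 ^ (2 * k + 1) - ?s * 2 ^ (k + 1)"
    if "m = 1"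
  proof -
    \<comment> \<open>Factor 1 alone decides the sign; the remaining factors are dihedral.\<close>
    have "(\<Prod>t\<in>{1..<k}. if e t then - 2 else 2 :: int) = ?s * 2 ^ (k - 1)"
    proof -
      have "{1..<k} = insert 1 {2..<k}" using k by auto
      then have "(\<Prod>t\<in>{1..<k}. if e t then - 2 else 2 :: int) = (if e 1 then - 2 else 2) * (\<Prod>t\<in>{2..<k}. if e t then - 2 else 2)"
        by simp
      also have "(\<Prod>t\<in>{2..<k}. if e t then - 2 else 2 :: int) = (\<Prod>t\<in>{2..<k}. 2)"
        by (rule prod.cong) (auto simp: e_def)
      also have "(if e 1 then - 2 else 2) * (\<Prod>t\<in>{2..<k}. 2) = ?s * (2 * 2 ^ (k - 2) :: int)"
        by (simp add: e_def)
      also have "(2 * 2 ^ (k - 2) :: int) = 2 ^ (k - 1)" using k by (cases k; cases "k - 1") auto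
      finally show ?thesis .
    qed
    then have "int (card (\<Omega>\<^sub>1 W)) - int (card (\<Omega>\<^sub>c W cW)) = 4 * (?s * 2 ^ (k - 1))"
      using card_Omega_m1[OF that] sum_signs_plane_grp[of k e] k by simp
    moreover have "(4 * 2 ^ (k - 1) :: int) = 2 ^ (k + 1)" using k by (cases k) auto
    ultimately have d: "int (card (\<Omega>\<^sub>1 W)) - int (card (\<Omega>\<^sub>c W cW)) = ?s * 2 ^ (k + 1)" by (simp split: if_splits)
    have 1: "card (\<Omega>\<^sub>1 G) = 2 * card (\<Omega>\<^sub>1 W)" "card (\<Omega>\<^sub>c G c) = 2 * card (\<Omega>\<^sub>c W cW)"
      unfolding O1 Oc using card_Omega_GG[OF W.one_closed] card_Omega_GG[OF cW(1)] by simp_all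
    \<comment> \<open>The sum and the difference of the two cardinalities determine both of
      them.\<close>
    have "int (card (\<Omega>\<^sub>1 G)) + int (card (\<Omega>\<^sub>c G c)) = int (2 * 2 ^ (2 * k + 1))"
      unfolding O1 Oc of_nat_add[symmetric] card_Omega_sum k2 by simp
    then have 2: "int (card (\<Omega>\<^sub>1 G)) + int (card (\<Omega>\<^sub>c G c)) = 2 * 2 ^ (2 * k + 1)" by simp
    show "int (card (\<Omega>\<^sub>1 G)) = 2 ^ (2 * k + 1) + ?s * 2 ^ (k + 1)" "int (card (\<Omega>\<^sub>c G c)) = 2 ^ (2 * k + 1) - ?s * 2 ^ (k + 1)"
      using d 1 2 by linarith+
  qed
  then show "m = 1 \<Longrightarrow> int (card (\<Omega>\<^sub>1 G)) = 2 ^ (2 * k + 1) + ?s * 2 ^ (k + 1)"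
    "m = 1 \<Longrightarrow> int (card (\<Omega>\<^sub>c G c)) = 2 ^ (2 * k + 1) - ?s * 2 ^ (k + 1)" by blast+
  have finG: "finite (carrier G)" using hb X.fin bij_betw_finite by blast
  have "theta GG TYPE('f) (if m = 1 then 2 else 4)"
  proof (rule theta_GG)
    fix g assume g: "m = 1" "g \<in> carrier W" "g \<otimes>\<^bsub>W\<^esub> g = cW"
    have "k \<ge> 1" using k by simp
    from ex_noncommuting_involution[OF this HOL.refl] g(2,3)
    show "\<exists>h\<in>carrier W. h \<otimes>\<^bsub>W\<^esub> h = \<one>\<^bsub>W\<^esub> \<and> g \<otimes>\<^bsub>W\<^esub> h \<noteq> h \<otimes>\<^bsub>W\<^esub> g"
      unfolding g(1) by blast
  qed
  then have th: "theta G TYPE('f) (if m = 1 then 2 else 4)"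
    using theta_iso[OF G GG_group \<open>G \<cong> GG\<close> X.fin char2] by blast
  \<comment> \<open>The claim halves the exponent by \<open>div\<close>, so the sum must be even for
    the square root of \<open>theta\<close> to give the stated power.\<close>
  have "even (order G)" unfolding oG order_GG by simp
  moreover have "even (card (\<Omega>\<^sub>1 G))"
    unfolding O1 using card_Omega_GG[OF W.one_closed] by simp
  ultimately obtain s where s: "order G + card (\<Omega>\<^sub>1 G) = 2 * s" by (metis dvdE even_add)
  have "order G > 0" using finG c(1) by (auto simp: order_def card_gt_0_iff)
  then have "s \<ge> 1" using s by linarith
  interpret GA: grp_alg G "TYPE('f)"
    using G finG char2 by (simp add: grp_alg_def grp_alg_axioms_def)
  show "card (unitary_V G :: ('a \<Rightarrow> 'f) set) =
      (if m = 1 then 2 else 4) * CARD('f) ^ ((order G + card (\<Omega>\<^sub>1 G)) div 2 - 1)"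
    unfolding GA.unitary_V_eq by (rule theta_card_unitaries[OF th s \<open>s \<ge> 1\<close>])
qed

theorem theorem4p16:
  fixes G :: "nat \<Rightarrow> ('a, 'm) monoid_scheme" and c :: "nat \<Rightarrow> 'a"
    and m n k :: nat
  assumes char_F: "CHAR('f::finite_field) = 2"
    and "n > m" and "m \<ge> 1" and "k \<ge> 2"
    and "\<And>l. l \<in> {1, 2} \<Longrightarrow> group (G l)"
    and "\<And>l. l \<in> {1, 2} \<Longrightarrow> G l \<cong>
           central_product ([M2 (m + 1) 1, if l = 1 then D8 else Q8] @ replicate (k - 2) D8)
           \<times>\<times> integer_mod_group (2 ^ n)"
    and "\<And>l. l \<in> {1, 2} \<Longrightarrow> c l \<in> carrier (G l)"
    and "\<And>l. l \<in> {1, 2} \<Longrightarrow> derived (G l) (carrier (G l)) = generate (G l) {c l}"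
    and "\<And>l. l \<in> {1, 2} \<Longrightarrow> card (derived (G l) (carrier (G l))) = 2"
  shows "(m = 1 \<longrightarrow>
            card (\<Omega>\<^sub>1 (G 1)) = 2 ^ (2 * k + 1) + 2 ^ (k + 1) \<and>
            card (\<Omega>\<^sub>c (G 2) (c 2)) = 2 ^ (2 * k + 1) + 2 ^ (k + 1) \<and>
            card (\<Omega>\<^sub>c (G 1) (c 1)) = 2 ^ (2 * k + 1) - 2 ^ (k + 1) \<and>
            card (\<Omega>\<^sub>1 (G 2)) = 2 ^ (2 * k + 1) - 2 ^ (k + 1)) \<and>
         (m \<ge> 2 \<longrightarrow>
            (\<forall>l\<in>{1, 2}. card (\<Omega>\<^sub>1 (G l)) = 2 ^ (2 * k + 1) \<and>
                        card (\<Omega>\<^sub>c (G l) (c l)) = 2 ^ (2 * k + 1))) \<and>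
         (\<forall>l\<in>{1, 2}.
            (m = 1 \<longrightarrow>
               card (unitary_V (G l) :: ('a \<Rightarrow> 'f) set) =
                 2 * CARD('f) ^ ((order (G l) + card (\<Omega>\<^sub>1 (G l))) div 2 - 1)) \<and>
            (m \<ge> 2 \<longrightarrow>
               card (unitary_V (G l) :: ('a \<Rightarrow> 'f) set) =
                 4 * CARD('f) ^ ((order (G l) + card (\<Omega>\<^sub>1 (G l))) div 2 - 1)))"
proof -
  note count = unitary_count[OF char_F assms(2-9)]
  \<comment> \<open>Subtraction of natural numbers truncates, so the two powers have to be compared
    before passing from integers.\<close>
  have le: "(2::nat) ^ (k + 1) \<le> 2 ^ (2 * k + 1)" by (rule power_increasing) auto
  have plus: "x = 2 ^ (2 * k + 1) + 2 ^ (k + 1)" if "int x = 2 ^ (2 * k + 1) + 2 ^ (k + 1)" for x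
  proof -
    have "int x = int (2 ^ (2 * k + 1) + 2 ^ (k + 1))" using that by simp
    then show ?thesis by (simp only: of_nat_eq_iff)
  qed
  have minus: "x = 2 ^ (2 * k + 1) - 2 ^ (k + 1)" if "int x = 2 ^ (2 * k + 1) - 2 ^ (k + 1)" for x
  proof -
    have "int x = int (2 ^ (2 * k + 1) - 2 ^ (k + 1))" using that le by (simp add: of_nat_diff)
    then show ?thesis by (simp only: of_nat_eq_iff)
  qed
  have l: "1 \<in> {1, 2::nat}" "2 \<in> {1, 2::nat}" by simp_all
  show ?thesis
  proof (intro conjI impI ballI)
    assume m: "m = 1"
    show "card (\<Omega>\<^sub>1 (G 1)) = 2 ^ (2 * k + 1) + 2 ^ (k + 1)"
      "card (\<Omega>\<^sub>c (G 2) (c 2)) = 2 ^ (2 * k + 1) + 2 ^ (k + 1)"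
      using count(1)[OF l(1) l(1) l(1) l(1) l(1) m] count(2)[OF l(2) l(2) l(2) l(2) l(2) m] by (intro plus; simp)+
    show "card (\<Omega>\<^sub>c (G 1) (c 1)) = 2 ^ (2 * k + 1) - 2 ^ (k + 1)"
      "card (\<Omega>\<^sub>1 (G 2)) = 2 ^ (2 * k + 1) - 2 ^ (k + 1)"
      using count(2)[OF l(1) l(1) l(1) l(1) l(1) m] count(1)[OF l(2) l(2) l(2) l(2) l(2) m] by (intro minus; simp)+
  next
    fix l :: nat assume m: "m \<ge> 2" and l: "l \<in> {1, 2}"
    show "card (\<Omega>\<^sub>1 (G l)) = 2 ^ (2 * k + 1)" "card (\<Omega>\<^sub>c (G l) (c l)) = 2 ^ (2 * k + 1)"
      by (rule count(3)[OF l l l l l m], rule count(4)[OF l l l l l m])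
  next
    fix l :: nat assume l: "l \<in> {1, 2}" and m: "m = 1"
    show "card (unitary_V (G l) :: ('a \<Rightarrow> 'f) set) = 2 * CARD('f) ^ ((order (G l) + card (\<Omega>\<^sub>1 (G l))) div 2 - 1)"
      using count(5)[OF l l l l l] by (simp only: m if_True simp_thms)
  next
    fix l :: nat assume l: "l \<in> {1, 2}" and m: "m \<ge> 2"
    then have "(m = 1) = False" by simp
    then show "card (unitary_V (G l) :: ('a \<Rightarrow> 'f) set) = 4 * CARD('f) ^ ((order (G l) + card (\<Omega>\<^sub>1 (G l))) div 2 - 1)"
      using count(5)[OF l l l l l] by (simp only: if_False)
  qed
qed

end
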